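(* Let $K\in\mathbb{T}^3$. There exist $\gamma_1=\gamma_1(K)>0$ and $\tilde\gamma_1=\tilde\gamma_1(K)>0$ with the following properties. (i) For any $\gamma\in(0,\gamma_1)$ there exists $\lambda_1=\lambda_1(K,\gamma)>0$ such that for any $\lambda>\lambda_1$ the operator $H_{\gamma,\lambda}(K)$ has no eigenvalues below its essential spectrum. (ii) For any $\gamma>\gamma_1$ there exists $\lambda_2=\lambda_2(K,\gamma)>0$ such that for any $\lambda>\lambda_2$ the operator $H_{\gamma,\lambda}(K)$ has an eigenvalue below its essential spectrum. (iii) For any $\gamma>\tilde\gamma_1$ there exists $\lambda_3=\lambda_3(K,\gamma)>0$ such that for any $\lambda>\lambda_3$ the operator $H_{\gamma,\lambda}(K)$ has at least three eigenvalues (counted with multiplicity) below its essential spectrum.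
   Context: $\mathbb{T}^3=(-\pi,\pi]^3$ is the three-dimensional torus (coordinates mod $2\pi$) and $\epsilon(p)=\sum_{i=1}^3(1-\cos p_i)$. For $\gamma>0$ and $K\in\mathbb{T}^3$ put $\mathcal{E}_{\gamma,K}(p,q)=\epsilon(p)+\epsilon(q)+\gamma\,\epsilon(K-p-q)$, $p,q\in\mathbb{T}^3$. Let $L^{2,a}((\mathbb{T}^3)^2)$ be the Hilbert space of $f\in L^2(\mathbb{T}^3\times\mathbb{T}^3)$ with $f(p,q)=-f(q,p)$. For $\lambda\ge0$, $H_{\gamma,\lambda}(K)$ is the bounded self-adjoint operator on $L^{2,a}((\mathbb{T}^3)^2)$ given by $$H_{\gamma,\lambda}(K)f(p,q)=\mathcal{E}_{\gamma,K}(p,q)f(p,q)-\frac{\lambda}{(2\pi)^3}\int_{\mathbb{T}^3}f(s,q)\,ds-\frac{\lambda}{(2\pi)^3}\int_{\mathbb{T}^3}f(p,s)\,ds .$$ "Below its essential spectrum" means smaller than $\inf\sigma_{\mathrm{ess}}(H_{\gamma,\lambda}(K))$. *)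

theory Defs
  imports "HOL-Analysis.Analysis" "HOL-Library.Extended_Nat"
begin

section \<open>Spectral notions on closed subspaces of complex \<open>L\<^sup>2\<close>\<close>

text \<open>
  Elements of \<open>L\<^sup>2\<close> are represented by square-integrable functions; equality of elements
  is equality almost everywhere. Below, \<open>V\<close> is (the set of representatives of) a closed
  subspace of \<open>L\<^sup>2(M)\<close>, and \<open>A\<close> is an operator on \<open>V\<close>, given on
  representatives and compatible with almost everywhere equality.
\<close>

definition L2 :: "'a measure \<Rightarrow> ('a \<Rightarrow> complex) set" where
  "L2 M = {f \<in> borel_measurable M. integrable M (\<lambda>x. (cmod (f x))\<^sup>2)}"

definition l2_norm :: "'a measure \<Rightarrow> ('a \<Rightarrow> complex) \<Rightarrow> real" where
  "l2_norm M f = sqrt (\<integral>x. (cmod (f x))\<^sup>2 \<partial>M)"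

text \<open>
  The resolvent set: \<open>A - z\<close> maps \<open>V\<close> onto \<open>V\<close> and has a bounded inverse. The norm
  estimate expresses both injectivity (up to null sets) and boundedness of the inverse.
\<close>

definition resolvent_set ::
  "'a measure \<Rightarrow> ('a \<Rightarrow> complex) set \<Rightarrow> (('a \<Rightarrow> complex) \<Rightarrow> 'a \<Rightarrow> complex) \<Rightarrow> complex set" where
  "resolvent_set M V A = {z.
     (\<forall>g\<in>V. \<exists>f\<in>V. AE x in M. A f x - z * f x = g x) \<and>
     (\<exists>C. \<forall>f\<in>V. l2_norm M f \<le> C * l2_norm M (\<lambda>x. A f x - z * f x))}"

definition spectrum_of ::
  "'a measure \<Rightarrow> ('a \<Rightarrow> complex) set \<Rightarrow> (('a \<Rightarrow> complex) \<Rightarrow> 'a \<Rightarrow> complex) \<Rightarrow> complex set" where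
  "spectrum_of M V A = - resolvent_set M V A"

definition eigenspace ::
  "'a measure \<Rightarrow> ('a \<Rightarrow> complex) set \<Rightarrow> (('a \<Rightarrow> complex) \<Rightarrow> 'a \<Rightarrow> complex) \<Rightarrow> complex
    \<Rightarrow> ('a \<Rightarrow> complex) set" where
  "eigenspace M V A z = {f \<in> V. AE x in M. A f x = z * f x}"

definition is_eigenvalue ::
  "'a measure \<Rightarrow> ('a \<Rightarrow> complex) set \<Rightarrow> (('a \<Rightarrow> complex) \<Rightarrow> 'a \<Rightarrow> complex) \<Rightarrow> complex \<Rightarrow> bool" where
  "is_eigenvalue M V A z \<longleftrightarrow> (\<exists>f \<in> eigenspace M V A z. \<not> (AE x in M. f x = 0))"

text \<open>Complex linear independence of \<open>f 0, \<dots>, f (n - 1)\<close> modulo null functions.\<close>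

definition lin_indep_AE :: "'a measure \<Rightarrow> nat \<Rightarrow> (nat \<Rightarrow> 'a \<Rightarrow> complex) \<Rightarrow> bool" where
  "lin_indep_AE M n f \<longleftrightarrow>
     (\<forall>c :: nat \<Rightarrow> complex. (AE x in M. (\<Sum>i<n. c i * f i x) = 0) \<longrightarrow> (\<forall>i<n. c i = 0))"

text \<open>The dimension of the eigenspace, possibly infinite, and \<open>0\<close> if \<open>z\<close> is not an eigenvalue.\<close>

definition multiplicity_of ::
  "'a measure \<Rightarrow> ('a \<Rightarrow> complex) set \<Rightarrow> (('a \<Rightarrow> complex) \<Rightarrow> 'a \<Rightarrow> complex) \<Rightarrow> complex \<Rightarrow> enat" where
  "multiplicity_of M V A z =
     Sup {enat n | n. \<exists>f. (\<forall>i<n. f i \<in> eigenspace M V A z) \<and> lin_indep_AE M n f}"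

text \<open>
  For self-adjoint \<open>A\<close>, the discrete spectrum consists of the isolated points of the
  spectrum that are eigenvalues of finite multiplicity.
\<close>

definition discrete_spectrum ::
  "'a measure \<Rightarrow> ('a \<Rightarrow> complex) set \<Rightarrow> (('a \<Rightarrow> complex) \<Rightarrow> 'a \<Rightarrow> complex) \<Rightarrow> complex set" where
  "discrete_spectrum M V A =
     {z. z isolated_in spectrum_of M V A \<and> is_eigenvalue M V A z \<and> multiplicity_of M V A z < \<infinity>}"

definition essential_spectrum ::
  "'a measure \<Rightarrow> ('a \<Rightarrow> complex) set \<Rightarrow> (('a \<Rightarrow> complex) \<Rightarrow> 'a \<Rightarrow> complex) \<Rightarrow> complex set" where
  "essential_spectrum M V A = spectrum_of M V A - discrete_spectrum M V A"

text \<open>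
  The spectrum of a self-adjoint operator is real, so taking real parts loses nothing.
  The infimum is taken in the extended reals to avoid an arbitrary value for the infimum of
  an empty or unbounded set.
\<close>

definition inf_ess_spectrum ::
  "'a measure \<Rightarrow> ('a \<Rightarrow> complex) set \<Rightarrow> (('a \<Rightarrow> complex) \<Rightarrow> 'a \<Rightarrow> complex) \<Rightarrow> ereal" where
  "inf_ess_spectrum M V A = (INF z\<in>essential_spectrum M V A. ereal (Re z))"

definition eigenvalues_below_ess ::
  "'a measure \<Rightarrow> ('a \<Rightarrow> complex) set \<Rightarrow> (('a \<Rightarrow> complex) \<Rightarrow> 'a \<Rightarrow> complex) \<Rightarrow> real set" where
  "eigenvalues_below_ess M V A =
     {e. is_eigenvalue M V A (complex_of_real e) \<and> ereal e < inf_ess_spectrum M V A}"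

text \<open>
  The number of eigenvalues below the essential spectrum, counted with multiplicity: the
  (possibly infinite) sum of all multiplicities, as the supremum of the finite partial sums.
\<close>

definition number_below_ess ::
  "'a measure \<Rightarrow> ('a \<Rightarrow> complex) set \<Rightarrow> (('a \<Rightarrow> complex) \<Rightarrow> 'a \<Rightarrow> complex) \<Rightarrow> enat" where
  "number_below_ess M V A =
     (SUP F\<in>{F. finite F \<and> F \<subseteq> eigenvalues_below_ess M V A}.
        \<Sum>e\<in>F. multiplicity_of M V A (complex_of_real e))"


section \<open>The three-particle operator\<close>

text \<open>
  The torus is represented by its fundamental domain; \<open>K - p - q\<close> need not be reduced
  modulo \<open>2\<pi>\<close>, since it only enters through the \<open>2\<pi>\<close>-periodic function \<open>\<epsilon>\<close>.
\<close>

definition torus :: "(real^3) set" where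
  "torus = {p. \<forall>i. - pi < p $ i \<and> p $ i \<le> pi}"

definition torus_measure :: "(real^3) measure" where
  "torus_measure = restrict_space lborel torus"

definition torus2_measure :: "((real^3) \<times> (real^3)) measure" where
  "torus2_measure = torus_measure \<Otimes>\<^sub>M torus_measure"

definition eps :: "real^3 \<Rightarrow> real" where
  "eps p = (\<Sum>i\<in>UNIV. 1 - cos (p $ i))"

definition E_disp :: "real \<Rightarrow> real^3 \<Rightarrow> real^3 \<Rightarrow> real^3 \<Rightarrow> real" where
  "E_disp \<gamma> K p q = eps p + eps q + \<gamma> * eps (K - p - q)"

definition L2a :: "((real^3) \<times> (real^3) \<Rightarrow> complex) set" where
  "L2a = {f \<in> L2 torus2_measure. AE (p, q) in torus2_measure. f (p, q) = - f (q, p)}"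

definition H_op ::
  "real \<Rightarrow> real \<Rightarrow> real^3 \<Rightarrow> ((real^3) \<times> (real^3) \<Rightarrow> complex) \<Rightarrow> (real^3) \<times> (real^3) \<Rightarrow> complex" where
  "H_op \<gamma> \<mu> K f = (\<lambda>(p, q).
     complex_of_real (E_disp \<gamma> K p q) * f (p, q)
     - complex_of_real (\<mu> / (2 * pi) ^ 3) * (\<integral>s. f (s, q) \<partial>torus_measure)
     - complex_of_real (\<mu> / (2 * pi) ^ 3) * (\<integral>s. f (p, s) \<partial>torus_measure))"

end

theory Submission
  imports Defs
begin

text \<open>On antisymmetric functions the interaction is \<open>\<mu> P\<close>, where \<open>P\<close> is the orthogonal projection onto the functions
  \<open>\<phi> q - \<phi> p\<close> with \<open>\<phi>\<close> of mean zero. For large \<open>\<mu>\<close> the low-lying spectrum is therefore governed by the form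
  \<open>q\<^sub>\<gamma>(\<phi>) = \<integral> eps \<phi>\<^sup>2 + \<gamma>/vol \<integral>\<integral> k \<phi> \<phi>\<close> with \<open>k p q = (\<Sum>i. cos (K\<^sub>i - p\<^sub>i - q\<^sub>i))\<close>, measured from the bottom
  \<open>0\<close> of \<open>eps\<close>, and \<open>\<gamma>\<^sub>1\<close> is the supremum of the \<open>\<gamma>\<close> with \<open>q\<^sub>\<gamma> \<ge> 0\<close>. Above \<open>\<gamma>\<^sub>1\<close> a negative direction of \<open>q\<^sub>\<gamma>\<close> gives an
  eigenvalue: up to the rank of the negative part of \<open>k\<close> the operator is bounded below by its threshold. For \<open>\<gamma> > 12\<close>
  the three functions \<open>sin (p\<^sub>i - K\<^sub>i/2)\<close> span a negative subspace.

  Below \<open>\<gamma>\<^sub>1\<close>, let \<open>\<Lambda>\<^sub>z q = 1 - \<mu>/vol \<integral> 1/(E p q - z) dp\<close>. Zeros of \<open>\<Lambda>\<^sub>z\<close> put \<open>z\<close> into the essential spectrum, so an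
  eigenvalue \<open>e\<close> below it has \<open>\<Lambda>\<^sub>e > 0\<close>, and its eigenvector yields \<open>\<phi>\<close> with
  \<open>\<integral> \<mu> \<Lambda>\<^sub>e \<phi>\<^sup>2 + \<mu>\<^sup>2/vol \<integral>\<integral> \<phi> \<phi>/(E - e) = 0\<close>. As \<open>\<mu> \<rightarrow> \<infinity>\<close> this is a small perturbation of \<open>q\<^sub>\<gamma>(\<phi>) = 0\<close>. The weight \<open>\<mu> \<Lambda>\<^sub>e\<close> may
  be smaller than \<open>eps\<close> near its minimum, but there it still grows quadratically, and since \<open>1/|p|\<^sup>2\<close> is integrable in three
  dimensions the perturbation cannot create a bound state as long as \<open>q\<^sub>\<gamma>\<^sub>'\<close> is nonnegative for some \<open>\<gamma>' > \<gamma>\<close>.\<close>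

section \<open>Bounded symmetric operators on a real Hilbert space\<close>

text \<open>The essential spectrum is never computed; only one-sided bounds enter. For existence it
  is bounded from below: a form inequality with a finite-rank correction leaves finitely many
  spectral points below a level, all isolated and of finite multiplicity. For absence it is bounded
  from above, and since its definition removes isolated eigenvalues of finite multiplicity, a zero
  of \<open>Lam\<close> must also be shown not to be isolated in the spectrum. The eigenvalue
  \<open>e\<close> is only known to lie in a window of width \<open>C\<close> above
  \<open>-\<mu>\<close>. There every denominator is \<open>\<mu>\<close> up to \<open>C\<close>, so
  errors are \<open>O(1/\<mu>)\<close>, uniformly in the energy. Such an error is not small against
  \<open>eps\<close> near the origin, where \<open>eps\<close> vanishes. The way out is that the
  error of a second difference with step \<open>t\<close> is \<open>O(eps t / \<mu>)\<close>:
  together with positivity of the weight this yields quadratic growth around a minimizer whose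
  position is unknown. All kernels are real, so the spectral theory lives on a real Hilbert space
  and a complex function is a pair of its elements.\<close>

lemma coercive_surj:
  fixes S :: "'a::{real_inner,complete_space} \<Rightarrow> 'a"
  assumes S: "bounded_linear S" and c: "0 < c" and coer: "\<And>x. c * (norm x)\<^sup>2 \<le> x \<bullet> S x"
  shows "\<exists>x. S x = g"
proof -
  interpret S: bounded_linear S by fact
  obtain K0 where K0: "\<And>x. norm (S x) \<le> norm x * K0" using S.bounded by blast
  \<comment> \<open>The maximum with \<open>c\<close> keeps the radicand \<open>1 - c^2/K^2\<close>
    nonnegative.\<close>
  define K where "K = max K0 c"
  have K: "norm (S x) \<le> norm x * K" for x
    using K0[of x] by (smt (verit) K_def mult_left_mono norm_ge_zero)
  have Kp: "K > 0" "c \<le> K" using c by (auto simp: K_def)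
  \<comment> \<open>This step minimizes the bound \<open>1 - 2tc + t^2 K^2\<close> for the squared
    Lipschitz constant of \<open>F\<close>; its minimum \<open>1 - c^2/K^2\<close> is below one, so
    \<open>F\<close> is a contraction.\<close>
  define t where "t = c / K\<^sup>2"
  define q where "q = sqrt (1 - c\<^sup>2 / K\<^sup>2)"
  define F where "F x = x - t *\<^sub>R (S x - g)" for x
  have tp: "t > 0" using c Kp by (simp add: t_def)
  have "c\<^sup>2 / K\<^sup>2 \<le> 1" using Kp c by (simp add: power_mono)
  then have q: "0 \<le> q" "q < 1" "q\<^sup>2 = 1 - c\<^sup>2 / K\<^sup>2"
    using c Kp by (auto simp: q_def)
  have est: "norm (x - t *\<^sub>R S x) \<le> q * norm x" for x
  proof (rule power2_le_imp_le)
    have "(norm (x - t *\<^sub>R S x))\<^sup>2 = (norm x)\<^sup>2 - 2 * t * (x \<bullet> S x) + t\<^sup>2 * (norm (S x))\<^sup>2"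
      by (simp add: power2_norm_eq_inner inner_diff_left inner_diff_right inner_commute[of "S x" x]
          power2_eq_square[of t] algebra_simps)
    also have "\<dots> \<le> (norm x)\<^sup>2 - 2 * t * (c * (norm x)\<^sup>2) + t\<^sup>2 * (norm x * K)\<^sup>2"
      using coer[of x] K[of x] tp by (intro add_mono diff_mono mult_left_mono power_mono) auto
    also have "\<dots> = (q * norm x)\<^sup>2"
      unfolding power_mult_distrib q(3) using Kp by (simp add: t_def field_simps power2_eq_square)
    finally show "(norm (x - t *\<^sub>R S x))\<^sup>2 \<le> (q * norm x)\<^sup>2" .
  qed (use q in auto)
  have "\<forall>x y. dist (F x) (F y) \<le> q * dist x y"
  proof (intro allI)
    fix x y
    have "F x - F y = (x - y) - t *\<^sub>R S (x - y)"
      by (simp add: F_def S.diff algebra_simps)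
    then show "dist (F x) (F y) \<le> q * dist x y"
      using est[of "x - y"] by (simp add: dist_norm)
  qed
  then obtain x where "F x = x" using banach_fix_type[OF q(1,2)] by blast
  then show ?thesis using tp by (auto simp: F_def)
qed

text \<open>Gaussian elimination, one equation at a time. The field is arbitrary because real
  combinations of trial vectors and complex combinations of eigenfunctions are both counted this
  way.\<close>

lemma underdetermined_system:
  fixes A :: "'j \<Rightarrow> 'i \<Rightarrow> 'a::field"
  assumes "finite J" "finite I" "card J < card I"
  shows "\<exists>c. (\<exists>i\<in>I. c i \<noteq> 0) \<and> (\<forall>j\<in>J. (\<Sum>i\<in>I. c i * A j i) = 0)"
  using assms
proof (induction J arbitrary: I A rule: finite_induct)
  case empty
  then have "I \<noteq> {}" by auto
  then show ?case by (intro exI[of _ "\<lambda>_. 1"]) auto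
next
  case (insert j0 J)
  show ?case
  proof (cases "\<forall>i\<in>I. A j0 i = 0")
    case True
    have "card J < card I" using insert by auto
    from insert.IH[OF \<open>finite I\<close> this, of A] True show ?thesis by auto
  next
    case False
    then obtain i0 where i0: "i0 \<in> I" "A j0 i0 \<noteq> 0" by blast
    define I' where "I' = I - {i0}"
    have fin: "finite I'" and I: "I = insert i0 I'" "i0 \<notin> I'" using i0 insert by (auto simp: I'_def)
    have "card J < card I'" using insert I fin by auto
    from insert.IH[OF fin this, of "\<lambda>j i. A j i - A j i0 * A j0 i / A j0 i0"]
    obtain c i1 where c: "i1 \<in> I'" "c i1 \<noteq> 0"
      and z: "\<And>j. j \<in> J \<Longrightarrow> (\<Sum>i\<in>I'. c i * (A j i - A j i0 * A j0 i / A j0 i0)) = 0"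
      by blast
    \<comment> \<open>Equation \<open>j0\<close> solved for the coefficient at the pivot
      \<open>i0\<close> gives \<open>- s\<close>.\<close>
    define s where "s = (\<Sum>i\<in>I'. c i * A j0 i) / A j0 i0"
    define d where "d = c(i0 := - s)"
    have sum: "(\<Sum>i\<in>I. d i * A j i) = (\<Sum>i\<in>I'. c i * A j i) - s * A j i0" for j
    proof -
      have "(\<Sum>i\<in>I'. d i * A j i) = (\<Sum>i\<in>I'. c i * A j i)"
        using I by (intro sum.cong) (auto simp: d_def)
      then show ?thesis using fin I by (simp add: d_def)
    qed
    have "(\<Sum>i\<in>I. d i * A j i) = 0" if "j \<in> J" for j
      using z[OF that]
      by (simp add: sum s_def right_diff_distrib sum_subtractf sum_divide_distrib
          sum_distrib_left mult_ac)
    moreover have "(\<Sum>i\<in>I. d i * A j0 i) = 0" using i0 by (simp add: sum s_def)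
    moreover have "\<exists>i\<in>I. d i \<noteq> 0" using c I by (intro bexI[of _ i1]) (auto simp: d_def)
    ultimately show ?thesis by (intro exI[of _ d]) auto
  qed
qed

lemma inner_sum_orthonormal:
  fixes e :: "nat \<Rightarrow> 'a::real_inner"
  assumes "\<And>i j. i < k \<Longrightarrow> j < k \<Longrightarrow> e i \<bullet> e j = (if i = j then 1 else 0)" "j < k"
  shows "e j \<bullet> (\<Sum>i<k. a i *\<^sub>R e i) = a j"
proof -
  have "e j \<bullet> (\<Sum>i<k. a i *\<^sub>R e i) = (\<Sum>i<k. a i * (e j \<bullet> e i))"
    by (simp add: inner_sum_right)
  also have "\<dots> = (\<Sum>i<k. if i = j then a i else 0)"
    using assms by (intro sum.cong) auto
  finally show ?thesis using assms by simp
qed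

text \<open>A minimizing sequence of the Rayleigh quotient has a subsequence along which \<open>L\<close> converges;
  the form inequality then makes this subsequence Cauchy.\<close>

lemma minimizer_is_eigenvector:
  fixes T :: "'a::{real_inner,complete_space} \<Rightarrow> 'a" and L :: "'a \<Rightarrow> 'b::euclidean_space"
  assumes T: "bounded_linear T" and sym: "\<And>x y. T x \<bullet> y = x \<bullet> T y"
    and L: "bounded_linear L"
    and form: "\<And>x. m * (norm x)\<^sup>2 \<le> x \<bullet> T x + (norm (L x))\<^sup>2"
    and W: "subspace W" "closed W" "\<And>x. x \<in> W \<Longrightarrow> T x \<in> W"
    and x0: "x0 \<in> W" "x0 \<bullet> T x0 < m * (norm x0)\<^sup>2"
  shows "\<exists>l<m. \<exists>e\<in>W. norm e = 1 \<and> T e = l *\<^sub>R e"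
proof -
  interpret T: bounded_linear T by fact
  interpret L: bounded_linear L by fact
  obtain K where K: "K > 0" "\<And>x. norm (T x) \<le> norm x * K" using T.pos_bounded by blast
  obtain KL where KL: "KL > 0" "\<And>x. norm (L x) \<le> norm x * KL" using L.pos_bounded by blast
  define R where "R = (\<lambda>x. x \<bullet> T x) ` {x\<in>W. norm x = 1}"
  have bd: "\<bar>x \<bullet> T x\<bar> \<le> K * (norm x)\<^sup>2" for x
    using Cauchy_Schwarz_ineq2[of x "T x"] K(2)[of x]
    by (smt (verit) mult.assoc mult.commute mult_left_mono norm_ge_zero power2_eq_square)
  have R_bdd: "bdd_below R"
    unfolding R_def by (rule bdd_belowI2[where m = "- K"]) (use bd in \<open>metis (mono_tags, lifting) abs_le_D2 mem_Collect_eq minus_le_iff mult.right_neutral power_one\<close>)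
  have x0n: "norm x0 > 0"
  proof (rule ccontr)
    assume "\<not> norm x0 > 0"
    then have "x0 = 0" by simp
    then show False using x0 by simp
  qed
  define u where "u = x0 /\<^sub>R norm x0"
  have u: "u \<in> W" "norm u = 1" "u \<bullet> T u < m"
  proof -
    show "u \<in> W" using W x0 by (simp add: u_def subspace_scale)
    show "norm u = 1" using x0n by (simp add: u_def)
    have [simp]: "norm x0 \<noteq> 0" using x0n by simp
    have "u \<bullet> T u = (x0 \<bullet> T x0) / (norm x0)\<^sup>2"
      by (simp add: u_def T.scaleR power2_eq_square divide_inverse)
    then show "u \<bullet> T u < m" using x0(2) x0n by (simp add: pos_divide_less_eq)
  qed
  define l where "l = Inf R"
  have Rne: "R \<noteq> {}" using u by (auto simp: R_def)
  have l_le: "l * (norm x)\<^sup>2 \<le> x \<bullet> T x" if "x \<in> W" for x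
  proof (cases "x = 0")
    case False
    then have "norm x > 0" by simp
    have "(x /\<^sub>R norm x) \<bullet> T (x /\<^sub>R norm x) \<in> R"
      unfolding R_def using W that False by (intro imageI) (auto simp: subspace_scale)
    then have "l \<le> (x /\<^sub>R norm x) \<bullet> T (x /\<^sub>R norm x)"
      unfolding l_def by (rule cInf_lower[OF _ R_bdd])
    also have "\<dots> = (x \<bullet> T x) / (norm x)\<^sup>2"
      by (simp add: T.scaleR power2_eq_square divide_inverse)
    finally show ?thesis using \<open>norm x > 0\<close> by (simp add: divide_simps)
  qed (simp add: T.zero)
  have lm: "l < m"
  proof -
    have "l \<le> u \<bullet> T u" unfolding l_def by (rule cInf_lower[OF _ R_bdd]) (use u in \<open>auto simp: R_def\<close>)
    then show ?thesis using u by simp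
  qed
  define Q where "Q x = x \<bullet> T x - l * (norm x)\<^sup>2" for x
  have Q0: "0 \<le> Q x" if "x \<in> W" for x using l_le[OF that] by (simp add: Q_def)
  have "\<exists>x\<in>W. norm x = 1 \<and> Q x < 1 / Suc n" for n
  proof -
    have "\<exists>r\<in>R. r < l + 1 / Suc n"
      using cInf_lessD[OF Rne, of "l + 1 / Suc n"] by (auto simp: l_def)
    then show ?thesis by (auto simp: R_def Q_def)
  qed
  then obtain f where f: "\<And>n. f n \<in> W" "\<And>n. norm (f n) = 1" "\<And>n. Q (f n) < 1 / Suc n"
    by metis
  have "bounded (range (\<lambda>n. L (f n)))"
    unfolding bounded_iff using KL(2) f(2) by (metis (no_types, lifting) mult_1 rangeE)
  then obtain a r where r: "strict_mono r" "(\<lambda>n. L (f (r n))) \<longlonglongrightarrow> a"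
    using bounded_imp_convergent_subsequence[of "\<lambda>n. L (f n)"] by (auto simp: o_def)
  define g where "g n = f (r n)" for n
  have g: "g n \<in> W" "norm (g n) = 1" for n using f by (auto simp: g_def)
  have Qg: "Q (g n) < 1 / Suc n" for n
  proof -
    have "Q (g n) < 1 / Suc (r n)" using f by (simp add: g_def)
    also have "\<dots> \<le> 1 / Suc n" using seq_suble[OF r(1), of n] by (simp add: frac_le)
    finally show ?thesis .
  qed
  \<comment> \<open>Parallelogram law for the form \<open>Q\<close>, which is nonnegative on
    \<open>W\<close>.\<close>
  have Q_diff: "Q (x - y) \<le> 2 * Q x + 2 * Q y" if "x \<in> W" "y \<in> W" for x y
  proof -
    have "Q (x - y) + Q (x + y) = 2 * Q x + 2 * Q y"
      by (simp add: Q_def T.add T.diff power2_norm_eq_inner inner_add_left inner_add_right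
          inner_diff_left inner_diff_right algebra_simps)
    moreover have "0 \<le> Q (x + y)" using that W by (intro Q0) (auto simp: subspace_add)
    ultimately show ?thesis by linarith
  qed
  have Lg: "Cauchy (\<lambda>n. L (g n))" using r by (auto simp: g_def intro: LIMSEQ_imp_Cauchy)
  have "Cauchy g"
  proof (rule metric_CauchyI)
    fix e :: real assume e: "e > 0"
    \<comment> \<open>The assumption \<open>form\<close> bounds \<open>m - l\<close> times the
      squared norm by \<open>Q x\<close> plus the squared norm of \<open>L x\<close>; allowing
      \<open>d / 2\<close> to each summand gives distance below \<open>e\<close>.\<close>
    define d where "d = (m - l) * e\<^sup>2"
    have d: "d > 0" using lm e by (simp add: d_def)
    obtain N1 where N1: "\<And>i j. i \<ge> N1 \<Longrightarrow> j \<ge> N1 \<Longrightarrow> dist (L (g i)) (L (g j)) < sqrt (d / 2)"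
      using metric_CauchyD[OF Lg, of "sqrt (d/2)"] d by auto
    obtain N2 where N2: "1 / Suc N2 < d / 8" using reals_Archimedean[of "d/8"] d by (auto simp: inverse_eq_divide)
    show "\<exists>M. \<forall>i\<ge>M. \<forall>j\<ge>M. dist (g i) (g j) < e"
    proof (intro exI[of _ "max N1 N2"] allI impI)
      fix i j assume ij: "max N1 N2 \<le> i" "max N1 N2 \<le> j"
      have Qs: "Q (g n) < d / 8" if "N2 \<le> n" for n
      proof -
        have "1 / real (Suc n) \<le> 1 / Suc N2" using that by (simp add: frac_le)
        then show ?thesis using Qg[of n] N2 by linarith
      qed
      have "Q (g i - g j) < d / 2"
        using Q_diff[OF g(1)[of i] g(1)[of j]] Qs[of i] Qs[of j] ij by simp
      moreover have "(norm (L (g i - g j)))\<^sup>2 < d / 2"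
      proof -
        have "norm (L (g i - g j)) < sqrt (d / 2)" using N1[of i j] ij by (simp add: dist_norm L.diff)
        then have "(norm (L (g i - g j)))\<^sup>2 < (sqrt (d / 2))\<^sup>2" by (intro power_strict_mono) auto
        then show ?thesis using d by simp
      qed
      ultimately have "(m - l) * (norm (g i - g j))\<^sup>2 < d"
        using form[of "g i - g j"] by (simp add: Q_def algebra_simps)
      then have "(norm (g i - g j))\<^sup>2 < e\<^sup>2" using lm by (simp add: d_def)
      then show "dist (g i) (g j) < e" using e by (simp add: dist_norm power2_less_imp_less)
    qed
  qed
  then obtain e where e: "g \<longlonglongrightarrow> e" using Cauchy_convergent convergent_def by blast
  have eW: "e \<in> W" using closed_sequentially[OF W(2) g(1) e] .
  have "(\<lambda>n. norm (g n)) \<longlonglongrightarrow> norm e" by (intro tendsto_intros e)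
  then have en: "norm e = 1" using g(2) by (simp add: LIMSEQ_const_iff)
  have "(\<lambda>n. Q (g n)) \<longlonglongrightarrow> Q e"
    unfolding Q_def by (intro tendsto_intros e T.tendsto)
  moreover have "(\<lambda>n. Q (g n)) \<longlonglongrightarrow> 0"
  proof (rule tendsto_sandwich[OF _ _ tendsto_const LIMSEQ_inverse_real_of_nat])
    show "\<forall>\<^sub>F n in sequentially. 0 \<le> Q (g n)" using Q0 g by auto
    show "\<forall>\<^sub>F n in sequentially. Q (g n) \<le> inverse (real (Suc n))"
      using Qg by (intro always_eventually allI) (auto simp: inverse_eq_divide intro: less_imp_le)
  qed
  ultimately have Qe: "Q e = 0" using LIMSEQ_unique by blast
  \<comment> \<open>Moving from the minimizer against its residual \<open>h\<close> by
    \<open>1 / C\<close> changes \<open>Q\<close> from 0 to at most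
    \<open>- (h \<bullet> h) / C\<close>. As \<open>Q\<close> is nonnegative on \<open>W\<close>,
    the residual vanishes.\<close>
  define h where "h = T e - l *\<^sub>R e"
  have hW: "h \<in> W" using W eW by (simp add: h_def subspace_diff subspace_scale)
  define C where "C = K + \<bar>l\<bar>"
  have C: "C > 0" using K by (simp add: C_def)
  have "0 \<le> Q (e - (1 / C) *\<^sub>R h)"
    using W eW hW by (intro Q0) (simp add: subspace_diff subspace_scale)
  also have "Q (e - (1 / C) *\<^sub>R h) = Q e - 2 / C * (h \<bullet> h) + (1 / C)\<^sup>2 * Q h"
  proof -
    have 1: "e \<bullet> T h = h \<bullet> T e" "e \<bullet> h = h \<bullet> e"
      using sym[of e h] inner_commute[of "T e" h] inner_commute[of e h] by simp_all
    have "Q (e - s *\<^sub>R h) = Q e - 2 * s * (h \<bullet> T e - l * (h \<bullet> e)) + s\<^sup>2 * Q h" for s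
      by (simp add: Q_def T.diff T.scaleR power2_norm_eq_inner inner_diff_left inner_diff_right 1)
        (simp add: power2_eq_square algebra_simps)
    moreover have "h \<bullet> h = h \<bullet> T e - l * (h \<bullet> e)"
      by (subst (2) h_def) (simp add: inner_diff_right)
    ultimately show ?thesis by simp
  qed
  also have "\<dots> \<le> - 2 / C * (h \<bullet> h) + (1 / C)\<^sup>2 * (C * (h \<bullet> h))"
  proof -
    have "\<bar>l * (norm h)\<^sup>2\<bar> = \<bar>l\<bar> * (norm h)\<^sup>2" by (simp add: abs_mult)
    then have "Q h \<le> C * (h \<bullet> h)"
      using bd[of h] by (simp add: Q_def C_def power2_norm_eq_inner algebra_simps)
    then show ?thesis using Qe C by (simp add: mult_left_mono)
  qed
  also have "\<dots> = - (h \<bullet> h) / C" using C by (simp add: field_simps power2_eq_square)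
  finally have "h \<bullet> h \<le> 0" using C by (simp add: divide_simps)
  then have "h = 0" using inner_ge_zero[of h] by (metis inner_eq_zero_iff order_antisym)
  then have "T e = l *\<^sub>R e" by (simp add: h_def)
  then show ?thesis using lm eW en by blast
qed

text \<open>The eigenvectors below \<open>m\<close> are exhausted one at a time; their number is at most the rank of \<open>L\<close>.\<close>

lemma finite_spectrum_below:
  fixes T :: "'a::{real_inner,complete_space} \<Rightarrow> 'a" and L :: "'a \<Rightarrow> 'b::euclidean_space"
  assumes T: "bounded_linear T" and sym: "\<And>x y. T x \<bullet> y = x \<bullet> T y"
    and L: "bounded_linear L"
    and form: "\<And>x. m * (norm x)\<^sup>2 \<le> x \<bullet> T x + (norm (L x))\<^sup>2"
  obtains k :: nat and e :: "nat \<Rightarrow> 'a" and l :: "nat \<Rightarrow> real"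
  where "\<forall>i<k. \<forall>j<k. e i \<bullet> e j = (if i = j then 1 else 0)"
    and "\<forall>i<k. T (e i) = l i *\<^sub>R e i"
    and "\<forall>i<k. l i < m"
    and "\<forall>x. (\<forall>i<k. e i \<bullet> x = 0) \<longrightarrow> m * (norm x)\<^sup>2 \<le> x \<bullet> T x"
proof -
  interpret T: bounded_linear T by fact
  interpret L: bounded_linear L by fact
  define good where "good k e l \<longleftrightarrow> (\<forall>i<k. \<forall>j<k. e i \<bullet> e j = (if i = j then 1 else 0)) \<and>
    (\<forall>i<k. T (e i) = l i *\<^sub>R e i \<and> l i < m)" for k :: nat and e :: "nat \<Rightarrow> 'a" and l :: "nat \<Rightarrow> real"
  \<comment> \<open>With more eigenvectors than dimensions in the target of \<open>L\<close>, a
    nonzero combination of them is killed by \<open>L\<close>. The form is at least \<open>m\<close>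
    there, but strictly below \<open>m\<close> on the span.\<close>
  have bound: "k \<le> DIM('b)" if G: "good k e l" for k e l
  proof (rule ccontr)
    assume "\<not> k \<le> DIM('b)"
    then have "card (Basis :: 'b set) < card {..<k}" by simp
    from underdetermined_system[OF finite_Basis finite_lessThan this, of "\<lambda>b i. L (e i) \<bullet> b"]
    obtain c where c: "\<exists>i<k. c i \<noteq> 0" and z: "\<And>b. b \<in> Basis \<Longrightarrow> (\<Sum>i<k. c i * (L (e i) \<bullet> b)) = 0"
      by auto
    define x where "x = (\<Sum>i<k. c i *\<^sub>R e i)"
    have ex: "e j \<bullet> x = c j" if "j < k" for j
      unfolding x_def using G that by (intro inner_sum_orthonormal) (auto simp: good_def)
    have "L x = 0"
    proof (rule euclidean_eqI)
      fix b :: 'b assume "b \<in> Basis"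
      then show "L x \<bullet> b = 0 \<bullet> b" using z by (simp add: x_def L.sum L.scaleR inner_sum_left)
    qed
    then have "m * (norm x)\<^sup>2 \<le> x \<bullet> T x" using form[of x] by simp
    moreover have "(norm x)\<^sup>2 = (\<Sum>i<k. (c i)\<^sup>2)"
      unfolding power2_norm_eq_inner
      by (subst (1) x_def) (simp add: inner_sum_left ex power2_eq_square)
    moreover have "x \<bullet> T x = (\<Sum>i<k. l i * (c i)\<^sup>2)"
    proof -
      have "x \<bullet> T x = T x \<bullet> x" by (simp add: inner_commute)
      also have "\<dots> = (\<Sum>i<k. c i *\<^sub>R T (e i)) \<bullet> x" by (simp add: x_def T.sum T.scaleR)
      also have "\<dots> = (\<Sum>i<k. l i * (c i)\<^sup>2)"
        unfolding inner_sum_left using G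
        by (intro sum.cong) (auto simp: good_def ex power2_eq_square)
      finally show ?thesis .
    qed
    moreover have "(\<Sum>i<k. l i * (c i)\<^sup>2) < (\<Sum>i<k. m * (c i)\<^sup>2)"
    proof (rule sum_strict_mono_ex1)
      show "\<forall>i\<in>{..<k}. l i * (c i)\<^sup>2 \<le> m * (c i)\<^sup>2"
        using G by (fastforce simp: good_def intro: mult_right_mono)
      show "\<exists>i\<in>{..<k}. l i * (c i)\<^sup>2 < m * (c i)\<^sup>2"
      proof -
        obtain i where "i < k" "c i \<noteq> 0" using c by blast
        then show ?thesis using G by (intro bexI[of _ i] mult_strict_right_mono) (auto simp: good_def)
      qed
    qed simp
    ultimately show False by (simp add: sum_distrib_left)
  qed
  define N where "N = {k. \<exists>e l. good k e l}"
  have "N \<subseteq> {..DIM('b)}" using bound by (auto simp: N_def)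
  then have N: "finite N" using finite_subset by blast
  have "0 \<in> N" by (auto simp: N_def good_def)
  then have "Max N \<in> N" using N Max_in by blast
  then obtain k e l where G: "good k e l" and k: "k = Max N" by (auto simp: N_def)
  have max: "k' \<le> k" if "good k' e' l'" for k' e' l'
    using that N by (auto simp: k N_def intro!: Max_ge)
  define W where "W = {x. \<forall>i<k. e i \<bullet> x = 0}"
  have W: "subspace W"
    by (auto simp: W_def subspace_def inner_add_right)
  have "W = (\<Inter>i\<in>{..<k}. {x. e i \<bullet> x = 0})" by (auto simp: W_def)
  then have Wc: "closed W"
    by (auto intro!: closed_INT closed_Collect_eq continuous_intros)
  have WT: "T x \<in> W" if "x \<in> W" for x
    using that G by (auto simp: W_def good_def simp flip: sym)
  have "m * (norm x)\<^sup>2 \<le> x \<bullet> T x" if "\<And>i. i < k \<Longrightarrow> e i \<bullet> x = 0" for x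
  proof (rule ccontr)
    assume "\<not> ?thesis"
    moreover have "x \<in> W" using that by (simp add: W_def)
    ultimately obtain l' e' where e': "l' < m" "e' \<in> W" "norm e' = 1" "T e' = l' *\<^sub>R e'"
      using minimizer_is_eigenvector[OF T sym L form W Wc WT, of x] by fastforce
    have "e' \<bullet> e' = 1" using e' by (simp add: dot_square_norm)
    then have "good (Suc k) (e(k := e')) (l(k := l'))"
      using G e' by (auto simp: good_def W_def less_Suc_eq inner_commute)
    then show False using max by fastforce
  qed
  then show ?thesis using that[of k e l] G by (auto simp: good_def)
qed

text \<open>One half of the min-max principle: for \<open>k < n\<close> some nontrivial combination
  of the trial vectors is orthogonal to every \<open>e i\<close>, where the form is at least
  \<open>m\<close>.\<close>

lemma eigenvector_count_ge_trial:
  fixes T :: "'a::real_inner \<Rightarrow> 'a"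
  assumes orth: "\<forall>x. (\<forall>i<k. e i \<bullet> x = 0) \<longrightarrow> m * (norm x)\<^sup>2 \<le> x \<bullet> T x"
    and trial: "\<And>c :: nat \<Rightarrow> real. \<exists>i<n. c i \<noteq> 0 \<Longrightarrow>
      (\<Sum>i<n. c i *\<^sub>R u i) \<bullet> T (\<Sum>i<n. c i *\<^sub>R u i) < m * (norm (\<Sum>i<n. c i *\<^sub>R u i))\<^sup>2"
  shows "n \<le> (k::nat)"
proof (rule ccontr)
  assume "\<not> n \<le> k"
  then have "card {..<k} < card {..<n}" by simp
  from underdetermined_system[OF finite_lessThan finite_lessThan this, of "\<lambda>j i. e j \<bullet> u i"]
  obtain c where c: "\<exists>i<n. c i \<noteq> 0" and z: "\<And>j. j < k \<Longrightarrow> (\<Sum>i<n. c i * (e j \<bullet> u i)) = 0"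
    by auto
  have "m * (norm (\<Sum>i<n. c i *\<^sub>R u i))\<^sup>2 \<le> (\<Sum>i<n. c i *\<^sub>R u i) \<bullet> T (\<Sum>i<n. c i *\<^sub>R u i)"
    using orth z by (simp add: inner_sum_right)
  then show False using trial[OF c] by simp
qed

lemma eigenvector_in_complement_zero:
  fixes T :: "'a::real_inner \<Rightarrow> 'a"
  assumes orth: "\<forall>x. (\<forall>i<k. e i \<bullet> x = 0) \<longrightarrow> m * (norm x)\<^sup>2 \<le> x \<bullet> T x"
    and x: "T x = a *\<^sub>R x" "a < m" "\<And>i. i < (k::nat) \<Longrightarrow> e i \<bullet> x = 0"
  shows "x = 0"
proof -
  have "m * (norm x)\<^sup>2 \<le> x \<bullet> T x" using orth x(3) by blast
  also have "\<dots> = a * (norm x)\<^sup>2" by (simp add: x(1) power2_norm_eq_inner)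
  finally have "m * (norm x)\<^sup>2 \<le> a * (norm x)\<^sup>2" .
  then have "(m - a) * (norm x)\<^sup>2 \<le> 0" by (simp add: algebra_simps)
  then show ?thesis using x(2) by (simp add: mult_le_0_iff)
qed

text \<open>\<open>T\<close> leaves the span of the \<open>e i\<close> and its orthogonal complement
  invariant, so Pythagoras splits the estimate. The distance of \<open>a\<close> to the eigenvalues
  governs the span, coercivity with constant \<open>m - a\<close> the complement.\<close>

lemma bounded_below_off_eigenvalues:
  fixes T :: "'a::real_inner \<Rightarrow> 'a"
  assumes T: "bounded_linear T" and sym: "\<And>x y. T x \<bullet> y = x \<bullet> T y"
    and on: "\<forall>i<k. \<forall>j<k. e i \<bullet> e j = (if i = j then 1 else 0)"
    and ev: "\<forall>i<k. T (e i) = l i *\<^sub>R e i"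
    and orth: "\<forall>x. (\<forall>i<k. e i \<bullet> x = 0) \<longrightarrow> m * (norm x)\<^sup>2 \<le> x \<bullet> T x"
    and a: "a < m" "\<And>i. i < (k::nat) \<Longrightarrow> a \<noteq> l i"
  shows "\<exists>d>0. \<forall>x. d * norm x \<le> norm (T x - a *\<^sub>R x)"
proof -
  interpret T: bounded_linear T by fact
  have on: "\<And>i j. i < k \<Longrightarrow> j < k \<Longrightarrow> e i \<bullet> e j = (if i = j then 1 else 0)" using on by blast
  have ev: "\<And>i. i < k \<Longrightarrow> T (e i) = l i *\<^sub>R e i" using ev by blast
  \<comment> \<open>Inserting \<open>m - a\<close> also keeps the set nonempty when
    \<open>k = 0\<close>.\<close>
  define d where "d = Min (insert (m - a) ((\<lambda>i. \<bar>l i - a\<bar>) ` {..<k}))"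
  have d: "d > 0" using a by (auto simp: d_def)
  have d1: "d \<le> m - a" and d2: "\<And>i. i < k \<Longrightarrow> d \<le> \<bar>l i - a\<bar>" by (auto simp: d_def)
  have "d * norm x \<le> norm (T x - a *\<^sub>R x)" for x
  proof -
    define p where "p = (\<Sum>i<k. (e i \<bullet> x) *\<^sub>R e i)"
    define y where "y = x - p"
    have y: "e i \<bullet> y = 0" if "i < k" for i
      using inner_sum_orthonormal[OF on that, where a = "\<lambda>i. e i \<bullet> x"] that
      by (simp add: y_def p_def inner_diff_right)
    have ey: "e i \<bullet> (T y - a *\<^sub>R y) = 0" if "i < k" for i
      using y[OF that] ev[OF that] by (simp add: inner_diff_right flip: sym)
    have Tp: "T p - a *\<^sub>R p = (\<Sum>i<k. ((l i - a) * (e i \<bullet> x)) *\<^sub>R e i)"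
      unfolding p_def T.sum T.scaleR scaleR_sum_right sum_subtractf[symmetric]
      by (intro sum.cong) (auto simp: ev algebra_simps)
    have pyth: "(norm ((\<Sum>i<k. b i *\<^sub>R e i) + z))\<^sup>2 = (\<Sum>i<k. (b i)\<^sup>2) + (norm z)\<^sup>2"
      if "\<And>i. i < k \<Longrightarrow> e i \<bullet> z = 0" for b z
    proof -
      have "(\<Sum>i<k. b i *\<^sub>R e i) \<bullet> z = 0" using that by (simp add: inner_sum_left)
      moreover have "(\<Sum>i<k. b i *\<^sub>R e i) \<bullet> (\<Sum>i<k. b i *\<^sub>R e i) = (\<Sum>i<k. (b i)\<^sup>2)"
        by (subst inner_sum_left) (simp add: inner_sum_orthonormal[OF on] power2_eq_square)
      ultimately show ?thesis
        by (simp add: power2_norm_eq_inner inner_add_left inner_add_right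
            inner_commute[of z "\<Sum>i<k. b i *\<^sub>R e i"])
    qed
    have nx: "(norm x)\<^sup>2 = (\<Sum>i<k. (e i \<bullet> x)\<^sup>2) + (norm y)\<^sup>2"
      using pyth[of y "\<lambda>i. e i \<bullet> x"] y by (simp add: p_def[symmetric] y_def)
    have "T x - a *\<^sub>R x = (T p - a *\<^sub>R p) + (T y - a *\<^sub>R y)"
      by (simp add: y_def T.diff algebra_simps)
    then have nT: "(norm (T x - a *\<^sub>R x))\<^sup>2
        = (\<Sum>i<k. ((l i - a) * (e i \<bullet> x))\<^sup>2) + (norm (T y - a *\<^sub>R y))\<^sup>2"
      using pyth[OF ey] by (simp add: Tp)
    have "d * norm y \<le> norm (T y - a *\<^sub>R y)"
    proof (cases "y = 0")
      case False
      have "(m - a) * (norm y)\<^sup>2 \<le> y \<bullet> (T y - a *\<^sub>R y)"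
        using orth y by (simp add: inner_diff_right power2_norm_eq_inner algebra_simps)
      also have "\<dots> \<le> norm y * norm (T y - a *\<^sub>R y)" by (rule norm_cauchy_schwarz)
      finally have "(m - a) * norm y \<le> norm (T y - a *\<^sub>R y)"
        using False by (simp add: power2_eq_square)
      then show ?thesis using d1 by (meson mult_right_mono norm_ge_zero order_trans)
    qed (simp add: T.zero)
    then have 1: "d\<^sup>2 * (norm y)\<^sup>2 \<le> (norm (T y - a *\<^sub>R y))\<^sup>2"
      using d by (metis norm_ge_zero power_mono power_mult_distrib mult_nonneg_nonneg less_imp_le)
    have 2: "d\<^sup>2 * (e i \<bullet> x)\<^sup>2 \<le> (l i - a)\<^sup>2 * (e i \<bullet> x)\<^sup>2" if "i < k" for i
    proof -
      have "d\<^sup>2 \<le> (l i - a)\<^sup>2" using d2[OF that] d by (metis less_imp_le power2_abs power_mono)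
      then show ?thesis by (simp add: mult_right_mono)
    qed
    have "(d * norm x)\<^sup>2 \<le> (norm (T x - a *\<^sub>R x))\<^sup>2"
      unfolding nT power_mult_distrib nx distrib_left sum_distrib_left
      by (intro add_mono sum_mono 1 2) auto
    then show ?thesis by (rule power2_le_imp_le) simp
  qed
  then show ?thesis using d by blast
qed

text \<open>The operator is \<open>(T - a)^2 + b^2\<close>. Symmetry turns its form into exactly the
  right-hand side of the lower bound, so squaring makes the indefinite operator \<open>T - a\<close>
  accessible to \<open>coercive_surj\<close>.\<close>

lemma symmetric_bounded_below_surj:
  fixes T :: "'a::{real_inner,complete_space} \<Rightarrow> 'a"
  assumes T: "bounded_linear T" and sym: "\<And>x y. T x \<bullet> y = x \<bullet> T y"
    and d: "d > 0" "\<And>x. d * (norm x)\<^sup>2 \<le> (norm (T x - a *\<^sub>R x))\<^sup>2 + b\<^sup>2 * (norm x)\<^sup>2"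
  shows "\<exists>x. T (T x - a *\<^sub>R x) - a *\<^sub>R (T x - a *\<^sub>R x) + b\<^sup>2 *\<^sub>R x = g"
proof -
  interpret T: bounded_linear T by fact
  have S: "bounded_linear (\<lambda>x. T (T x - a *\<^sub>R x) - a *\<^sub>R (T x - a *\<^sub>R x) + b\<^sup>2 *\<^sub>R x)"
    using T by (intro bounded_linear_add bounded_linear_sub bounded_linear_compose[OF T]
        bounded_linear_scaleR_right bounded_linear_const_scaleR bounded_linear_ident)
  show ?thesis
  proof (rule coercive_surj[OF S d(1)])
    fix x
    have "x \<bullet> (T (T x - a *\<^sub>R x) - a *\<^sub>R (T x - a *\<^sub>R x) + b\<^sup>2 *\<^sub>R x)
      = (norm (T x - a *\<^sub>R x))\<^sup>2 + b\<^sup>2 * (norm x)\<^sup>2"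
    proof -
      define w where "w = T x - a *\<^sub>R x"
      have "x \<bullet> T w = T x \<bullet> w" by (simp add: sym)
      then have "x \<bullet> (T w - a *\<^sub>R w + b\<^sup>2 *\<^sub>R x) = (T x - a *\<^sub>R x) \<bullet> w + b\<^sup>2 * (x \<bullet> x)"
        by (simp add: inner_add_right inner_diff_right inner_diff_left)
      then show ?thesis by (simp add: w_def[symmetric] power2_norm_eq_inner)
    qed
    then show "d * (norm x)\<^sup>2 \<le> x \<bullet> (T (T x - a *\<^sub>R x) - a *\<^sub>R (T x - a *\<^sub>R x) + b\<^sup>2 *\<^sub>R x)"
      using d(2)[of x] by simp
  qed
qed

section \<open>Square-integrable real functions\<close>

definition sq_int :: "'a measure \<Rightarrow> ('a \<Rightarrow> real) \<Rightarrow> bool" where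
  "sq_int M f \<longleftrightarrow> f \<in> borel_measurable M \<and> integrable M (\<lambda>x. (f x)\<^sup>2)"

lemma sq_intD:
  assumes "sq_int M f"
  shows "f \<in> borel_measurable M" "integrable M (\<lambda>x. (f x)\<^sup>2)"
  using assms by (auto simp: sq_int_def)

lemma sq_int_mult_integrable:
  assumes "sq_int M f" "sq_int M g"
  shows "integrable M (\<lambda>x. f x * g x)"
proof (rule Bochner_Integration.integrable_bound)
  note [measurable] = sq_intD(1)[OF assms(1)] sq_intD(1)[OF assms(2)]
  show "integrable M (\<lambda>x. (f x)\<^sup>2 + (g x)\<^sup>2)" using assms by (auto simp: sq_int_def)
  show "(\<lambda>x. f x * g x) \<in> borel_measurable M" by measurable
  have "\<bar>a * b\<bar> \<le> a\<^sup>2 + b\<^sup>2" for a b :: real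
  proof -
    have "2 * \<bar>a * b\<bar> \<le> a\<^sup>2 + b\<^sup>2"
      using zero_le_power2[of "\<bar>a\<bar> - \<bar>b\<bar>"] by (simp add: power2_diff abs_mult)
    then show ?thesis by linarith
  qed
  then show "AE x in M. norm (f x * g x) \<le> norm ((f x)\<^sup>2 + (g x)\<^sup>2)" by auto
qed

lemma sq_int_add: "sq_int M f \<Longrightarrow> sq_int M g \<Longrightarrow> sq_int M (\<lambda>x. f x + g x)"
  using sq_int_mult_integrable[of M f g]
  by (auto simp: sq_int_def power2_sum mult.assoc)

lemma sq_int_cmult: "sq_int M f \<Longrightarrow> sq_int M (\<lambda>x. c * f x)"
  by (auto simp: sq_int_def power_mult_distrib)

lemma sq_int_uminus: "sq_int M f \<Longrightarrow> sq_int M (\<lambda>x. - f x)"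
  by (auto simp: sq_int_def)

lemma sq_int_diff: "sq_int M f \<Longrightarrow> sq_int M g \<Longrightarrow> sq_int M (\<lambda>x. f x - g x)"
  using sq_int_add[of M f "\<lambda>x. - g x"] sq_int_uminus[of M g] by simp

lemma sq_int_sum: "finite I \<Longrightarrow> (\<And>i. i \<in> I \<Longrightarrow> sq_int M (f i)) \<Longrightarrow> sq_int M (\<lambda>x. \<Sum>i\<in>I. f i x)"
  by (induction I rule: finite_induct) (auto intro: sq_int_add simp: sq_int_def[of M "\<lambda>_. 0"])

lemma sq_int_mult_bounded:
  assumes f: "sq_int M f" and g: "g \<in> borel_measurable M" "AE x in M. \<bar>g x\<bar> \<le> C"
  shows "sq_int M (\<lambda>x. g x * f x)"
  unfolding sq_int_def
proof
  note [measurable] = sq_intD(1)[OF f] g(1)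
  show "(\<lambda>x. g x * f x) \<in> borel_measurable M" by measurable
  show "integrable M (\<lambda>x. (g x * f x)\<^sup>2)"
  proof (rule Bochner_Integration.integrable_bound)
    show "integrable M (\<lambda>x. C\<^sup>2 * (f x)\<^sup>2)" using f by (auto simp: sq_int_def)
    show "(\<lambda>x. (g x * f x)\<^sup>2) \<in> borel_measurable M" by measurable
    show "AE x in M. norm ((g x * f x)\<^sup>2) \<le> norm (C\<^sup>2 * (f x)\<^sup>2)"
      using g(2)
    proof eventually_elim
      case (elim x)
      then have "(g x)\<^sup>2 \<le> C\<^sup>2" by (metis abs_ge_zero power2_abs power_mono)
      then show ?case by (simp add: power_mult_distrib mult_right_mono)
    qed
  qed
qed

lemma (in finite_measure) sq_int_bounded:
  assumes "g \<in> borel_measurable M" "AE x in M. \<bar>g x\<bar> \<le> C"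
  shows "sq_int M g"
proof -
  have "sq_int M (\<lambda>_. 1)" by (simp add: sq_int_def)
  from sq_int_mult_bounded[OF this assms] show ?thesis by simp
qed

lemma (in finite_measure) sq_int_integrable: "sq_int M f \<Longrightarrow> integrable M f"
  unfolding sq_int_def by (elim conjE) (rule square_integrable_imp_integrable)

lemma sq_int_Cauchy_Schwarz:
  assumes "sq_int M f" "sq_int M g"
  shows "(\<integral>x. f x * g x \<partial>M)\<^sup>2 \<le> (\<integral>x. (f x)\<^sup>2 \<partial>M) * (\<integral>x. (g x)\<^sup>2 \<partial>M)"
proof -
  note [measurable] = sq_intD(1)[OF assms(1)] sq_intD(1)[OF assms(2)]
  have sq: "(\<integral>\<^sup>+x. ennreal \<bar>h x\<bar> ^ 2 \<partial>M) = ennreal (\<integral>x. (h x)\<^sup>2 \<partial>M)" if "sq_int M h" for h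
  proof -
    have "(\<integral>\<^sup>+x. ennreal \<bar>h x\<bar> ^ 2 \<partial>M) = (\<integral>\<^sup>+x. ennreal ((h x)\<^sup>2) \<partial>M)"
      by (intro nn_integral_cong) (simp add: ennreal_power)
    then show ?thesis using that by (simp add: nn_integral_eq_integral sq_int_def)
  qed
  have int: "integrable M (\<lambda>x. f x * g x)" by (rule sq_int_mult_integrable[OF assms])
  have "ennreal ((\<integral>x. \<bar>f x * g x\<bar> \<partial>M)\<^sup>2) = (\<integral>\<^sup>+x. ennreal \<bar>f x\<bar> * ennreal \<bar>g x\<bar> \<partial>M)\<^sup>2"
  proof -
    have "(\<integral>\<^sup>+x. ennreal \<bar>f x\<bar> * ennreal \<bar>g x\<bar> \<partial>M) = (\<integral>\<^sup>+x. ennreal \<bar>f x * g x\<bar> \<partial>M)"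
      by (simp add: abs_mult ennreal_mult)
    also have "\<dots> = ennreal (\<integral>x. \<bar>f x * g x\<bar> \<partial>M)"
      using int by (intro nn_integral_eq_integral) auto
    finally show ?thesis by (simp add: ennreal_power)
  qed
  also have "\<dots> \<le> (\<integral>\<^sup>+x. ennreal \<bar>f x\<bar> ^ 2 \<partial>M) * (\<integral>\<^sup>+x. ennreal \<bar>g x\<bar> ^ 2 \<partial>M)"
    by (rule Cauchy_Schwarz_nn_integral) auto
  also have "\<dots> = ennreal ((\<integral>x. (f x)\<^sup>2 \<partial>M) * (\<integral>x. (g x)\<^sup>2 \<partial>M))"
    using assms by (simp add: sq ennreal_mult)
  finally have "(\<integral>x. \<bar>f x * g x\<bar> \<partial>M)\<^sup>2 \<le> (\<integral>x. (f x)\<^sup>2 \<partial>M) * (\<integral>x. (g x)\<^sup>2 \<partial>M)"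
    by (simp add: ennreal_le_iff)
  moreover have "(\<integral>x. f x * g x \<partial>M)\<^sup>2 \<le> (\<integral>x. \<bar>f x * g x\<bar> \<partial>M)\<^sup>2"
    by (metis integral_abs_bound abs_ge_zero power2_abs power_mono)
  ultimately show ?thesis by linarith
qed

section \<open>The torus\<close>

lemma torus_sets [measurable, simp]: "torus \<in> sets borel"
  unfolding torus_def by measurable

lemma space_torus_measure [simp]: "space torus_measure = torus"
  by (simp add: torus_measure_def space_restrict_space)

lemma borel_imp_torus_measurable: "f \<in> borel \<rightarrow>\<^sub>M N \<Longrightarrow> f \<in> torus_measure \<rightarrow>\<^sub>M N"
  unfolding torus_measure_def by (rule measurable_restrict_space1) simp

lemma torus_measurable_id [measurable]: "(\<lambda>p. p) \<in> torus_measure \<rightarrow>\<^sub>M borel"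
  by (rule borel_imp_torus_measurable) simp

lemma torus_measurable_nth [measurable]: "(\<lambda>p. p $ i) \<in> torus_measure \<rightarrow>\<^sub>M borel"
  by (rule borel_imp_torus_measurable) simp

lemma torus2_measurable_fst [measurable]: "fst \<in> torus2_measure \<rightarrow>\<^sub>M borel"
  unfolding torus2_measure_def using measurable_compose[OF measurable_fst torus_measurable_id] by simp

lemma torus2_measurable_snd [measurable]: "snd \<in> torus2_measure \<rightarrow>\<^sub>M borel"
  unfolding torus2_measure_def using measurable_compose[OF measurable_snd torus_measurable_id] by simp

lemma torus2_measurable_Pair: "(\<lambda>x. x) \<in> torus2_measure \<rightarrow>\<^sub>M borel"
proof -
  have "(\<lambda>x. (fst x, snd x)) \<in> torus2_measure \<rightarrow>\<^sub>M borel \<Otimes>\<^sub>M borel" by measurable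
  then show ?thesis by (simp add: borel_prod)
qed

lemma continuous_imp_torus_measurable:
  "continuous_on UNIV f \<Longrightarrow> f \<in> torus_measure \<rightarrow>\<^sub>M borel"
  by (intro borel_imp_torus_measurable borel_measurable_continuous_onI)

lemma continuous_imp_torus2_measurable:
  "continuous_on UNIV f \<Longrightarrow> f \<in> torus2_measure \<rightarrow>\<^sub>M borel"
  using measurable_compose[OF torus2_measurable_Pair borel_measurable_continuous_onI] by simp

lemma prod_Basis_cart: "(\<Prod>b\<in>Basis. f (b :: real^3)) = (\<Prod>i\<in>UNIV. f (axis i 1))"
proof -
  have B: "(Basis :: (real^3) set) = (\<lambda>i. axis i 1) ` UNIV" by (auto simp: Basis_vec_def)
  have "inj (\<lambda>i::3. axis i (1::real))" by (auto simp: inj_def axis_eq_axis)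
  then show ?thesis unfolding B by (subst prod.reindex) (auto simp: o_def)
qed

lemma nn_integral_lborel_prod_cart:
  fixes f :: "3 \<Rightarrow> real \<Rightarrow> ennreal"
  assumes [measurable]: "\<And>i. f i \<in> borel_measurable borel"
  shows "(\<integral>\<^sup>+x. (\<Prod>i\<in>UNIV. f i (x $ i)) \<partial>lborel) = (\<Prod>i\<in>UNIV. (\<integral>\<^sup>+t. f i t \<partial>lborel))"
proof -
  define g where "g b = f (axis_index b)" for b :: "real^3"
  have [measurable]: "g b \<in> borel_measurable borel" for b by (simp add: g_def)
  have "(\<integral>\<^sup>+x. (\<Prod>b\<in>Basis. g b (x \<bullet> b)) \<partial>lborel) = (\<Prod>b\<in>Basis. (\<integral>\<^sup>+t. g b t \<partial>lborel))"
    by (rule nn_integral_lborel_prod) auto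
  then show ?thesis unfolding prod_Basis_cart by (simp add: g_def axis_index_axis cart_eq_inner_axis[symmetric])
qed

lemma integral_lborel_prod_cart:
  fixes f :: "3 \<Rightarrow> real \<Rightarrow> real"
  assumes f: "\<And>i. integrable lborel (f i)"
  shows "(\<integral>x. (\<Prod>i\<in>UNIV. f i (x $ i)) \<partial>lborel) = (\<Prod>i\<in>UNIV. (\<integral>t. f i t \<partial>lborel))"
proof -
  have [measurable]: "f i \<in> borel_measurable borel" for i using borel_measurable_integrable[OF f[of i]] by simp
  define g where "g b = f (axis_index b)" for b :: "real^3"
  have [measurable]: "g b \<in> borel_measurable borel" for b by (simp add: g_def)
  interpret product_sigma_finite "\<lambda>_::real^3. lborel :: real measure" ..
  have "(\<integral>x. (\<Prod>b\<in>Basis. g b (x \<bullet> b)) \<partial>lborel)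
      = (\<integral>y. (\<Prod>b\<in>Basis. g b ((\<Sum>b\<in>Basis. y b *\<^sub>R b) \<bullet> b)) \<partial>(\<Pi>\<^sub>M b\<in>Basis. lborel))"
    by (subst lborel_eq, subst integral_distr) auto
  also have "\<dots> = (\<integral>y. (\<Prod>b\<in>Basis. g b (y b)) \<partial>(\<Pi>\<^sub>M b\<in>(Basis::(real^3) set). lborel))"
    by (intro Bochner_Integration.integral_cong refl prod.cong) simp
  also have "\<dots> = (\<Prod>b\<in>Basis. (\<integral>t. g b t \<partial>lborel))"
    using f by (intro product_integral_prod) (auto simp: g_def)
  finally show ?thesis unfolding prod_Basis_cart by (simp add: g_def axis_index_axis cart_eq_inner_axis[symmetric])
qed

lemma indicator_torus: "indicator torus p = (\<Prod>i\<in>UNIV. indicator {- pi<..pi} (p $ i) :: real)"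
  by (auto simp: torus_def indicator_def)

lemma integral_torus_prod:
  fixes f :: "3 \<Rightarrow> real \<Rightarrow> real"
  assumes f: "\<And>i. continuous_on UNIV (f i)"
  shows "(\<integral>p. (\<Prod>i\<in>UNIV. f i (p $ i)) \<partial>torus_measure) = (\<Prod>i\<in>UNIV. (\<integral>t. f i t * indicator {-pi..pi} t \<partial>lborel))"
proof -
  have cont: "continuous_on A (f i)" for A i using f continuous_on_subset by blast
  have [measurable]: "f i \<in> borel_measurable borel" for i using f borel_measurable_continuous_onI by blast
  have int: "integrable lborel (\<lambda>t. f i t * indicator {-pi..pi} t)" for i
    using borel_integrable_compact[of "{-pi..pi}" "f i"] cont[of _ i] by (simp add: mult.commute)
  \<comment> \<open>The fundamental domain is half-open; it differs by the null set
    \<open>{-pi}\<close> from the closed interval, on which the one-dimensional integrals are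
    evaluated.\<close>
  have AE: "AE t in lborel. f i t * indicator {-pi..pi} t = f i t * indicator {-pi<..pi} t" for i
    using AE_lborel_singleton[of "-pi"] by eventually_elim (auto simp: indicator_def)
  have int2: "integrable lborel (\<lambda>t. f i t * indicator {-pi<..pi} t)" for i
    using int[of i] by (rule integrable_cong_AE_imp) (use AE[of i] in \<open>auto elim: eventually_mono\<close>)
  have "(\<integral>p. (\<Prod>i\<in>UNIV. f i (p $ i)) \<partial>torus_measure)
      = (\<integral>p. (\<Prod>i\<in>UNIV. f i (p $ i) * indicator {- pi<..pi} (p $ i)) \<partial>lborel)"
    unfolding torus_measure_def
    by (subst integral_restrict_space) (auto simp: indicator_torus prod.distrib mult.commute)
  also have "\<dots> = (\<Prod>i\<in>UNIV. (\<integral>t. f i t * indicator {-pi<..pi} t \<partial>lborel))"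
    by (rule integral_lborel_prod_cart[OF int2])
  also have "\<dots> = (\<Prod>i\<in>UNIV. (\<integral>t. f i t * indicator {-pi..pi} t \<partial>lborel))"
  proof (intro prod.cong refl integral_cong_AE)
    fix i show "AE t in lborel. f i t * indicator {-pi<..pi} t = f i t * indicator {-pi..pi} t"
      using AE[of i] by (rule AE_mp) (intro AE_I2, simp)
  qed measurable
  finally show ?thesis .
qed

definition vol :: real where "vol = (2 * pi) ^ 3"

lemma vol_pos: "vol > 0" by (simp add: vol_def)

lemma integral_torus_one: "(\<integral>p. g (p $ i) \<partial>torus_measure) = (2 * pi)\<^sup>2 * (\<integral>t. g t * indicator {-pi..pi} t \<partial>lborel)"
  if "continuous_on UNIV g" for g :: "real \<Rightarrow> real"
proof -
  have "(\<integral>p. (\<Prod>j\<in>UNIV. (if j = i then g else (\<lambda>_. 1)) (p $ j)) \<partial>torus_measure)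
    = (\<Prod>j\<in>UNIV. (\<integral>t. (if j = i then g else (\<lambda>_. 1)) t * indicator {-pi..pi} t \<partial>lborel))"
    by (rule integral_torus_prod) (use that in auto)
  moreover have "(\<Prod>j\<in>UNIV. (if j = i then g else (\<lambda>_. 1)) (p $ j)) = g (p $ i)" for p :: "real^3"
    by (subst prod.remove[of _ i]) (auto intro!: prod.neutral)
  moreover have "(\<Prod>j\<in>UNIV. (\<integral>t. (if j = i then g else (\<lambda>_. 1)) t * indicator {-pi..pi} t \<partial>lborel))
     = (2 * pi)\<^sup>2 * (\<integral>t. g t * indicator {-pi..pi} t \<partial>lborel)"
  proof -
    have "(\<Prod>j\<in>UNIV - {i}. (\<integral>t. (if j = i then g else (\<lambda>_. 1)) t * indicator {-pi..pi} t \<partial>lborel))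
      = (\<Prod>j\<in>UNIV - {i}. 2 * pi)"
      by (intro prod.cong) auto
    then show ?thesis by (subst prod.remove[of _ i]) (auto simp: card_Diff_singleton)
  qed
  ultimately show ?thesis by simp
qed

lemma integral_torus_two: "(\<integral>p. g (p $ i) * h (p $ j) \<partial>torus_measure)
    = 2 * pi * (\<integral>t. g t * indicator {-pi..pi} t \<partial>lborel) * (\<integral>t. h t * indicator {-pi..pi} t \<partial>lborel)"
  if "continuous_on UNIV g" "continuous_on UNIV h" "i \<noteq> j" for g h :: "real \<Rightarrow> real"
proof -
  define f where "f = (\<lambda>k::3. if k = i then g else if k = j then h else (\<lambda>_. 1))"
  have "(\<integral>p. (\<Prod>k\<in>UNIV. f k (p $ k)) \<partial>torus_measure)
    = (\<Prod>k\<in>UNIV. (\<integral>t. f k t * indicator {-pi..pi} t \<partial>lborel))"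
    by (rule integral_torus_prod) (use that in \<open>auto simp: f_def\<close>)
  moreover have split: "(\<Prod>k\<in>UNIV. F k) = F i * (F j * prod F (UNIV - {i} - {j}))" for F :: "3 \<Rightarrow> real"
    using that by (subst prod.remove[of _ i], simp, simp, subst prod.remove[of _ j]) auto
  moreover have "(\<Prod>k\<in>UNIV - {i} - {j}. f k (p $ k)) = 1" for p :: "real^3"
    by (intro prod.neutral) (auto simp: f_def)
  moreover have "(\<Prod>k\<in>UNIV - {i} - {j}. (\<integral>t. f k t * indicator {-pi..pi} t \<partial>lborel)) = 2 * pi"
  proof -
    have "(\<Prod>k\<in>UNIV - {i} - {j}. (\<integral>t. f k t * indicator {-pi..pi} t \<partial>lborel)) = (\<Prod>k\<in>UNIV - {i} - {j}. 2 * pi)"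
      by (intro prod.cong) (auto simp: f_def)
    moreover have "card (UNIV - {i} - {j}) = 1" using that(3) by (simp add: card_Diff_singleton)
    ultimately show ?thesis by simp
  qed
  moreover have "f i = g" "f j = h" using that by (auto simp: f_def)
  ultimately show ?thesis by simp
qed

lemma emeasure_torus: "emeasure torus_measure torus = ennreal vol"
proof -
  have "emeasure torus_measure torus = (\<integral>\<^sup>+p. (\<Prod>i\<in>UNIV. indicator {- pi<..pi} ((p::real^3) $ i)) \<partial>lborel)"
  proof -
    have "emeasure torus_measure torus = emeasure lborel torus"
      unfolding torus_measure_def by (subst emeasure_restrict_space) auto
    also have "\<dots> = (\<integral>\<^sup>+p. indicator torus p \<partial>lborel)" by simp
    also have "\<dots> = (\<integral>\<^sup>+p. (\<Prod>i\<in>UNIV. indicator {- pi<..pi} ((p::real^3) $ i)) \<partial>lborel)"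
      by (intro nn_integral_cong) (auto simp: torus_def indicator_def)
    finally show ?thesis .
  qed
  also have "\<dots> = (\<Prod>i\<in>(UNIV::3 set). ennreal (2 * pi))"
    by (subst nn_integral_lborel_prod_cart) auto
  also have "\<dots> = ennreal vol" by (simp add: vol_def ennreal_power)
  finally show ?thesis .
qed

global_interpretation torus: finite_measure torus_measure
  by standard (simp add: emeasure_torus)

lemma measure_torus: "measure torus_measure torus = vol"
  using emeasure_torus vol_pos by (simp add: measure_def)

lemma space_torus2_measure [simp]: "space torus2_measure = torus \<times> torus"
  by (simp add: torus2_measure_def space_pair_measure)

global_interpretation torus2: pair_sigma_finite torus_measure torus_measure ..

global_interpretation torus2f: finite_measure torus2_measure
proof
  have "emeasure torus2_measure (torus \<times> torus) = emeasure torus_measure torus * emeasure torus_measure torus"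
    unfolding torus2_measure_def
    by (rule torus.emeasure_pair_measure_Times) (use sets.top[of torus_measure] in auto)
  then show "emeasure torus2_measure (space torus2_measure) \<noteq> \<infinity>"
    by (simp add: emeasure_torus ennreal_mult_eq_top_iff)
qed

section \<open>Trigonometric integrals over one period\<close>

lemma integral_sin_shift: "(\<integral>t. sin (t + a) * indicator {-pi..pi} t \<partial>lborel) = 0"
proof (subst integral_FTC_Icc_real[where F = "\<lambda>t. - cos (t + a)"])
  show "((\<lambda>t. - cos (t + a)) has_real_derivative sin (x + a)) (at x)" for x
    by (auto intro!: derivative_eq_intros)
qed (auto simp: cos_add intro!: continuous_intros)

lemma integral_cos_shift: "(\<integral>t. cos (t + a) * indicator {-pi..pi} t \<partial>lborel) = 0"
proof (subst integral_FTC_Icc_real[where F = "\<lambda>t. sin (t + a)"])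
  show "((\<lambda>t. sin (t + a)) has_real_derivative cos (x + a)) (at x)" for x
    by (auto intro!: derivative_eq_intros)
qed (auto simp: sin_add intro!: continuous_intros)

lemma integral_sin_cos_shift: "(\<integral>t. (sin (t + a) * cos (t + a)) * indicator {-pi..pi} t \<partial>lborel) = 0"
proof (subst integral_FTC_Icc_real[where F = "\<lambda>t. (sin (t + a))\<^sup>2 / 2"])
  show "((\<lambda>t. (sin (t + a))\<^sup>2 / 2) has_real_derivative sin (x + a) * cos (x + a)) (at x)" for x
    by (auto intro!: derivative_eq_intros)
qed (auto simp: sin_add intro!: continuous_intros)

lemma integral_sin_sq_shift: "(\<integral>t. (sin (t + a))\<^sup>2 * indicator {-pi..pi} t \<partial>lborel) = pi"
proof (subst integral_FTC_Icc_real[where F = "\<lambda>t. t / 2 - sin (t + a) * cos (t + a) / 2"])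
  fix x
  have "(sin (x + a))\<^sup>2 = 1 / 2 - (cos (x + a) * cos (x + a) - sin (x + a) * sin (x + a)) / 2"
    using sin_cos_squared_add[of "x + a"] by (simp add: power2_eq_square field_simps)
  then show "((\<lambda>t. t / 2 - sin (t + a) * cos (t + a) / 2) has_real_derivative (sin (x + a))\<^sup>2) (at x)"
    by (auto intro!: derivative_eq_intros)
next
  show "pi / 2 - sin (pi + a) * cos (pi + a) / 2 - (- pi / 2 - sin (- pi + a) * cos (- pi + a) / 2) = pi"
    by (simp add: sin_add cos_add)
qed (auto intro!: continuous_intros)

section \<open>Integrability of the inverse square in three dimensions\<close>

lemma nn_integral_powr_interval:
  assumes "a \<ge> 0"
  shows "(\<integral>\<^sup>+t. ennreal (\<bar>t\<bar> powr (-2/3)) * indicator {-a..a} t \<partial>lborel) \<le> ennreal (6 * a powr (1/3))"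
proof -
  define f where "f = (\<lambda>t::real. ennreal (\<bar>t\<bar> powr (-2/3)) * indicator {0..a} t)"
  have [measurable]: "f \<in> borel_measurable borel" unfolding f_def by measurable
  have I: "(\<integral>\<^sup>+t. f t \<partial>lborel) = ennreal (3 * a powr (1/3))"
  proof -
    have "((\<lambda>t. t powr (-2/3)) has_integral (a powr (1/3) / (1/3))) {0..a}"
      using has_integral_powr_from_0[of "-2/3" a] assms by simp
    then have "((\<lambda>t. \<bar>t\<bar> powr (-2/3)) has_integral (a powr (1/3) / (1/3))) {0..a}"
      by (rule has_integral_eq[rotated]) auto
    from nn_integral_has_integral_lebesgue'[OF _ this] show ?thesis by (simp add: f_def)
  qed
  have "(\<integral>\<^sup>+t. ennreal (\<bar>t\<bar> powr (-2/3)) * indicator {-a..a} t \<partial>lborel) \<le> (\<integral>\<^sup>+t. f t + f (0 + (-1) * t) \<partial>lborel)"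
    by (intro nn_integral_mono) (auto simp: f_def indicator_def)
  also have "\<dots> = (\<integral>\<^sup>+t. f t \<partial>lborel) + (\<integral>\<^sup>+t. f (0 + (-1) * t) \<partial>lborel)"
    by (intro nn_integral_add) auto
  also have "(\<integral>\<^sup>+t. f (0 + (-1) * t) \<partial>lborel) = (\<integral>\<^sup>+t. f t \<partial>lborel)"
    using nn_integral_real_affine[of f "-1" 0] by simp
  finally show ?thesis by (simp add: I flip: ennreal_plus)
qed

text \<open>Uniform in the position \<open>d\<close> of the singularity. The part within distance
  \<open>a\<close> of \<open>d\<close> is at most the centred integral, giving 6; elsewhere the
  integrand is at most \<open>a powr (-2/3)\<close> on a set of length at most \<open>2 * a\<close>,
  giving 2 more.\<close>

lemma nn_integral_powr_interval_shift:
  assumes "a > 0"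
  shows "(\<integral>\<^sup>+t. ennreal (\<bar>t - d\<bar> powr (-2/3)) * indicator {-a..a} t \<partial>lborel) \<le> ennreal (8 * a powr (1/3))"
proof -
  define g where "g = (\<lambda>t::real. ennreal (\<bar>t\<bar> powr (-2/3)) * indicator {-a..a} t)"
  have [measurable]: "g \<in> borel_measurable borel" unfolding g_def by measurable
  have "ennreal (\<bar>t - d\<bar> powr (-2/3)) * indicator {-a..a} t
      \<le> g (- d + 1 * t) + ennreal (a powr (-2/3)) * indicator {-a..a} t" for t
  proof (cases "\<bar>t - d\<bar> \<le> a")
    case True
    then have "ennreal (\<bar>t - d\<bar> powr (-2/3)) \<le> g (- d + 1 * t)" by (auto simp: g_def indicator_def)
    then show ?thesis by (auto simp: indicator_def intro: add_increasing2)
  next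
    case False
    then have "\<bar>t - d\<bar> powr (-2/3) \<le> a powr (-2/3)" using assms by (intro powr_mono2') auto
    then show ?thesis by (auto simp: indicator_def g_def intro!: ennreal_leI)
  qed
  then have "(\<integral>\<^sup>+t. ennreal (\<bar>t - d\<bar> powr (-2/3)) * indicator {-a..a} t \<partial>lborel)
      \<le> (\<integral>\<^sup>+t. g (- d + 1 * t) + ennreal (a powr (-2/3)) * indicator {-a..a} t \<partial>lborel)"
    by (intro nn_integral_mono)
  also have "\<dots> = (\<integral>\<^sup>+t. g t \<partial>lborel) + ennreal (a powr (-2/3)) * ennreal (2 * a)"
    using nn_integral_real_affine[of g 1 "-d"] assms
    by (subst nn_integral_add) (auto simp: nn_integral_cmult_indicator)
  also have "\<dots> \<le> ennreal (6 * a powr (1/3)) + ennreal (a powr (-2/3)) * ennreal (2 * a)"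
    using nn_integral_powr_interval[of a] assms by (intro add_mono) (auto simp: g_def)
  also have "\<dots> = ennreal (8 * a powr (1/3))"
  proof -
    have "a powr (-2/3) * a powr 1 = a powr (1/3)" by (subst powr_add[symmetric]) simp
    then have "a powr (-2/3) * (2 * a) = 2 * a powr (1/3)" using assms by simp
    then show ?thesis using assms by (simp flip: ennreal_plus ennreal_mult)
  qed
  finally show ?thesis .
qed

text \<open>The norm dominates each coordinate, so the inverse square is at most the product over
  \<open>i\<close> of the distances \<open>\<bar>p $ i - d $ i\<bar>\<close> to the power -2/3. This
  factorizes into one-dimensional integrable singularities; 512 is the cube of 8.\<close>

lemma nn_integral_inverse_square:
  fixes d :: "real^3"
  assumes "a > 0"
  shows "(\<integral>\<^sup>+p. ennreal (1 / (norm (p - d))\<^sup>2) * indicator {p. \<forall>i. \<bar>p $ i\<bar> \<le> a} p \<partial>lborel) \<le> ennreal (512 * a)"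
proof -
  \<comment> \<open>Since \<open>0 powr x\<close> is 0, the factor is set to \<open>top\<close> at
    the singularity; otherwise the product could vanish on a coordinate plane through
    \<open>d\<close> and the pointwise bound would fail.\<close>
  define h where "h i t = (if t = d $ i then top else ennreal (\<bar>t - d $ i\<bar> powr (-2/3))) * indicator {-a..a} t" for i t
  have [measurable]: "h i \<in> borel_measurable borel" for i unfolding h_def by measurable
  have "(\<integral>\<^sup>+t. h i t \<partial>lborel) \<le> ennreal (8 * a powr (1/3))" for i
  proof -
    have "AE t in lborel. h i t = ennreal (\<bar>t - d $ i\<bar> powr (-2/3)) * indicator {-a..a} t"
      using AE_lborel_singleton[of "d $ i"] by eventually_elim (auto simp: h_def)
    then have "(\<integral>\<^sup>+t. h i t \<partial>lborel) = (\<integral>\<^sup>+t. ennreal (\<bar>t - d $ i\<bar> powr (-2/3)) * indicator {-a..a} t \<partial>lborel)"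
      by (rule nn_integral_cong_AE)
    then show ?thesis using nn_integral_powr_interval_shift[OF assms, of "d $ i"] by (rule ord_eq_le_trans)
  qed
  then have "(\<Prod>i\<in>UNIV. (\<integral>\<^sup>+t. h i t \<partial>lborel)) \<le> (\<Prod>i\<in>(UNIV::3 set). ennreal (8 * a powr (1/3)))"
    unfolding UNIV_3 by (simp add: mult_mono)
  also have "\<dots> = ennreal (512 * a)"
  proof -
    have "(a powr (1/3)) ^ 3 = (a powr (1/3)) powr 3" using assms by (subst powr_numeral) auto
    also have "\<dots> = a" using assms by (simp add: powr_powr)
    finally show ?thesis by (simp add: ennreal_power power_mult_distrib)
  qed
  finally have *: "(\<integral>\<^sup>+p. (\<Prod>i\<in>UNIV. h i (p $ i)) \<partial>lborel) \<le> ennreal (512 * a)"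
    by (subst nn_integral_lborel_prod_cart) auto
  have "ennreal (1 / (norm (p - d))\<^sup>2) * indicator {p. \<forall>i. \<bar>p $ i\<bar> \<le> a} p \<le> (\<Prod>i\<in>UNIV. h i (p $ i))" for p
  proof (cases "(\<forall>i. \<bar>p $ i\<bar> \<le> a) \<and> p \<noteq> d")
    case True
    define N where "N = (norm (p - d))\<^sup>2"
    have N: "N > 0" using True by (simp add: N_def)
    have mem: "p $ i \<in> {-a..a}" for i using True by (simp add: abs_le_iff minus_le_iff)
    have hi: "ennreal (N powr (-1/3)) \<le> h i (p $ i)" for i
    proof (cases "p $ i = d $ i")
      case False
      have "\<bar>p $ i - d $ i\<bar> \<le> norm (p - d)"
        using component_le_norm_cart[of "p - d" i] by simp
      moreover have "\<bar>p $ i - d $ i\<bar> > 0" using False by simp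
      moreover have "N powr (-1/3) = norm (p - d) powr (-2/3)"
      proof -
        have "N = norm (p - d) powr 2" using True unfolding N_def by (subst powr_numeral) auto
        then have "N powr (-1/3) = norm (p - d) powr (2 * (-1/3))" by (simp only: powr_powr)
        then show ?thesis by simp
      qed
      ultimately have "N powr (-1/3) \<le> \<bar>p $ i - d $ i\<bar> powr (-2/3)"
        using powr_mono2'[of "-2/3" "\<bar>p $ i - d $ i\<bar>" "norm (p - d)"] by simp
      then show ?thesis using mem False by (simp add: h_def ennreal_leI)
    qed (use mem[of i] in \<open>auto simp: h_def\<close>)
    have "1 / N = (\<Prod>i\<in>(UNIV::3 set). N powr (-1/3))"
    proof -
      have "(N powr (-1/3)) ^ 3 = N powr (of_nat 3 * (-1/3))" using N by (intro powr_power) simp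
      also have "\<dots> = N powr (- 1)" by simp
      also have "\<dots> = 1 / N" unfolding powr_minus_divide using N by simp
      finally show ?thesis unfolding prod_constant by simp
    qed
    then have "ennreal (1 / N) = (\<Prod>i\<in>(UNIV::3 set). ennreal (N powr (-1/3)))"
      by (simp add: prod_ennreal ennreal_power)
    also have "\<dots> \<le> (\<Prod>i\<in>UNIV. h i (p $ i))" using hi unfolding UNIV_3 by (simp add: mult_mono)
    finally show ?thesis using True by (simp add: N_def)
  qed (auto simp: indicator_def)
  then have "(\<integral>\<^sup>+p. ennreal (1 / (norm (p - d))\<^sup>2) * indicator {p. \<forall>i. \<bar>p $ i\<bar> \<le> a} p \<partial>lborel) \<le> (\<integral>\<^sup>+p. (\<Prod>i\<in>UNIV. h i (p $ i)) \<partial>lborel)"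
    by (rule nn_integral_mono)
  then show ?thesis using * by (rule order_trans)
qed

section \<open>Product integrals on two copies of the torus\<close>

lemma torus2_measurable_fst' [measurable]: "fst \<in> torus2_measure \<rightarrow>\<^sub>M torus_measure"
  by (simp add: torus2_measure_def)

lemma torus2_measurable_snd' [measurable]: "snd \<in> torus2_measure \<rightarrow>\<^sub>M torus_measure"
  by (simp add: torus2_measure_def)

lemma swap_eq_Pair: "prod.swap = (\<lambda>x. (snd x, fst x))"
  by auto

lemma torus2_measurable_swap [measurable]: "prod.swap \<in> torus2_measure \<rightarrow>\<^sub>M torus2_measure"
  unfolding torus2_measure_def swap_eq_Pair by measurable

lemma torus2_distr_swap: "distr torus2_measure torus2_measure prod.swap = torus2_measure"
  unfolding torus2_measure_def swap_eq_Pair using torus2.distr_pair_swap by (simp add: case_prod_beta')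

lemma torus2_integral_swap:
  fixes f :: "_ \<Rightarrow> _::{banach, second_countable_topology}"
  assumes "f \<in> borel_measurable torus2_measure"
  shows "(\<integral>x. f (prod.swap x) \<partial>torus2_measure) = (\<integral>x. f x \<partial>torus2_measure)"
  using integral_distr[OF torus2_measurable_swap assms] by (simp add: torus2_distr_swap)

lemma torus2_integrable_swap:
  fixes f :: "_ \<Rightarrow> _::{banach, second_countable_topology}"
  assumes "integrable torus2_measure f"
  shows "integrable torus2_measure (\<lambda>x. f (prod.swap x))"
  using integrable_distr[OF torus2_measurable_swap, of f] assms by (simp add: torus2_distr_swap)

lemma torus2_AE_swap:
  assumes "AE x in torus2_measure. P x"
  shows "AE x in torus2_measure. P (prod.swap x)"
  by (rule AE_distrD[OF torus2_measurable_swap]) (unfold torus2_distr_swap, rule assms)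

lemma AE_torus2_fst:
  assumes "AE p in torus_measure. P p"
  shows "AE x in torus2_measure. P (fst x)"
proof -
  obtain N where N: "{p \<in> space torus_measure. \<not> P p} \<subseteq> N" "emeasure torus_measure N = 0" "N \<in> sets torus_measure"
    using AE_E[OF assms] by blast
  have T: "torus \<in> sets torus_measure" using sets.top[of torus_measure] by simp
  have "emeasure torus2_measure (N \<times> torus) = emeasure torus_measure N * emeasure torus_measure torus"
    unfolding torus2_measure_def by (rule torus.emeasure_pair_measure_Times[OF N(3) T])
  then have "N \<times> torus \<in> null_sets torus2_measure"
    using N T by (auto simp: null_sets_def torus2_measure_def)
  then show ?thesis by (rule AE_I') (use N(1) in auto)
qed

lemma AE_torus2_snd:
  assumes "AE p in torus_measure. P p"
  shows "AE x in torus2_measure. P (snd x)"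
  using torus2_AE_swap[OF AE_torus2_fst[OF assms]] by simp

lemma torus2_Fubini:
  fixes f :: "_ \<Rightarrow> _::{banach, second_countable_topology}"
  assumes "integrable torus2_measure f"
  shows "(\<integral>x. f x \<partial>torus2_measure) = (\<integral>p. \<integral>q. f (p, q) \<partial>torus_measure \<partial>torus_measure)"
    and "(\<integral>x. f x \<partial>torus2_measure) = (\<integral>q. \<integral>p. f (p, q) \<partial>torus_measure \<partial>torus_measure)"
  using torus2.integral_fst'[of f] torus2.integral_snd[of "\<lambda>p q. f (p, q)"] assms
  by (simp_all add: torus2_measure_def)

lemma torus2_sections:
  fixes f :: "_ \<Rightarrow> _::{banach, second_countable_topology}"
  assumes "integrable torus2_measure f"
  shows "AE p in torus_measure. integrable torus_measure (\<lambda>q. f (p, q))"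
    and "AE q in torus_measure. integrable torus_measure (\<lambda>p. f (p, q))"
    and "integrable torus_measure (\<lambda>p. \<integral>q. f (p, q) \<partial>torus_measure)"
    and "integrable torus_measure (\<lambda>q. \<integral>p. f (p, q) \<partial>torus_measure)"
  using torus2.AE_integrable_fst'[of f] torus2.AE_integrable_snd[of "\<lambda>p q. f (p, q)"]
    torus2.integrable_fst'[of f] torus2.integrable_snd[of "\<lambda>p q. f (p, q)"] assms
  by (simp_all add: torus2_measure_def)

lemma torus2_AE_section:
  assumes "AE x in torus2_measure. P x"
  shows "AE p in torus_measure. AE q in torus_measure. P (p, q)"
  using assms unfolding torus2_measure_def by (rule torus2.AE_pair)

lemma torus2_integrable_fst:
  fixes g :: "_ \<Rightarrow> real"
  assumes "integrable torus_measure g"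
  shows "integrable torus2_measure (\<lambda>x. g (fst x))"
  unfolding integrable_iff_bounded
proof
  note [measurable] = borel_measurable_integrable[OF assms]
  show "(\<lambda>x. g (fst x)) \<in> borel_measurable torus2_measure" by measurable
  have "(\<lambda>x. ennreal (norm (g (fst x)))) \<in> borel_measurable (torus_measure \<Otimes>\<^sub>M torus_measure)" by measurable
  from torus.nn_integral_fst[OF this]
  have "(\<integral>\<^sup>+ x. ennreal (norm (g (fst x))) \<partial>torus2_measure) = (\<integral>\<^sup>+p. ennreal (norm (g p)) * emeasure torus_measure torus \<partial>torus_measure)"
    by (simp add: torus2_measure_def)
  also have "\<dots> = (\<integral>\<^sup>+p. ennreal (norm (g p)) \<partial>torus_measure) * ennreal vol"
    by (simp add: nn_integral_multc emeasure_torus)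
  also have "\<dots> < \<infinity>" using assms by (simp add: integrable_iff_bounded ennreal_mult_less_top)
  finally show "(\<integral>\<^sup>+ x. ennreal (norm (g (fst x))) \<partial>torus2_measure) < \<infinity>" .
qed

lemma torus2_integrable_snd:
  fixes g :: "_ \<Rightarrow> real"
  assumes "integrable torus_measure g"
  shows "integrable torus2_measure (\<lambda>x. g (snd x))"
  using torus2_integrable_swap[OF torus2_integrable_fst[OF assms]] by simp

lemma sq_int_fst: "sq_int torus_measure g \<Longrightarrow> sq_int torus2_measure (\<lambda>x. g (fst x))"
  unfolding sq_int_def using torus2_integrable_fst[of "\<lambda>x. (g x)\<^sup>2"] by auto

lemma sq_int_snd: "sq_int torus_measure g \<Longrightarrow> sq_int torus2_measure (\<lambda>x. g (snd x))"
  unfolding sq_int_def using torus2_integrable_snd[of "\<lambda>x. (g x)\<^sup>2"] by auto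

lemma torus2_integral_fst:
  assumes "integrable torus_measure g"
  shows "(\<integral>x. g (fst x) \<partial>torus2_measure) = vol * (\<integral>p. g p \<partial>torus_measure)"
  using torus2_Fubini(1)[OF torus2_integrable_fst[OF assms]] by (simp add: measure_torus)

lemma torus2_integral_snd:
  assumes "integrable torus_measure g"
  shows "(\<integral>x. g (snd x) \<partial>torus2_measure) = vol * (\<integral>p. g p \<partial>torus_measure)"
  using torus2_Fubini(2)[OF torus2_integrable_snd[OF assms]] by (simp add: measure_torus)

lemma torus2_integrable_prod:
  assumes "sq_int torus_measure f" "sq_int torus_measure g"
  shows "integrable torus2_measure (\<lambda>x. f (fst x) * g (snd x))"
  by (rule sq_int_mult_integrable[OF sq_int_fst[OF assms(1)] sq_int_snd[OF assms(2)]])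

lemma torus2_integral_prod:
  assumes "sq_int torus_measure f" "sq_int torus_measure g"
  shows "(\<integral>x. f (fst x) * g (snd x) \<partial>torus2_measure) = (\<integral>p. f p \<partial>torus_measure) * (\<integral>q. g q \<partial>torus_measure)"
  by (simp add: torus2_Fubini(1)[OF torus2_integrable_prod[OF assms]])

section \<open>The dispersion relation\<close>

lemma eps_eq: "eps p = 3 - (\<Sum>i\<in>UNIV. cos (p $ i))"
  by (simp add: eps_def sum_subtractf)

lemma eps_nonneg: "0 \<le> eps p"
  unfolding eps_def by (rule sum_nonneg) simp

lemma eps_le_6: "eps p \<le> 6"
proof -
  have "eps p \<le> (\<Sum>i\<in>(UNIV::3 set). 2)"
    unfolding eps_def using cos_ge_minus_one by (intro sum_mono) (smt (verit))
  then show ?thesis by simp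
qed

lemma continuous_on_eps [continuous_intros]:
  fixes f :: "'a::t2_space \<Rightarrow> real^3"
  shows "continuous_on A f \<Longrightarrow> continuous_on A (\<lambda>x. eps (f x))"
  unfolding eps_def by (auto intro!: continuous_intros)

lemma eps_measurable [measurable]: "eps \<in> borel_measurable torus_measure"
  by (rule continuous_imp_torus_measurable) (intro continuous_intros)

lemma sq_int_eps: "sq_int torus_measure eps"
  by (rule torus.sq_int_bounded[where C = 6]) (auto simp: eps_nonneg eps_le_6)

definition kker :: "real^3 \<Rightarrow> real^3 \<Rightarrow> real^3 \<Rightarrow> real" where
  "kker K p q = (\<Sum>i\<in>UNIV. cos (K $ i - p $ i - q $ i))"

lemma eps_eq_kker: "eps (K - p - q) = 3 - kker K p q"
  by (simp add: eps_eq kker_def)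

lemma abs_kker_le: "\<bar>kker K p q\<bar> \<le> 3"
proof -
  have "\<bar>kker K p q\<bar> \<le> (\<Sum>i\<in>(UNIV::3 set). 1)"
    unfolding kker_def by (intro order_trans[OF sum_abs] sum_mono) simp
  then show ?thesis by simp
qed

lemma E_disp_eq: "E_disp \<gamma> K p q = eps p + eps q + 3 * \<gamma> - \<gamma> * kker K p q"
  unfolding E_disp_def eps_eq_kker by (simp add: algebra_simps)

lemma E_disp_bounds:
  assumes "0 \<le> \<gamma>"
  shows "0 \<le> E_disp \<gamma> K p q" "E_disp \<gamma> K p q \<le> 12 + 6 * \<gamma>"
  using assms eps_nonneg[of p] eps_nonneg[of q] eps_nonneg[of "K - p - q"]
    eps_le_6[of p] eps_le_6[of q] mult_left_mono[OF eps_le_6[of "K - p - q"], of \<gamma>]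
  by (auto simp: E_disp_def)

lemma E_disp_commute: "E_disp \<gamma> K p q = E_disp \<gamma> K q p"
  by (simp add: E_disp_def algebra_simps)

lemma kker_measurable [measurable]: "(\<lambda>x. kker K (fst x) (snd x)) \<in> borel_measurable torus2_measure"
  by (rule continuous_imp_torus2_measurable) (unfold kker_def, intro continuous_intros)

lemma E_disp_measurable [measurable]: "(\<lambda>x. E_disp \<gamma> K (fst x) (snd x)) \<in> borel_measurable torus2_measure"
  by (rule continuous_imp_torus2_measurable) (unfold E_disp_def, intro continuous_intros)

lemma E_disp_measurable_fst [measurable]: "(\<lambda>p. E_disp \<gamma> K p q) \<in> borel_measurable torus_measure"
  by (rule continuous_imp_torus_measurable) (unfold E_disp_def, intro continuous_intros)

lemma integral_torus_cos: "(\<integral>p. cos (c - p $ i) \<partial>torus_measure) = 0"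
proof -
  have "(\<integral>p. cos (p $ i + (- c)) \<partial>torus_measure) = 0"
    using integral_torus_one[of "\<lambda>t. cos (t + (- c))" i] integral_cos_shift[of "- c"]
    by (simp add: continuous_intros)
  moreover have "cos (p $ i + (- c)) = cos (c - p $ i)" for p :: "real^3"
    using cos_minus[of "c - p $ i"] by (simp add: algebra_simps)
  ultimately show ?thesis by simp
qed

lemma integral_torus_eps_shift: "(\<integral>p. eps (c - p) \<partial>torus_measure) = 3 * vol"
proof -
  have [simp]: "integrable torus_measure (\<lambda>p. cos (c $ i - p $ i))" for i
    by (rule torus.integrable_const_bound[where B = 1]) (auto intro!: borel_measurable_cos)
  show ?thesis by (simp add: eps_eq integral_torus_cos measure_torus)
qed

lemma integral_torus_eps: "(\<integral>p. eps p \<partial>torus_measure) = 3 * vol"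
proof -
  have "eps (0 - p) = eps p" for p by (simp add: eps_def)
  then show ?thesis using integral_torus_eps_shift[of 0] by simp
qed

lemma integral_torus_E_disp: "(\<integral>p. E_disp \<gamma> K p q \<partial>torus_measure) = vol * (3 + eps q + 3 * \<gamma>)"
proof -
  have "K - p - q = (K - q) - p" for p by simp
  moreover have "integrable torus_measure eps" using torus.sq_int_integrable[OF sq_int_eps] .
  moreover have "integrable torus_measure (\<lambda>p. eps (K - q - p))"
    using eps_nonneg eps_le_6
    by (intro torus.integrable_const_bound[where B = 6] continuous_imp_torus_measurable continuous_intros) auto
  ultimately show ?thesis
    unfolding E_disp_def using integral_torus_eps_shift[of "K - q"] integral_torus_eps
    by (simp add: measure_torus algebra_simps)
qed

section \<open>The effective quadratic form at infinite coupling\<close>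

definition qker :: "real^3 \<Rightarrow> (real^3 \<Rightarrow> real) \<Rightarrow> real" where
  "qker K \<phi> = (\<integral>x. kker K (fst x) (snd x) * (\<phi> (fst x) * \<phi> (snd x)) \<partial>torus2_measure)"

definition qform :: "real \<Rightarrow> real^3 \<Rightarrow> (real^3 \<Rightarrow> real) \<Rightarrow> real" where
  "qform \<gamma> K \<phi> = (\<integral>p. eps p * (\<phi> p)\<^sup>2 \<partial>torus_measure) + \<gamma> / vol * qker K \<phi>"

lemma sq_int_fst_snd:
  assumes "sq_int torus_measure f" "sq_int torus_measure g"
  shows "sq_int torus2_measure (\<lambda>x. f (fst x) * g (snd x))"
  unfolding sq_int_def
proof
  note [measurable] = sq_intD(1)[OF assms(1)] sq_intD(1)[OF assms(2)]
  show "(\<lambda>x. f (fst x) * g (snd x)) \<in> borel_measurable torus2_measure" by measurable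
  show "integrable torus2_measure (\<lambda>x. (f (fst x) * g (snd x))\<^sup>2)"
    unfolding integrable_iff_bounded
  proof
    show "(\<lambda>x. (f (fst x) * g (snd x))\<^sup>2) \<in> borel_measurable torus2_measure" by measurable
    have "(\<lambda>x. ennreal (norm ((f (fst x) * g (snd x))\<^sup>2))) \<in> borel_measurable (torus_measure \<Otimes>\<^sub>M torus_measure)" by measurable
    from torus.nn_integral_fst[OF this]
    have "(\<integral>\<^sup>+ x. ennreal (norm ((f (fst x) * g (snd x))\<^sup>2)) \<partial>torus2_measure)
      = (\<integral>\<^sup>+p. (\<integral>\<^sup>+q. ennreal ((f p)\<^sup>2) * ennreal ((g q)\<^sup>2) \<partial>torus_measure) \<partial>torus_measure)"
      by (simp add: torus2_measure_def power_mult_distrib ennreal_mult)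
    also have "\<dots> = (\<integral>\<^sup>+p. ennreal ((f p)\<^sup>2) \<partial>torus_measure) * (\<integral>\<^sup>+q. ennreal ((g q)\<^sup>2) \<partial>torus_measure)"
      by (simp add: nn_integral_cmult nn_integral_multc)
    also have "\<dots> < \<infinity>" using assms by (simp add: nn_integral_eq_integral sq_int_def ennreal_mult_less_top)
    finally show "(\<integral>\<^sup>+ x. ennreal (norm ((f (fst x) * g (snd x))\<^sup>2)) \<partial>torus2_measure) < \<infinity>" .
  qed
qed

lemma torus2_integrable_kernel:
  assumes "sq_int torus_measure f" "sq_int torus_measure g"
    and "b \<in> borel_measurable torus2_measure" "\<And>x. x \<in> torus \<times> torus \<Longrightarrow> \<bar>b x\<bar> \<le> C"
  shows "integrable torus2_measure (\<lambda>x. b x * (f (fst x) * g (snd x)))"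
proof (rule torus2f.sq_int_integrable, rule sq_int_mult_bounded)
  show "AE x in torus2_measure. \<bar>b x\<bar> \<le> C" using assms(4) by (intro AE_I2) auto
qed (use assms(3) sq_int_fst_snd[OF assms(1,2)] in auto)

lemma qker_integrable:
  assumes "sq_int torus_measure f" "sq_int torus_measure g"
  shows "integrable torus2_measure (\<lambda>x. kker K (fst x) (snd x) * (f (fst x) * g (snd x)))"
  using abs_kker_le by (intro torus2_integrable_kernel[OF assms, where C = 3]) auto

definition csh :: "real^3 \<Rightarrow> 3 \<Rightarrow> real^3 \<Rightarrow> real" where "csh K i p = cos (p $ i - K $ i / 2)"
definition ssh :: "real^3 \<Rightarrow> 3 \<Rightarrow> real^3 \<Rightarrow> real" where "ssh K i p = sin (p $ i - K $ i / 2)"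

lemma csh_ssh_bounds: "\<bar>csh K i p\<bar> \<le> 1" "\<bar>ssh K i p\<bar> \<le> 1"
  by (simp_all add: csh_def ssh_def)

lemma csh_ssh_measurable [measurable]:
  "csh K i \<in> borel_measurable torus_measure" "ssh K i \<in> borel_measurable torus_measure"
  by (auto intro!: continuous_imp_torus_measurable continuous_intros simp: csh_def[abs_def] ssh_def[abs_def])

lemma sq_int_csh_ssh: "sq_int torus_measure (csh K i)" "sq_int torus_measure (ssh K i)"
  using csh_ssh_bounds by (auto intro!: torus.sq_int_bounded[where C = 1])

text \<open>After the shift by half of \<open>K\<close> each summand is the cosine of a sum, and the
  addition theorem splits the kernel into three positive and three negative squares. The negative
  part thus has rank at most three.\<close>

lemma kker_separated: "kker K p q = (\<Sum>i\<in>UNIV. csh K i p * csh K i q - ssh K i p * ssh K i q)"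
proof -
  have "cos (K $ i - p $ i - q $ i) = cos ((p $ i - K $ i / 2) + (q $ i - K $ i / 2))" for i
    using cos_minus[of "K $ i - p $ i - q $ i"] by (simp add: algebra_simps)
  then show ?thesis unfolding kker_def csh_def ssh_def cos_add by simp
qed

lemma qker_eq:
  assumes "sq_int torus_measure \<phi>"
  shows "qker K \<phi> = (\<Sum>i\<in>UNIV. (\<integral>p. csh K i p * \<phi> p \<partial>torus_measure)\<^sup>2 - (\<integral>p. ssh K i p * \<phi> p \<partial>torus_measure)\<^sup>2)"
proof -
  have c: "sq_int torus_measure (\<lambda>p. csh K i p * \<phi> p)" and s: "sq_int torus_measure (\<lambda>p. ssh K i p * \<phi> p)" for i
    using csh_ssh_bounds assms by (auto intro!: sq_int_mult_bounded[where C = 1])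
  have eq: "kker K (fst x) (snd x) * (\<phi> (fst x) * \<phi> (snd x))
    = (\<Sum>i\<in>UNIV. (csh K i (fst x) * \<phi> (fst x)) * (csh K i (snd x) * \<phi> (snd x))
        - (ssh K i (fst x) * \<phi> (fst x)) * (ssh K i (snd x) * \<phi> (snd x)))" for x
    unfolding kker_separated sum_distrib_right by (intro sum.cong) (auto simp: algebra_simps)
  show ?thesis unfolding qker_def eq
    by (simp add: torus2_integrable_prod[OF c c] torus2_integrable_prod[OF s s]
        torus2_integral_prod[OF c c] torus2_integral_prod[OF s s] power2_eq_square)
qed

lemma antisym_norm:
  assumes \<phi>: "sq_int torus_measure \<phi>" and z: "(\<integral>p. \<phi> p \<partial>torus_measure) = 0"
  shows "(\<integral>x. (\<phi> (snd x) - \<phi> (fst x))\<^sup>2 \<partial>torus2_measure) = 2 * vol * (\<integral>p. (\<phi> p)\<^sup>2 \<partial>torus_measure)"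
proof -
  have i: "integrable torus_measure (\<lambda>p. (\<phi> p)\<^sup>2)" using \<phi> by (simp add: sq_int_def)
  have "(\<phi> (snd x) - \<phi> (fst x))\<^sup>2 = (\<phi> (fst x))\<^sup>2 + (\<phi> (snd x))\<^sup>2 - 2 * (\<phi> (fst x) * \<phi> (snd x))" for x
    by (simp add: power2_diff)
  then show ?thesis
    using torus2_integrable_fst[OF i] torus2_integrable_snd[OF i] torus2_integrable_prod[OF \<phi> \<phi>]
      torus2_integral_fst[OF i] torus2_integral_snd[OF i] torus2_integral_prod[OF \<phi> \<phi>] z
    by simp
qed

text \<open>Mean zero annihilates every part of the dispersion that is constant in one of the two
  variables; only \<open>kker\<close> couples them.\<close>

lemma E_disp_product_form:
  assumes \<phi>: "sq_int torus_measure \<phi>" and z: "(\<integral>p. \<phi> p \<partial>torus_measure) = 0"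
  shows "(\<integral>x. E_disp \<gamma> K (fst x) (snd x) * (\<phi> (fst x) * \<phi> (snd x)) \<partial>torus2_measure) = - \<gamma> * qker K \<phi>"
proof -
  have e\<phi>: "sq_int torus_measure (\<lambda>p. eps p * \<phi> p)"
    using eps_nonneg eps_le_6 by (intro sq_int_mult_bounded[OF \<phi>, where C = 6]) auto
  have eq: "E_disp \<gamma> K (fst x) (snd x) * (\<phi> (fst x) * \<phi> (snd x)) = (eps (fst x) * \<phi> (fst x)) * \<phi> (snd x)
    + \<phi> (fst x) * (eps (snd x) * \<phi> (snd x)) + 3 * \<gamma> * (\<phi> (fst x) * \<phi> (snd x))
    - \<gamma> * (kker K (fst x) (snd x) * (\<phi> (fst x) * \<phi> (snd x)))" for x
    by (simp add: E_disp_eq algebra_simps)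
  show ?thesis unfolding eq
    by (simp add: torus2_integrable_prod[OF \<phi> \<phi>] torus2_integrable_prod[OF e\<phi> \<phi>] torus2_integrable_prod[OF \<phi> e\<phi>]
        torus2_integral_prod[OF \<phi> \<phi>] torus2_integral_prod[OF e\<phi> \<phi>] torus2_integral_prod[OF \<phi> e\<phi>]
        qker_integrable[OF \<phi> \<phi>] z qker_def)
qed

text \<open>In the two square terms one variable integrates out and leaves the average
  \<open>3 + 3\<gamma> + eps\<close> of the dispersion; the cross term leaves \<open>qker\<close>.
  This is the origin of the level \<open>3 + 3\<gamma>\<close> from which \<open>qform\<close> is
  measured.\<close>

lemma antisym_form:
  assumes \<phi>: "sq_int torus_measure \<phi>" and z: "(\<integral>p. \<phi> p \<partial>torus_measure) = 0" and \<gamma>: "0 \<le> \<gamma>"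
  shows "(\<integral>x. E_disp \<gamma> K (fst x) (snd x) * (\<phi> (snd x) - \<phi> (fst x))\<^sup>2 \<partial>torus2_measure)
    = 2 * vol * ((3 + 3 * \<gamma>) * (\<integral>p. (\<phi> p)\<^sup>2 \<partial>torus_measure) + qform \<gamma> K \<phi>)"
proof -
  define E where "E x = E_disp \<gamma> K (fst x) (snd x)" for x
  have [measurable]: "E \<in> borel_measurable torus2_measure" unfolding E_def[abs_def] by measurable
  have Eb: "\<bar>E x\<bar> \<le> 12 + 6 * \<gamma>" for x using E_disp_bounds[OF \<gamma>] by (simp add: E_def)
  have i: "integrable torus_measure (\<lambda>p. (\<phi> p)\<^sup>2)" using \<phi> by (simp add: sq_int_def)
  have bd: "integrable torus2_measure (\<lambda>x. E x * f x)" if "integrable torus2_measure f" for f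
    by (rule Bochner_Integration.integrable_bound[of _ "\<lambda>x. (12 + 6 * \<gamma>) * f x"])
      (use that Eb \<gamma> in \<open>auto simp: abs_mult intro!: mult_right_mono\<close>)
  have ei: "integrable torus_measure (\<lambda>p. eps p * (\<phi> p)\<^sup>2)"
    by (rule Bochner_Integration.integrable_bound[of _ "\<lambda>p. 6 * (\<phi> p)\<^sup>2"])
      (use i sq_intD(1)[OF \<phi>] eps_nonneg eps_le_6 in \<open>auto simp: abs_mult intro!: mult_right_mono\<close>)
  have i1: "integrable torus2_measure (\<lambda>x. E x * (\<phi> (fst x))\<^sup>2)"
    and i2: "integrable torus2_measure (\<lambda>x. E x * (\<phi> (snd x))\<^sup>2)"
    and i3: "integrable torus2_measure (\<lambda>x. E x * (\<phi> (fst x) * \<phi> (snd x)))"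
    using torus2_integrable_fst[OF i] torus2_integrable_snd[OF i] torus2_integrable_prod[OF \<phi> \<phi>] by (auto intro: bd)
  have s2: "(\<integral>x. E x * (\<phi> (snd x))\<^sup>2 \<partial>torus2_measure)
    = vol * ((3 + 3 * \<gamma>) * (\<integral>p. (\<phi> p)\<^sup>2 \<partial>torus_measure) + (\<integral>p. eps p * (\<phi> p)\<^sup>2 \<partial>torus_measure))"
  proof -
    have "(\<integral>x. E x * (\<phi> (snd x))\<^sup>2 \<partial>torus2_measure)
      = (\<integral>q. vol * ((3 + 3 * \<gamma>) * (\<phi> q)\<^sup>2 + eps q * (\<phi> q)\<^sup>2) \<partial>torus_measure)"
      by (subst torus2_Fubini(2)[OF i2]) (simp add: E_def integral_torus_E_disp algebra_simps)
    then show ?thesis using i ei by simp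
  qed
  have s1: "(\<integral>x. E x * (\<phi> (fst x))\<^sup>2 \<partial>torus2_measure) = (\<integral>x. E x * (\<phi> (snd x))\<^sup>2 \<partial>torus2_measure)"
    using torus2_integral_swap[OF borel_measurable_integrable[OF i2]] by (simp add: E_def E_disp_commute)
  have s3: "(\<integral>x. E x * (\<phi> (fst x) * \<phi> (snd x)) \<partial>torus2_measure) = - \<gamma> * qker K \<phi>"
    unfolding E_def by (rule E_disp_product_form[OF \<phi> z])
  have "E x * (\<phi> (snd x) - \<phi> (fst x))\<^sup>2 = E x * (\<phi> (fst x))\<^sup>2 + E x * (\<phi> (snd x))\<^sup>2 - 2 * (E x * (\<phi> (fst x) * \<phi> (snd x)))" for x
    by (simp add: power2_diff algebra_simps)
  then have "(\<integral>x. E x * (\<phi> (snd x) - \<phi> (fst x))\<^sup>2 \<partial>torus2_measure)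
     = 2 * (vol * ((3 + 3 * \<gamma>) * (\<integral>p. (\<phi> p)\<^sup>2 \<partial>torus_measure) + (\<integral>p. eps p * (\<phi> p)\<^sup>2 \<partial>torus_measure))) + 2 * \<gamma> * qker K \<phi>"
    using i1 i2 i3 by (simp add: s1 s2 s3)
  then show ?thesis using vol_pos by (simp add: E_def qform_def algebra_simps)
qed

lemma integral_ssh: "(\<integral>p. ssh K i p \<partial>torus_measure) = 0"
  using integral_torus_one[of "\<lambda>t. sin (t + - (K $ i / 2))" i] integral_sin_shift[of "- (K $ i / 2)"]
  by (simp add: ssh_def continuous_intros)

lemma integral_ssh_ssh: "(\<integral>p. ssh K i p * ssh K j p \<partial>torus_measure) = (if i = j then vol / 2 else 0)"
proof (cases "i = j")
  case True
  then show ?thesis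
    using integral_torus_one[of "\<lambda>t. (sin (t + - (K $ i / 2)))\<^sup>2" i] integral_sin_sq_shift[of "- (K $ i / 2)"]
    by (simp add: ssh_def continuous_intros vol_def power2_eq_square power3_eq_cube)
next
  case False
  then show ?thesis
    using integral_torus_two[of "\<lambda>t. sin (t + - (K $ i / 2))" "\<lambda>t. sin (t + - (K $ j / 2))" i j]
      integral_sin_shift[of "- (K $ i / 2)"]
    by (simp add: ssh_def continuous_intros)
qed

lemma integral_csh_ssh: "(\<integral>p. csh K i p * ssh K j p \<partial>torus_measure) = 0"
proof (cases "i = j")
  case True
  then show ?thesis
    using integral_torus_one[of "\<lambda>t. sin (t + - (K $ i / 2)) * cos (t + - (K $ i / 2))" i]
      integral_sin_cos_shift[of "- (K $ i / 2)"]
    by (simp add: ssh_def csh_def continuous_intros mult.commute)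
next
  case False
  then show ?thesis
    using integral_torus_two[of "\<lambda>t. cos (t + - (K $ i / 2))" "\<lambda>t. sin (t + - (K $ j / 2))" i j]
      integral_cos_shift[of "- (K $ i / 2)"]
    by (simp add: ssh_def csh_def continuous_intros)
qed

section \<open>The real Hilbert space of antisymmetric functions\<close>

lemma (in finite_measure) integral_abs_le_sqrt:
  assumes "sq_int M f"
  shows "(\<integral>x. \<bar>f x\<bar> \<partial>M) \<le> sqrt (measure M (space M)) * sqrt (\<integral>x. (f x)\<^sup>2 \<partial>M)"
proof -
  note [measurable] = sq_intD(1)[OF assms]
  have "sq_int M (\<lambda>x. \<bar>f x\<bar>)" using assms by (auto simp: sq_int_def)
  moreover have "sq_int M (\<lambda>_. 1)" by (simp add: sq_int_def)
  ultimately have "(\<integral>x. \<bar>f x\<bar> * 1 \<partial>M)\<^sup>2 \<le> (\<integral>x. \<bar>f x\<bar>\<^sup>2 \<partial>M) * (\<integral>x. 1\<^sup>2 \<partial>M)"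
    by (rule sq_int_Cauchy_Schwarz)
  then have "(\<integral>x. \<bar>f x\<bar> \<partial>M)\<^sup>2 \<le> measure M (space M) * (\<integral>x. (f x)\<^sup>2 \<partial>M)" by (simp add: mult.commute)
  then have "sqrt ((\<integral>x. \<bar>f x\<bar> \<partial>M)\<^sup>2) \<le> sqrt (measure M (space M) * (\<integral>x. (f x)\<^sup>2 \<partial>M))"
    by (rule real_sqrt_le_mono)
  then show ?thesis by (simp add: real_sqrt_mult)
qed

text \<open>On a finite measure space geometric decay of the \<open>L\<^sup>2\<close> distances makes the \<open>L\<^sup>1\<close> norms of the
  increments summable, hence gives convergence almost everywhere; Fatou's lemma does the rest.\<close>

lemma (in finite_measure) sq_int_complete:
  fixes g :: "nat \<Rightarrow> 'a \<Rightarrow> real"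
  assumes g: "\<And>n. sq_int M (g n)"
    and d: "\<And>n m. n \<le> m \<Longrightarrow> (\<integral>x. (g n x - g m x)\<^sup>2 \<partial>M) \<le> (1/4) ^ n"
  obtains f where "sq_int M f" "AE x in M. (\<lambda>n. g n x) \<longlonglongrightarrow> f x"
    "\<And>n. (\<integral>x. (g n x - f x)\<^sup>2 \<partial>M) \<le> (1/4) ^ n"
proof -
  have [measurable]: "g n \<in> borel_measurable M" for n using sq_intD(1)[OF g] .
  define D where "D n x = \<bar>g n x - g (Suc n) x\<bar>" for n x
  have [measurable]: "D n \<in> borel_measurable M" for n unfolding D_def[abs_def] by measurable
  define C where "C = sqrt (measure M (space M))"
  have D_le: "(\<integral>\<^sup>+x. ennreal (D n x) \<partial>M) \<le> ennreal (C * (1/2) ^ n)" for n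
  proof -
    have s: "sq_int M (\<lambda>x. g n x - g (Suc n) x)" by (intro sq_int_diff g)
    have "(\<integral>x. D n x \<partial>M) \<le> C * sqrt (\<integral>x. (g n x - g (Suc n) x)\<^sup>2 \<partial>M)"
      unfolding D_def C_def by (rule integral_abs_le_sqrt[OF s])
    also have "\<dots> \<le> C * sqrt ((1/4) ^ n)"
      using d[of n "Suc n"] by (intro mult_left_mono) (auto simp: C_def)
    also have "sqrt ((1/4) ^ n) = (1/2 :: real) ^ n" by (simp add: real_sqrt_power real_sqrt_divide)
    finally have "ennreal (\<integral>x. D n x \<partial>M) \<le> ennreal (C * (1/2) ^ n)" by (rule ennreal_leI)
    moreover have "(\<integral>\<^sup>+x. ennreal (D n x) \<partial>M) = ennreal (\<integral>x. D n x \<partial>M)"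
      using sq_int_integrable[OF s] by (intro nn_integral_eq_integral) (auto simp: D_def)
    ultimately show ?thesis by simp
  qed
  have "(\<integral>\<^sup>+x. (\<Sum>n. ennreal (D n x)) \<partial>M) = (\<Sum>n. \<integral>\<^sup>+x. ennreal (D n x) \<partial>M)"
    by (rule nn_integral_suminf) measurable
  also have "\<dots> \<le> (\<Sum>n. ennreal (C * (1/2) ^ n))"
    using D_le by (intro suminf_le) auto
  also have "\<dots> = ennreal (\<Sum>n. C * (1/2) ^ n)"
    by (intro suminf_ennreal2 summable_mult summable_geometric) (auto simp: C_def)
  also have "\<dots> < \<infinity>" by simp
  finally have "AE x in M. (\<Sum>n. ennreal (D n x)) \<noteq> \<infinity>"
    by (intro nn_integral_PInf_AE) auto
  then have conv: "AE x in M. convergent (\<lambda>n. g n x)"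
  proof eventually_elim
    case (elim x)
    have "summable (\<lambda>n. D n x)" using elim by (intro summable_suminf_not_top) (auto simp: D_def)
    moreover have "D n x = norm (g (Suc n) x - g n x)" for n by (simp add: D_def)
    ultimately have "summable (\<lambda>n. norm (g (Suc n) x - g n x))" by simp
    then have "summable (\<lambda>n. g (Suc n) x - g n x)" by (rule summable_norm_cancel)
    then have "convergent (\<lambda>n. \<Sum>i<n. g (Suc i) x - g i x)" by (simp add: summable_iff_convergent)
    then have "convergent (\<lambda>n. g n x - g 0 x)" by (simp add: sum_lessThan_telescope[of "\<lambda>n. g n x"])
    then have "convergent (\<lambda>n. (g n x - g 0 x) + g 0 x)" by (intro convergent_add convergent_const)
    then show ?case by simp
  qed
  define f where "f x = lim (\<lambda>n. g n x)" for x
  have [measurable]: "f \<in> borel_measurable M" unfolding f_def[abs_def] by measurable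
  have lim: "AE x in M. (\<lambda>n. g n x) \<longlonglongrightarrow> f x"
    using conv by eventually_elim (simp add: f_def convergent_LIMSEQ_iff)
  have est: "(\<integral>\<^sup>+x. ennreal ((g n x - f x)\<^sup>2) \<partial>M) \<le> ennreal ((1/4) ^ n)" for n
  proof -
    have "(\<integral>\<^sup>+x. ennreal ((g n x - f x)\<^sup>2) \<partial>M) = (\<integral>\<^sup>+x. liminf (\<lambda>m. ennreal ((g n x - g m x)\<^sup>2)) \<partial>M)"
    proof (rule nn_integral_cong_AE)
      show "AE x in M. ennreal ((g n x - f x)\<^sup>2) = liminf (\<lambda>m. ennreal ((g n x - g m x)\<^sup>2))"
        using lim
      proof eventually_elim
        case (elim x)
        then have "(\<lambda>m. ennreal ((g n x - g m x)\<^sup>2)) \<longlonglongrightarrow> ennreal ((g n x - f x)\<^sup>2)"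
          by (intro tendsto_intros)
        then show ?case by (intro lim_imp_Liminf[symmetric]) auto
      qed
    qed
    also have "\<dots> \<le> liminf (\<lambda>m. \<integral>\<^sup>+x. ennreal ((g n x - g m x)\<^sup>2) \<partial>M)"
      by (rule nn_integral_liminf) measurable
    also have "\<dots> \<le> ennreal ((1/4) ^ n)"
    proof (rule Liminf_le)
      show "\<forall>\<^sub>F m in sequentially. (\<integral>\<^sup>+x. ennreal ((g n x - g m x)\<^sup>2) \<partial>M) \<le> ennreal ((1/4) ^ n)"
        using eventually_ge_at_top[of n]
      proof eventually_elim
        case (elim m)
        have "sq_int M (\<lambda>x. g n x - g m x)" by (intro sq_int_diff g)
        then show ?case using d[OF elim] by (simp add: nn_integral_eq_integral sq_int_def ennreal_leI)
      qed
    qed simp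
    finally show ?thesis .
  qed
  have s: "sq_int M (\<lambda>x. g n x - f x)" for n
    unfolding sq_int_def integrable_iff_bounded using est[of n] by (auto simp: le_less_trans)
  have "sq_int M (\<lambda>x. g 0 x - (g 0 x - f x))" by (intro sq_int_diff g s)
  then have "sq_int M f" by simp
  moreover have "(\<integral>x. (g n x - f x)\<^sup>2 \<partial>M) \<le> (1/4) ^ n" for n
    using est[of n] s[of n] by (simp add: nn_integral_eq_integral sq_int_def)
  ultimately show ?thesis using lim that by blast
qed

section \<open>Antisymmetric functions modulo null sets as a type\<close>

definition asq :: "((real^3) \<times> (real^3) \<Rightarrow> real) \<Rightarrow> bool" where
  "asq f \<longleftrightarrow> sq_int torus2_measure f \<and> (AE x in torus2_measure. f x = - f (prod.swap x))"

lemma asqD: "asq f \<Longrightarrow> sq_int torus2_measure f" "asq f \<Longrightarrow> AE x in torus2_measure. f x = - f (prod.swap x)"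
  by (auto simp: asq_def)

lemma asq_measurable: "asq f \<Longrightarrow> f \<in> borel_measurable torus2_measure"
  using asqD(1) sq_intD(1) by blast

lemma asq_zero: "asq (\<lambda>_. 0)"
  by (simp add: asq_def sq_int_def)

lemma asq_add:
  assumes "asq f" "asq g"
  shows "asq (\<lambda>x. f x + g x)"
  unfolding asq_def
proof
  show "AE x in torus2_measure. f x + g x = - (f (prod.swap x) + g (prod.swap x))"
    using asqD(2)[OF assms(1)] asqD(2)[OF assms(2)] by eventually_elim simp
qed (use assms asqD sq_int_add in blast)

lemma asq_cmult:
  assumes "asq f"
  shows "asq (\<lambda>x. c * f x)"
  unfolding asq_def
proof
  show "AE x in torus2_measure. c * f x = - (c * f (prod.swap x))"
    using asqD(2)[OF assms] by eventually_elim simp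
qed (use assms asqD sq_int_cmult in blast)

lemma asq_uminus: "asq f \<Longrightarrow> asq (\<lambda>x. - f x)"
  using asq_cmult[of f "-1"] by simp

lemma asq_diff: "asq f \<Longrightarrow> asq g \<Longrightarrow> asq (\<lambda>x. f x - g x)"
  using asq_add[OF _ asq_uminus, of f g] by simp

lemma asq_integrable: "asq f \<Longrightarrow> asq g \<Longrightarrow> integrable torus2_measure (\<lambda>x. f x * g x)"
  using asqD(1) sq_int_mult_integrable by blast

\<comment> \<open>A type rather than a set of representatives, so that the operator lemmas stated
  for the classes \<open>real_inner\<close> and \<open>complete_space\<close> apply. The quotient is
  partial: only \<open>asq\<close> functions represent elements.\<close>
quotient_type hilb = "(real^3) \<times> (real^3) \<Rightarrow> real" / partial:
  "\<lambda>f g. asq f \<and> asq g \<and> (AE x in torus2_measure. f x = g x)"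
proof (rule part_equivpI)
  show "\<exists>f. asq f \<and> asq f \<and> (AE x in torus2_measure. f x = f x)"
    using asq_zero by (intro exI[of _ "\<lambda>_. 0"]) simp
  show "symp (\<lambda>f g. asq f \<and> asq g \<and> (AE x in torus2_measure. f x = g x))"
    by (intro sympI) (auto elim: eventually_mono)
  show "transp (\<lambda>f g. asq f \<and> asq g \<and> (AE x in torus2_measure. f x = g x))"
  proof (intro transpI conjI)
    fix f g h :: "(real^3) \<times> (real^3) \<Rightarrow> real"
    assume "asq f \<and> asq g \<and> (AE x in torus2_measure. f x = g x)" "asq g \<and> asq h \<and> (AE x in torus2_measure. g x = h x)"
    then have "AE x in torus2_measure. f x = g x" "AE x in torus2_measure. g x = h x" by auto
    then show "AE x in torus2_measure. f x = h x" by eventually_elim simp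
  qed auto
qed

instantiation hilb :: real_inner
begin

lift_definition zero_hilb :: hilb is "\<lambda>_. 0" by (simp add: asq_zero)

lift_definition plus_hilb :: "hilb \<Rightarrow> hilb \<Rightarrow> hilb" is "\<lambda>f g x. f x + g x"
proof -
  fix f f' g g' :: "(real^3) \<times> (real^3) \<Rightarrow> real"
  assume *: "asq f \<and> asq f' \<and> (AE x in torus2_measure. f x = f' x)" "asq g \<and> asq g' \<and> (AE x in torus2_measure. g x = g' x)"
  then have "AE x in torus2_measure. f x = f' x" "AE x in torus2_measure. g x = g' x" by auto
  then have "AE x in torus2_measure. f x + g x = f' x + g' x" by eventually_elim simp
  with * show "asq (\<lambda>x. f x + g x) \<and> asq (\<lambda>x. f' x + g' x) \<and> (AE x in torus2_measure. f x + g x = f' x + g' x)"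
    by (auto intro: asq_add)
qed

lift_definition uminus_hilb :: "hilb \<Rightarrow> hilb" is "\<lambda>f x. - f x"
  by (auto intro: asq_uminus)

lift_definition minus_hilb :: "hilb \<Rightarrow> hilb \<Rightarrow> hilb" is "\<lambda>f g x. f x - g x"
proof -
  fix f f' g g' :: "(real^3) \<times> (real^3) \<Rightarrow> real"
  assume *: "asq f \<and> asq f' \<and> (AE x in torus2_measure. f x = f' x)" "asq g \<and> asq g' \<and> (AE x in torus2_measure. g x = g' x)"
  then have "AE x in torus2_measure. f x = f' x" "AE x in torus2_measure. g x = g' x" by auto
  then have "AE x in torus2_measure. f x - g x = f' x - g' x" by eventually_elim simp
  with * show "asq (\<lambda>x. f x - g x) \<and> asq (\<lambda>x. f' x - g' x) \<and> (AE x in torus2_measure. f x - g x = f' x - g' x)"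
    by (auto intro: asq_diff)
qed

lift_definition scaleR_hilb :: "real \<Rightarrow> hilb \<Rightarrow> hilb" is "\<lambda>c f x. c * f x"
  by (auto intro: asq_cmult)

lift_definition inner_hilb :: "hilb \<Rightarrow> hilb \<Rightarrow> real" is "\<lambda>f g. \<integral>x. f x * g x \<partial>torus2_measure"
proof (rule integral_cong_AE)
  fix f f' g g' :: "(real^3) \<times> (real^3) \<Rightarrow> real"
  assume *: "asq f \<and> asq f' \<and> (AE x in torus2_measure. f x = f' x)" "asq g \<and> asq g' \<and> (AE x in torus2_measure. g x = g' x)"
  then have "AE x in torus2_measure. f x = f' x" "AE x in torus2_measure. g x = g' x" by auto
  then show "AE x in torus2_measure. f x * g x = f' x * g' x" by eventually_elim simp
  from * show "(\<lambda>x. f x * g x) \<in> borel_measurable torus2_measure" "(\<lambda>x. f' x * g' x) \<in> borel_measurable torus2_measure"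
    by (blast intro: borel_measurable_times asq_measurable)+
qed

definition norm_hilb :: "hilb \<Rightarrow> real" where "norm_hilb x = sqrt (x \<bullet> x)"
definition sgn_hilb :: "hilb \<Rightarrow> hilb" where "sgn_hilb x = inverse (norm x) *\<^sub>R x"
definition dist_hilb :: "hilb \<Rightarrow> hilb \<Rightarrow> real" where "dist_hilb x y = norm (x - y)"
definition uniformity_hilb :: "(hilb \<times> hilb) filter" where
  "uniformity_hilb = (INF e\<in>{0 <..}. principal {(x, y). dist x y < e})"
definition open_hilb :: "hilb set \<Rightarrow> bool" where
  "open_hilb U \<longleftrightarrow> (\<forall>x\<in>U. \<forall>\<^sub>F (x', y) in uniformity. x' = x \<longrightarrow> y \<in> U)"

instance
proof
  fix x y z :: hilb and a b r :: real and U :: "hilb set"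
  show "x + y + z = x + (y + z)" by transfer (auto simp: add.assoc intro!: asq_add)
  show "x + y = y + x" by transfer (auto simp: add.commute intro!: asq_add)
  show "0 + x = x" by transfer auto
  show "- x + x = 0" by transfer (auto simp: asq_zero)
  show "x - y = x + - y" by transfer (auto intro!: asq_diff)
  show "a *\<^sub>R (x + y) = a *\<^sub>R x + a *\<^sub>R y"
    by transfer (auto simp: distrib_left intro!: asq_add asq_cmult)
  show "(a + b) *\<^sub>R x = a *\<^sub>R x + b *\<^sub>R x"
    by transfer (auto simp: distrib_right intro!: asq_add asq_cmult)
  show "a *\<^sub>R b *\<^sub>R x = (a * b) *\<^sub>R x"
    by transfer (auto simp: mult.assoc intro!: asq_cmult)
  show "1 *\<^sub>R x = x" by transfer auto
  show "dist x y = norm (x - y)" by (simp add: dist_hilb_def)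
  show "sgn x = inverse (norm x) *\<^sub>R x" by (simp add: sgn_hilb_def)
  show "uniformity = (INF e\<in>{0 <..}. principal {(x :: hilb, y). dist x y < e})"
    by (simp add: uniformity_hilb_def)
  show "open U \<longleftrightarrow> (\<forall>x\<in>U. \<forall>\<^sub>F (x', y) in uniformity. x' = x \<longrightarrow> y \<in> U)"
    by (simp add: open_hilb_def)
  show "x \<bullet> y = y \<bullet> x" by transfer (simp add: mult.commute)
  show "(x + y) \<bullet> z = x \<bullet> z + y \<bullet> z"
    by transfer (simp add: distrib_right asq_integrable)
  show "(r *\<^sub>R x) \<bullet> y = r * (x \<bullet> y)"
    by transfer (simp add: mult.assoc)
  show "0 \<le> x \<bullet> x" by transfer simp
  show "x \<bullet> x = 0 \<longleftrightarrow> x = 0"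
  proof transfer
    fix f assume "asq f \<and> asq f \<and> (AE x in torus2_measure. f x = f x)"
    then have f: "asq f" by auto
    have "(\<integral>x. f x * f x \<partial>torus2_measure) = 0 \<longleftrightarrow> (AE x in torus2_measure. f x * f x = 0)"
      by (rule integral_nonneg_eq_0_iff_AE[OF asq_integrable[OF f f]]) auto
    then show "(\<integral>x. f x * f x \<partial>torus2_measure) = 0 \<longleftrightarrow> asq f \<and> asq (\<lambda>_. 0) \<and> (AE x in torus2_measure. f x = 0)"
      using f asq_zero by simp
  qed
  show "norm x = sqrt (x \<bullet> x)" by (simp add: norm_hilb_def)
qed

end

lemma hilb_cases: obtains f where "asq f" "x = abs_hilb f"
  using Quotient_rel_rep[OF Quotient_hilb] Quotient_abs_rep[OF Quotient_hilb] by metis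

lemma asq_rep: "asq (rep_hilb x)"
  using Quotient_rep_reflp[OF Quotient_hilb, of x] by blast

lemma abs_rep_hilb [simp]: "abs_hilb (rep_hilb x) = x"
  using Quotient_abs_rep[OF Quotient_hilb] by metis

lemma abs_hilb_eq_iff:
  assumes "asq f" "asq g"
  shows "abs_hilb f = abs_hilb g \<longleftrightarrow> (AE x in torus2_measure. f x = g x)"
  using Quotient_rel[OF Quotient_hilb, of f g] assms by auto

lemma abs_hilb_plus: "asq f \<Longrightarrow> asq g \<Longrightarrow> abs_hilb f + abs_hilb g = abs_hilb (\<lambda>x. f x + g x)"
  by (rule plus_hilb.abs_eq) auto

lemma abs_hilb_minus: "asq f \<Longrightarrow> asq g \<Longrightarrow> abs_hilb f - abs_hilb g = abs_hilb (\<lambda>x. f x - g x)"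
  by (rule minus_hilb.abs_eq) auto

lemma abs_hilb_scaleR: "asq f \<Longrightarrow> c *\<^sub>R abs_hilb f = abs_hilb (\<lambda>x. c * f x)"
  by (rule scaleR_hilb.abs_eq) auto

lemma abs_hilb_zero: "0 = abs_hilb (\<lambda>_. 0)"
  by (rule zero_hilb.abs_eq)

lemma abs_hilb_inner: "asq f \<Longrightarrow> asq g \<Longrightarrow> abs_hilb f \<bullet> abs_hilb g = (\<integral>x. f x * g x \<partial>torus2_measure)"
  by (rule inner_hilb.abs_eq) auto

lemma abs_hilb_norm: "asq f \<Longrightarrow> (norm (abs_hilb f))\<^sup>2 = (\<integral>x. (f x)\<^sup>2 \<partial>torus2_measure)"
  by (simp add: power2_norm_eq_inner abs_hilb_inner) (simp add: power2_eq_square)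

lemma abs_hilb_sum:
  assumes "\<And>i. i \<in> I \<Longrightarrow> asq (f i)" "finite I"
  shows "asq (\<lambda>x. \<Sum>i\<in>I. a i * f i x) \<and> (\<Sum>i\<in>I. a i *\<^sub>R abs_hilb (f i)) = abs_hilb (\<lambda>x. \<Sum>i\<in>I. a i * f i x)"
  using assms(2,1)
proof (induction I rule: finite_induct)
  case (insert i I)
  then show ?case by (auto simp: abs_hilb_scaleR abs_hilb_plus asq_cmult intro!: asq_add asq_cmult)
qed (simp add: asq_zero abs_hilb_zero)

text \<open>A subsequence with distances below \<open>(1/2) ^ n\<close> meets the geometric decay in
  \<open>sq_int_complete\<close>. The resulting convergence almost everywhere carries antisymmetry
  over to the limit.\<close>

instance hilb :: complete_space
proof
  fix X :: "nat \<Rightarrow> hilb" assume X: "Cauchy X"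
  have quarter: "((1/2) ^ n)\<^sup>2 = (1/4 :: real) ^ n" for n
    by (simp add: power2_eq_square flip: power_mult_distrib)
  have "\<exists>r. strict_mono r \<and> (\<forall>n. \<forall>m\<ge>r n. dist (X (r n)) (X m) < (1/2) ^ n)"
  proof -
    have "\<forall>n. \<exists>N. \<forall>i\<ge>N. \<forall>j\<ge>N. dist (X i) (X j) < (1/2) ^ n"
      using X by (intro allI metric_CauchyD) auto
    then obtain N where N: "\<And>n i j. i \<ge> N n \<Longrightarrow> j \<ge> N n \<Longrightarrow> dist (X i) (X j) < (1/2) ^ n" by metis
    define r where "r = rec_nat (N 0) (\<lambda>n r. Suc (max r (N (Suc n))))"
    have r: "r 0 = N 0" "r (Suc n) = Suc (max (r n) (N (Suc n)))" for n by (simp_all add: r_def)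
    have "N n \<le> r n" for n by (cases n) (simp_all add: r)
    moreover have "strict_mono r" by (rule strict_monoI_Suc) (simp add: r)
    ultimately show ?thesis using N by (intro exI[of _ r]) (meson le_trans order_refl)
  qed
  then obtain r where r: "strict_mono r" "\<And>n m. r n \<le> m \<Longrightarrow> dist (X (r n)) (X m) < (1/2) ^ n" by blast
  define g where "g n = rep_hilb (X (r n))" for n
  have g: "asq (g n)" "abs_hilb (g n) = X (r n)" for n by (simp_all add: g_def asq_rep)
  have "(\<integral>x. (g n x - g m x)\<^sup>2 \<partial>torus2_measure) \<le> (1/4) ^ n" if "n \<le> m" for n m
  proof -
    have "(\<integral>x. (g n x - g m x)\<^sup>2 \<partial>torus2_measure) = (dist (X (r n)) (X (r m)))\<^sup>2"
      using g by (simp add: dist_norm flip: g(2)) (simp add: abs_hilb_minus abs_hilb_norm asq_diff)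
    also have "\<dots> \<le> ((1/2) ^ n)\<^sup>2"
    proof (rule power_mono)
      have "r n \<le> r m" using r(1) that by (simp add: strict_mono_less_eq)
      then show "dist (X (r n)) (X (r m)) \<le> (1/2) ^ n" using r(2) by (simp add: less_imp_le)
    qed simp
    also have "\<dots> = (1/4) ^ n" by (rule quarter)
    finally show ?thesis .
  qed
  note d = this
  obtain f where f: "sq_int torus2_measure f" "AE x in torus2_measure. (\<lambda>n. g n x) \<longlonglongrightarrow> f x"
    "\<And>n. (\<integral>x. (g n x - f x)\<^sup>2 \<partial>torus2_measure) \<le> (1/4) ^ n"
    by (rule torus2f.sq_int_complete[of g, OF asqD(1)[OF g(1)] d]) (assumption, rule that)
  have "AE x in torus2_measure. \<forall>n. g n x = - g n (prod.swap x)"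
    using asqD(2)[OF g(1)] by (simp add: AE_all_countable)
  then have "AE x in torus2_measure. f x = - f (prod.swap x)"
    using f(2) torus2_AE_swap[OF f(2)]
  proof eventually_elim
    case (elim x)
    then have "(\<lambda>n. - g n (prod.swap x)) \<longlonglongrightarrow> f x" by simp
    moreover have "(\<lambda>n. - g n (prod.swap x)) \<longlonglongrightarrow> - f (prod.swap x)" using elim by (intro tendsto_minus)
    ultimately show ?case using LIMSEQ_unique by blast
  qed
  then have af: "asq f" using f by (simp add: asq_def)
  have "(\<lambda>n. X (r n)) \<longlonglongrightarrow> abs_hilb f"
  proof (rule metric_LIMSEQ_I)
    fix e :: real assume "e > 0"
    then obtain N where N: "(1/2) ^ N < e" using real_arch_pow_inv[of e "1/2"] by auto
    show "\<exists>N. \<forall>n\<ge>N. dist (X (r n)) (abs_hilb f) < e"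
    proof (intro exI[of _ N] allI impI)
      fix n assume n: "N \<le> n"
      have "(dist (X (r n)) (abs_hilb f))\<^sup>2 = (\<integral>x. (g n x - f x)\<^sup>2 \<partial>torus2_measure)"
        using g af by (simp add: dist_norm flip: g(2)) (simp add: abs_hilb_minus abs_hilb_norm asq_diff)
      also have "\<dots> \<le> ((1/2) ^ n)\<^sup>2" using f(3)[of n] by (simp add: quarter)
      finally have "dist (X (r n)) (abs_hilb f) \<le> (1/2) ^ n" by (rule power2_le_imp_le) simp
      also have "\<dots> \<le> (1/2) ^ N" using n by (intro power_decreasing) auto
      finally show "dist (X (r n)) (abs_hilb f) < e" using N by simp
    qed
  qed
  then have "X \<longlonglongrightarrow> abs_hilb f"
    using Cauchy_converges_subseq[OF X r(1), of "abs_hilb f"] by (simp add: o_def)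
  then show "convergent X" by (auto simp: convergent_def)
qed

section \<open>The operator on the real Hilbert space\<close>

definition asec :: "((real^3) \<times> (real^3) \<Rightarrow> real) \<Rightarrow> real^3 \<Rightarrow> real" where
  "asec f q = (\<integral>p. f (p, q) \<partial>torus_measure)"

definition anti :: "(real^3 \<Rightarrow> real) \<Rightarrow> (real^3) \<times> (real^3) \<Rightarrow> real" where
  "anti \<phi> x = \<phi> (snd x) - \<phi> (fst x)"

lemma sq_int_asec:
  assumes "sq_int torus2_measure f"
  shows "sq_int torus_measure (asec f)"
  unfolding sq_int_def
proof
  have f: "integrable torus2_measure f" "integrable torus2_measure (\<lambda>x. (f x)\<^sup>2)"
    using torus2f.sq_int_integrable[OF assms] assms by (auto simp: sq_int_def)
  show m [measurable]: "asec f \<in> borel_measurable torus_measure"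
    using borel_measurable_integrable[OF torus2_sections(4)[OF f(1)]] by (simp add: asec_def[abs_def])
  show "integrable torus_measure (\<lambda>q. (asec f q)\<^sup>2)"
  proof (rule Bochner_Integration.integrable_bound)
    show "integrable torus_measure (\<lambda>q. vol * (\<integral>p. (f (p, q))\<^sup>2 \<partial>torus_measure))"
      by (intro integrable_mult_right torus2_sections(4)[OF f(2)])
    show "AE q in torus_measure. norm ((asec f q)\<^sup>2) \<le> norm (vol * (\<integral>p. (f (p, q))\<^sup>2 \<partial>torus_measure))"
      using torus2_sections(2)[OF f(1)] torus2_sections(2)[OF f(2)]
    proof eventually_elim
      case (elim q)
      then have "sq_int torus_measure (\<lambda>p. f (p, q))" by (auto simp: sq_int_def)
      moreover have "sq_int torus_measure (\<lambda>p. 1)" by (simp add: sq_int_def)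
      ultimately have "(\<integral>p. f (p, q) * 1 \<partial>torus_measure)\<^sup>2 \<le> (\<integral>p. (f (p, q))\<^sup>2 \<partial>torus_measure) * (\<integral>p. 1\<^sup>2 \<partial>torus_measure)"
        by (rule sq_int_Cauchy_Schwarz)
      then have "(asec f q)\<^sup>2 \<le> vol * (\<integral>p. (f (p, q))\<^sup>2 \<partial>torus_measure)"
        by (simp add: asec_def measure_torus mult.commute)
      then show ?case by simp
    qed
  qed measurable
qed

lemma asec_pair_snd:
  assumes "sq_int torus_measure \<phi>" "sq_int torus2_measure f"
  shows "(\<integral>x. \<phi> (snd x) * f x \<partial>torus2_measure) = (\<integral>q. \<phi> q * asec f q \<partial>torus_measure)"
  using torus2_Fubini(2)[OF sq_int_mult_integrable[OF sq_int_snd[OF assms(1)] assms(2)]]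
  by (simp add: asec_def)

lemma asec_pair_fst:
  assumes \<phi>: "sq_int torus_measure \<phi>" and f: "asq f"
  shows "(\<integral>x. \<phi> (fst x) * f x \<partial>torus2_measure) = - (\<integral>q. \<phi> q * asec f q \<partial>torus_measure)"
proof -
  note [measurable] = asq_measurable[OF f] sq_intD(1)[OF \<phi>]
  have "(\<integral>x. \<phi> (fst x) * f x \<partial>torus2_measure) = (\<integral>x. \<phi> (snd x) * f (prod.swap x) \<partial>torus2_measure)"
    using torus2_integral_swap[of "\<lambda>x. \<phi> (fst x) * f x"] by simp
  also have "\<dots> = (\<integral>x. - (\<phi> (snd x) * f x) \<partial>torus2_measure)"
  proof (rule integral_cong_AE)
    show "AE x in torus2_measure. \<phi> (snd x) * f (prod.swap x) = - (\<phi> (snd x) * f x)"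
      using asqD(2)[OF f] by eventually_elim simp
  qed measurable
  finally show ?thesis using asec_pair_snd[OF \<phi> asqD(1)[OF f]] by simp
qed

lemma integral_asec:
  assumes "asq f"
  shows "(\<integral>q. asec f q \<partial>torus_measure) = 0"
proof -
  have 1: "sq_int torus_measure (\<lambda>_. 1)" by (simp add: sq_int_def)
  show ?thesis using asec_pair_fst[OF 1 assms] asec_pair_snd[OF 1 asqD(1)[OF assms]] by simp
qed

lemma asq_anti:
  assumes "sq_int torus_measure \<phi>"
  shows "asq (anti \<phi>)"
  using sq_int_diff[OF sq_int_snd[OF assms] sq_int_fst[OF assms]]
  by (simp add: asq_def anti_def[abs_def])

lemma asec_anti:
  assumes "sq_int torus_measure \<phi>" "(\<integral>p. \<phi> p \<partial>torus_measure) = 0"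
  shows "asec (anti \<phi>) q = vol * \<phi> q"
  using torus.sq_int_integrable[OF assms(1)] assms(2) by (simp add: asec_def anti_def measure_torus)

text \<open>Up to the factor 2, \<open>anti\<close> is the adjoint of \<open>asec\<close>: by
  antisymmetry of \<open>f\<close> both terms of \<open>anti\<close> contribute equally.\<close>

lemma anti_inner:
  assumes \<phi>: "sq_int torus_measure \<phi>" and f: "asq f"
  shows "(\<integral>x. anti \<phi> x * f x \<partial>torus2_measure) = 2 * (\<integral>q. \<phi> q * asec f q \<partial>torus_measure)"
proof -
  have "integrable torus2_measure (\<lambda>x. \<phi> (snd x) * f x)" "integrable torus2_measure (\<lambda>x. \<phi> (fst x) * f x)"
    using sq_int_mult_integrable[OF sq_int_snd[OF \<phi>] asqD(1)[OF f]]
      sq_int_mult_integrable[OF sq_int_fst[OF \<phi>] asqD(1)[OF f]] by auto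
  then show ?thesis
    using asec_pair_snd[OF \<phi> asqD(1)[OF f]] asec_pair_fst[OF \<phi> f]
    by (simp add: anti_def left_diff_distrib)
qed

lemma asec_cong:
  assumes f: "sq_int torus2_measure f" and g: "sq_int torus2_measure g" and fg: "AE x in torus2_measure. f x = g x"
  shows "AE q in torus_measure. asec f q = asec g q"
  using torus2_sections(2)[OF torus2f.sq_int_integrable[OF f]]
    torus2_sections(2)[OF torus2f.sq_int_integrable[OF g]]
    torus2_AE_section[OF torus2_AE_swap[OF fg]]
  unfolding asec_def by eventually_elim (intro integral_cong_AE, auto)

lemma asec_other:
  assumes f: "asq f"
  shows "AE p in torus_measure. (\<integral>q. f (p, q) \<partial>torus_measure) = - asec f p"
  using torus2_sections(1)[OF torus2f.sq_int_integrable[OF asqD(1)[OF f]]]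
    torus2_sections(2)[OF torus2f.sq_int_integrable[OF asqD(1)[OF f]]]
    torus2_AE_section[OF asqD(2)[OF f]]
proof eventually_elim
  case (elim p)
  have "(\<integral>q. f (p, q) \<partial>torus_measure) = (\<integral>q. - f (q, p) \<partial>torus_measure)"
    by (rule integral_cong_AE) (use elim in auto)
  then show ?case by (simp add: asec_def)
qed

lemma E_disp_abs_le: "\<bar>E_disp \<gamma> K p q\<bar> \<le> 12 + 6 * \<bar>\<gamma>\<bar>"
proof -
  have "\<bar>\<gamma> * eps (K - p - q)\<bar> \<le> \<bar>\<gamma>\<bar> * 6"
    unfolding abs_mult using eps_nonneg eps_le_6 by (intro mult_left_mono) auto
  then show ?thesis
    using eps_nonneg[of p] eps_nonneg[of q] eps_le_6[of p] eps_le_6[of q] by (simp add: E_disp_def abs_le_iff)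
qed

lemma asq_E_disp:
  assumes f: "asq f"
  shows "asq (\<lambda>x. E_disp \<gamma> K (fst x) (snd x) * f x)"
  unfolding asq_def
proof
  show "sq_int torus2_measure (\<lambda>x. E_disp \<gamma> K (fst x) (snd x) * f x)"
    by (rule sq_int_mult_bounded[OF asqD(1)[OF f] E_disp_measurable, where C = "12 + 6 * \<bar>\<gamma>\<bar>"])
      (simp add: E_disp_abs_le)
  show "AE x in torus2_measure. E_disp \<gamma> K (fst x) (snd x) * f x
    = - (E_disp \<gamma> K (fst (prod.swap x)) (snd (prod.swap x)) * f (prod.swap x))"
    using asqD(2)[OF f]
  proof eventually_elim
    case (elim x)
    then show ?case using E_disp_commute[of \<gamma> K "fst x" "snd x"] by simp
  qed
qed

lift_definition Emul :: "real \<Rightarrow> real^3 \<Rightarrow> hilb \<Rightarrow> hilb" is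
  "\<lambda>\<gamma> K f x. E_disp \<gamma> K (fst x) (snd x) * f x"
  by (auto intro: asq_E_disp)

text \<open>On antisymmetric functions the two interaction integrals add up to
  \<open>asec f q - asec f p\<close>. Division by \<open>vol\<close> makes the map idempotent,
  because \<open>asec (anti \<phi>)\<close> is \<open>vol * \<phi>\<close> for \<open>\<phi>\<close>
  of mean zero; it is the projection \<open>P\<close> of the overview.\<close>

definition pfun :: "((real^3) \<times> (real^3) \<Rightarrow> real) \<Rightarrow> (real^3) \<times> (real^3) \<Rightarrow> real" where
  "pfun f = anti (\<lambda>p. (1 / vol) * asec f p)"

lemma asq_pfun: "asq f \<Longrightarrow> asq (pfun f)"
  unfolding pfun_def by (intro asq_anti sq_int_cmult sq_int_asec asqD)

lift_definition Pop :: "hilb \<Rightarrow> hilb" is pfun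
proof -
  fix f g :: "(real^3) \<times> (real^3) \<Rightarrow> real"
  assume *: "asq f \<and> asq g \<and> (AE x in torus2_measure. f x = g x)"
  then have "AE q in torus_measure. asec f q = asec g q" using asec_cong asqD(1) by blast
  from AE_torus2_fst[OF this] AE_torus2_snd[OF this]
  have "AE x in torus2_measure. pfun f x = pfun g x"
    by eventually_elim (simp add: pfun_def anti_def)
  with * show "asq (pfun f) \<and> asq (pfun g) \<and> (AE x in torus2_measure. pfun f x = pfun g x)"
    by (simp add: asq_pfun)
qed

lemma Emul_abs: "asq f \<Longrightarrow> Emul \<gamma> K (abs_hilb f) = abs_hilb (\<lambda>x. E_disp \<gamma> K (fst x) (snd x) * f x)"
  by (rule Emul.abs_eq) simp

lemma Pop_abs: "asq f \<Longrightarrow> Pop (abs_hilb f) = abs_hilb (pfun f)"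
  by (rule Pop.abs_eq) simp

lemma asec_pfun: "asq f \<Longrightarrow> asec (pfun f) q = asec f q"
  unfolding pfun_def using vol_pos sq_int_cmult[OF sq_int_asec[OF asqD(1)], of f "1 / vol"]
  by (subst asec_anti) (auto simp: integral_asec)

lemma Pop_inner_abs:
  assumes "asq f" "asq g"
  shows "Pop (abs_hilb f) \<bullet> abs_hilb g = 2 / vol * (\<integral>q. asec f q * asec g q \<partial>torus_measure)"
proof -
  have "Pop (abs_hilb f) \<bullet> abs_hilb g = (\<integral>x. pfun f x * g x \<partial>torus2_measure)"
    by (simp add: Pop_abs abs_hilb_inner asq_pfun assms)
  also have "\<dots> = 2 * (\<integral>q. (1 / vol) * asec f q * asec g q \<partial>torus_measure)"
    unfolding pfun_def by (intro anti_inner sq_int_cmult sq_int_asec asqD assms)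
  finally show ?thesis by (simp add: mult.assoc)
qed

text \<open>A consequence of \<open>asec (pfun g) = asec g\<close>. The identity says at once that
  \<open>Pop\<close> is idempotent and symmetric; symmetry and the norm bound are both read off from
  it.\<close>

lemma Pop_inner_Pop: "Pop x \<bullet> Pop y = Pop x \<bullet> y"
proof -
  obtain f where f: "asq f" "x = abs_hilb f" by (rule hilb_cases)
  obtain g where g: "asq g" "y = abs_hilb g" by (rule hilb_cases)
  show ?thesis using Pop_inner_abs[OF f(1) asq_pfun[OF g(1)]] Pop_inner_abs[OF f(1) g(1)]
    by (simp add: f g Pop_abs asec_pfun)
qed

lemma Pop_sym: "Pop x \<bullet> y = x \<bullet> Pop y"
  using Pop_inner_Pop[of x y] Pop_inner_Pop[of y x] by (simp add: inner_commute)

lemma norm_Pop_le: "norm (Pop x) \<le> norm x"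
proof -
  have "norm (Pop x) * norm (Pop x) = Pop x \<bullet> x"
    using Pop_inner_Pop[of x x] by (simp add: power2_norm_eq_inner flip: power2_eq_square)
  also have "\<dots> \<le> norm (Pop x) * norm x" by (rule norm_cauchy_schwarz)
  finally show ?thesis by (cases "norm (Pop x) = 0") auto
qed

text \<open>The inner product separates points, so symmetry alone forces linearity; this replaces a
  check on representatives.\<close>

lemma symmetric_imp_linear:
  fixes T :: "'a::real_inner \<Rightarrow> 'a"
  assumes "\<And>x y. T x \<bullet> y = x \<bullet> T y"
  shows "T (x + y) = T x + T y" "T (c *\<^sub>R x) = c *\<^sub>R T x"
  by (rule vector_eq_rdot[THEN iffD1], simp add: assms inner_add_left)+

lemma bounded_linear_Pop: "bounded_linear Pop"
  by (rule bounded_linear_intro[where K = 1]) (auto simp: symmetric_imp_linear[OF Pop_sym] norm_Pop_le)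

lemma Emul_sym: "Emul \<gamma> K x \<bullet> y = x \<bullet> Emul \<gamma> K y"
  by transfer (simp add: ac_simps)

lemma norm_Emul_le: "norm (Emul \<gamma> K x) \<le> (12 + 6 * \<bar>\<gamma>\<bar>) * norm x"
proof -
  obtain f where f: "asq f" "x = abs_hilb f" by (rule hilb_cases)
  have "(norm (Emul \<gamma> K x))\<^sup>2 = (\<integral>x. (E_disp \<gamma> K (fst x) (snd x) * f x)\<^sup>2 \<partial>torus2_measure)"
    by (simp add: f Emul_abs abs_hilb_norm asq_E_disp)
  also have "\<dots> \<le> (\<integral>x. (12 + 6 * \<bar>\<gamma>\<bar>)\<^sup>2 * (f x)\<^sup>2 \<partial>torus2_measure)"
  proof (rule integral_mono)
    show "integrable torus2_measure (\<lambda>x. (E_disp \<gamma> K (fst x) (snd x) * f x)\<^sup>2)"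
      using asqD(1)[OF asq_E_disp[OF f(1)]] by (simp add: sq_int_def)
    show "integrable torus2_measure (\<lambda>x. (12 + 6 * \<bar>\<gamma>\<bar>)\<^sup>2 * (f x)\<^sup>2)"
      using asqD(1)[OF f(1)] by (simp add: sq_int_def)
    fix x
    have "(E_disp \<gamma> K (fst x) (snd x))\<^sup>2 \<le> (12 + 6 * \<bar>\<gamma>\<bar>)\<^sup>2"
      using E_disp_abs_le by (metis abs_ge_zero power2_abs power_mono)
    then show "(E_disp \<gamma> K (fst x) (snd x) * f x)\<^sup>2 \<le> (12 + 6 * \<bar>\<gamma>\<bar>)\<^sup>2 * (f x)\<^sup>2"
      by (simp add: power_mult_distrib mult_right_mono)
  qed
  also have "\<dots> = ((12 + 6 * \<bar>\<gamma>\<bar>) * norm x)\<^sup>2"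
    by (simp add: f abs_hilb_norm power_mult_distrib)
  finally show ?thesis by (rule power2_le_imp_le) simp
qed

lemma bounded_linear_Emul: "bounded_linear (Emul \<gamma> K)"
  by (rule bounded_linear_intro[where K = "12 + 6 * \<bar>\<gamma>\<bar>"])
    (simp_all add: symmetric_imp_linear[OF Emul_sym] mult.commute[of "norm _"] norm_Emul_le del: mult_le_cancel_right)

definition Hop :: "real \<Rightarrow> real \<Rightarrow> real^3 \<Rightarrow> hilb \<Rightarrow> hilb" where
  "Hop \<gamma> \<mu> K x = Emul \<gamma> K x - \<mu> *\<^sub>R Pop x"

lemma bounded_linear_Hop: "bounded_linear (Hop \<gamma> \<mu> K)"
  unfolding Hop_def[abs_def]
  by (intro bounded_linear_sub bounded_linear_Emul bounded_linear_compose[OF bounded_linear_scaleR_right bounded_linear_Pop])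

lemma Hop_sym: "Hop \<gamma> \<mu> K x \<bullet> y = x \<bullet> Hop \<gamma> \<mu> K y"
  by (simp add: Hop_def inner_diff_left inner_diff_right Emul_sym Pop_sym)

section \<open>Complex functions as pairs of Hilbert space elements\<close>

definition hre :: "((real^3) \<times> (real^3) \<Rightarrow> complex) \<Rightarrow> hilb" where "hre f = abs_hilb (\<lambda>x. Re (f x))"
definition him :: "((real^3) \<times> (real^3) \<Rightarrow> complex) \<Rightarrow> hilb" where "him f = abs_hilb (\<lambda>x. Im (f x))"

lemma L2a_iff: "f \<in> L2a \<longleftrightarrow> asq (\<lambda>x. Re (f x)) \<and> asq (\<lambda>x. Im (f x))"
proof
  assume "f \<in> L2a"
  then have f [measurable]: "f \<in> borel_measurable torus2_measure" and i: "integrable torus2_measure (\<lambda>x. (cmod (f x))\<^sup>2)"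
    and a: "AE x in torus2_measure. f x = - f (prod.swap x)"
    by (auto simp: L2a_def L2_def case_prod_beta' swap_eq_Pair)
  have "integrable torus2_measure (\<lambda>x. (Re (f x))\<^sup>2)" "integrable torus2_measure (\<lambda>x. (Im (f x))\<^sup>2)"
    by (rule Bochner_Integration.integrable_bound[OF i]; simp add: cmod_power2)+
  moreover have "AE x in torus2_measure. Re (f x) = - Re (f (prod.swap x))" "AE x in torus2_measure. Im (f x) = - Im (f (prod.swap x))"
    using a by (eventually_elim, simp)+
  ultimately show "asq (\<lambda>x. Re (f x)) \<and> asq (\<lambda>x. Im (f x))" by (simp add: asq_def sq_int_def)
next
  assume a: "asq (\<lambda>x. Re (f x)) \<and> asq (\<lambda>x. Im (f x))"
  then have [measurable]: "(\<lambda>x. Re (f x)) \<in> borel_measurable torus2_measure" "(\<lambda>x. Im (f x)) \<in> borel_measurable torus2_measure"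
    by (auto dest: asq_measurable)
  have "f \<in> borel_measurable torus2_measure" using borel_measurable_complex_iff[of f] by simp
  moreover have "integrable torus2_measure (\<lambda>x. (cmod (f x))\<^sup>2)"
    using a by (auto simp: cmod_power2 asq_def sq_int_def)
  moreover have "AE x in torus2_measure. f x = - f (prod.swap x)"
  proof -
    have "AE x in torus2_measure. Re (f x) = - Re (f (prod.swap x))" "AE x in torus2_measure. Im (f x) = - Im (f (prod.swap x))"
      using a by (auto simp: asq_def)
    then show ?thesis by eventually_elim (simp add: complex_eq_iff)
  qed
  ultimately show "f \<in> L2a" by (auto simp: L2a_def L2_def case_prod_beta' swap_eq_Pair)
qed

lemma L2aD: "f \<in> L2a \<Longrightarrow> asq (\<lambda>x. Re (f x))" "f \<in> L2a \<Longrightarrow> asq (\<lambda>x. Im (f x))"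
  by (auto simp: L2a_iff)

lemma L2a_measurable: "f \<in> L2a \<Longrightarrow> f \<in> borel_measurable torus2_measure"
  by (simp add: L2a_def L2_def)

lemma L2a_integrable:
  assumes "f \<in> L2a"
  shows "integrable torus2_measure f"
proof (rule Bochner_Integration.integrable_bound)
  show "integrable torus2_measure (\<lambda>x. \<bar>Re (f x)\<bar> + \<bar>Im (f x)\<bar>)"
    using L2aD[OF assms] asqD(1) torus2f.sq_int_integrable by (intro Bochner_Integration.integrable_add integrable_abs) blast+
  show "AE x in torus2_measure. norm (f x) \<le> norm (\<bar>Re (f x)\<bar> + \<bar>Im (f x)\<bar>)"
    using cmod_le by (auto intro!: AE_I2)
qed (rule L2a_measurable[OF assms])

lemma l2_norm_hilb:
  assumes "f \<in> L2a"
  shows "l2_norm torus2_measure f = sqrt ((norm (hre f))\<^sup>2 + (norm (him f))\<^sup>2)"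
  using L2aD[OF assms] by (simp add: l2_norm_def hre_def him_def abs_hilb_norm cmod_power2 asq_def sq_int_def)

lemma L2a_of_hilb:
  "(\<lambda>x. Complex (rep_hilb v x) (rep_hilb w x)) \<in> L2a"
  "hre (\<lambda>x. Complex (rep_hilb v x) (rep_hilb w x)) = v" "him (\<lambda>x. Complex (rep_hilb v x) (rep_hilb w x)) = w"
  by (auto simp: L2a_iff asq_rep hre_def him_def)

lemma AE_eq_iff_hilb:
  assumes "f \<in> L2a" "g \<in> L2a"
  shows "(AE x in torus2_measure. f x = g x) \<longleftrightarrow> hre f = hre g \<and> him f = him g"
  using L2aD[OF assms(1)] L2aD[OF assms(2)]
  by (simp add: hre_def him_def abs_hilb_eq_iff complex_eq_iff flip: AE_conj_iff)

lemma L2a_zero: "(\<lambda>_. 0) \<in> L2a" "hre (\<lambda>_. 0) = 0" "him (\<lambda>_. 0) = 0"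
  by (auto simp: L2a_iff hre_def him_def asq_zero abs_hilb_zero)

lemma L2a_cmult:
  assumes "f \<in> L2a"
  shows "(\<lambda>x. c * f x) \<in> L2a" "hre (\<lambda>x. c * f x) = Re c *\<^sub>R hre f - Im c *\<^sub>R him f"
    "him (\<lambda>x. c * f x) = Re c *\<^sub>R him f + Im c *\<^sub>R hre f"
  using L2aD[OF assms]
  by (auto simp: L2a_iff hre_def him_def abs_hilb_scaleR abs_hilb_minus abs_hilb_plus asq_cmult
      intro!: asq_diff asq_add asq_cmult)

lemma L2a_add:
  assumes "f \<in> L2a" "g \<in> L2a"
  shows "(\<lambda>x. f x + g x) \<in> L2a" "hre (\<lambda>x. f x + g x) = hre f + hre g" "him (\<lambda>x. f x + g x) = him f + him g"
  using L2aD[OF assms(1)] L2aD[OF assms(2)]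
  by (auto simp: L2a_iff hre_def him_def abs_hilb_plus intro!: asq_add)

lemma L2a_diff:
  assumes "f \<in> L2a" "g \<in> L2a"
  shows "(\<lambda>x. f x - g x) \<in> L2a" "hre (\<lambda>x. f x - g x) = hre f - hre g" "him (\<lambda>x. f x - g x) = him f - him g"
  using L2aD[OF assms(1)] L2aD[OF assms(2)]
  by (auto simp: L2a_iff hre_def him_def abs_hilb_minus intro!: asq_diff)

lemma L2a_sum:
  assumes "finite I" "\<And>i. i \<in> I \<Longrightarrow> f i \<in> L2a"
  shows "(\<lambda>x. \<Sum>i\<in>I. f i x) \<in> L2a \<and> hre (\<lambda>x. \<Sum>i\<in>I. f i x) = (\<Sum>i\<in>I. hre (f i))
    \<and> him (\<lambda>x. \<Sum>i\<in>I. f i x) = (\<Sum>i\<in>I. him (f i))"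
  using assms
proof (induction I rule: finite_induct)
  case (insert i I)
  then show ?case by (simp add: L2a_add)
qed (simp add: L2a_zero)

lemma asq_cong:
  assumes u: "asq u" and w: "w \<in> borel_measurable torus2_measure" and uw: "AE x in torus2_measure. w x = u x"
  shows "asq w" "abs_hilb w = abs_hilb u"
proof -
  note [measurable] = w asq_measurable[OF u]
  have "integrable torus2_measure (\<lambda>x. (w x)\<^sup>2)"
    by (rule integrable_cong_AE_imp[OF sq_intD(2)[OF asqD(1)[OF u]]]) (measurable, use uw in eventually_elim, simp)
  moreover have "AE x in torus2_measure. w x = - w (prod.swap x)"
    using uw torus2_AE_swap[OF uw] asqD(2)[OF u] by eventually_elim simp
  ultimately show "asq w" by (simp add: asq_def sq_int_def w)
  then show "abs_hilb w = abs_hilb u" using u uw by (simp add: abs_hilb_eq_iff)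
qed

definition hfun :: "real \<Rightarrow> real \<Rightarrow> real^3 \<Rightarrow> ((real^3) \<times> (real^3) \<Rightarrow> real) \<Rightarrow> (real^3) \<times> (real^3) \<Rightarrow> real" where
  "hfun \<gamma> \<mu> K u x = E_disp \<gamma> K (fst x) (snd x) * u x - \<mu> * pfun u x"

lemma hfun_hilb:
  assumes "asq u"
  shows "asq (hfun \<gamma> \<mu> K u)" "Hop \<gamma> \<mu> K (abs_hilb u) = abs_hilb (hfun \<gamma> \<mu> K u)"
  using assms unfolding hfun_def[abs_def]
  by (auto simp: Hop_def Emul_abs Pop_abs abs_hilb_scaleR asq_pfun abs_hilb_minus asq_E_disp asq_cmult
      intro!: asq_diff asq_cmult asq_E_disp asq_pfun)

text \<open>Only almost everywhere: on a section that is not integrable the Bochner integral takes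
  the default value 0, and antisymmetry relates the two partial integrals only up to null
  sets.\<close>

lemma H_op_hfun:
  assumes "f \<in> L2a"
  shows "AE x in torus2_measure. H_op \<gamma> \<mu> K f x
    = Complex (hfun \<gamma> \<mu> K (\<lambda>x. Re (f x)) x) (hfun \<gamma> \<mu> K (\<lambda>x. Im (f x)) x)"
proof -
  note i = torus2_sections(1,2)[OF L2a_integrable[OF assms]]
  have "AE q in torus_measure. (\<integral>s. f (s, q) \<partial>torus_measure) = Complex (asec (\<lambda>x. Re (f x)) q) (asec (\<lambda>x. Im (f x)) q)"
    using i(2) by eventually_elim (simp add: asec_def complex_eq_iff)
  note 1 = AE_torus2_snd[OF this]
  have "AE p in torus_measure. (\<integral>s. f (p, s) \<partial>torus_measure) = Complex (- asec (\<lambda>x. Re (f x)) p) (- asec (\<lambda>x. Im (f x)) p)"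
    using i(1) asec_other[OF L2aD(1)[OF assms]] asec_other[OF L2aD(2)[OF assms]]
    by eventually_elim (simp add: complex_eq_iff)
  note 2 = AE_torus2_fst[OF this]
  from 1 2 show ?thesis
  proof eventually_elim
    case (elim x)
    obtain p q where x: "x = (p, q)" by (cases x)
    show ?case using elim vol_pos
      by (simp add: x H_op_def hfun_def pfun_def anti_def complex_eq_iff vol_def field_simps)
  qed
qed

lemma H_op_measurable:
  assumes "f \<in> L2a"
  shows "H_op \<gamma> \<mu> K f \<in> borel_measurable torus2_measure"
proof -
  have [measurable]: "f \<in> borel_measurable (torus_measure \<Otimes>\<^sub>M torus_measure)"
    using L2a_measurable[OF assms] by (simp add: torus2_measure_def)
  have [measurable]: "(\<lambda>x. E_disp \<gamma> K (fst x) (snd x)) \<in> borel_measurable (torus_measure \<Otimes>\<^sub>M torus_measure)"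
    using E_disp_measurable by (simp add: torus2_measure_def)
  show ?thesis unfolding H_op_def torus2_measure_def case_prod_beta' by measurable
qed

lemma H_op_L2a:
  assumes "f \<in> L2a"
  shows "H_op \<gamma> \<mu> K f \<in> L2a" "hre (H_op \<gamma> \<mu> K f) = Hop \<gamma> \<mu> K (hre f)" "him (H_op \<gamma> \<mu> K f) = Hop \<gamma> \<mu> K (him f)"
proof -
  note [measurable] = H_op_measurable[OF assms, of \<gamma> \<mu> K]
  have r: "AE x in torus2_measure. Re (H_op \<gamma> \<mu> K f x) = hfun \<gamma> \<mu> K (\<lambda>x. Re (f x)) x"
    and i: "AE x in torus2_measure. Im (H_op \<gamma> \<mu> K f x) = hfun \<gamma> \<mu> K (\<lambda>x. Im (f x)) x"
    using H_op_hfun[OF assms, of \<gamma> \<mu> K] by (eventually_elim, simp)+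
  note r' = asq_cong[OF hfun_hilb(1)[OF L2aD(1)[OF assms]] _ r] and i' = asq_cong[OF hfun_hilb(1)[OF L2aD(2)[OF assms]] _ i]
  show "H_op \<gamma> \<mu> K f \<in> L2a" using r'(1) i'(1) by (simp add: L2a_iff)
  show "hre (H_op \<gamma> \<mu> K f) = Hop \<gamma> \<mu> K (hre f)" using r'(2) by (simp add: hre_def hfun_hilb(2)[OF L2aD(1)[OF assms]])
  show "him (H_op \<gamma> \<mu> K f) = Hop \<gamma> \<mu> K (him f)" using i'(2) by (simp add: him_def hfun_hilb(2)[OF L2aD(2)[OF assms]])
qed

section \<open>Eigenvalues below the essential spectrum\<close>

lemma H_minus_z:
  assumes "f \<in> L2a"
  shows "(\<lambda>x. H_op \<gamma> \<mu> K f x - z * f x) \<in> L2a"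
    "hre (\<lambda>x. H_op \<gamma> \<mu> K f x - z * f x) = Hop \<gamma> \<mu> K (hre f) - Re z *\<^sub>R hre f + Im z *\<^sub>R him f"
    "him (\<lambda>x. H_op \<gamma> \<mu> K f x - z * f x) = Hop \<gamma> \<mu> K (him f) - Re z *\<^sub>R him f - Im z *\<^sub>R hre f"
  using L2a_diff[OF H_op_L2a(1)[OF assms] L2a_cmult(1)[OF assms, of z]]
  by (simp_all add: H_op_L2a[OF assms] L2a_cmult[OF assms])

text \<open>Coercivity of \<open>(H - Re z)\<^sup>2 + (Im z)\<^sup>2\<close> on the real space yields the resolvent at \<open>z\<close>, since
  \<open>(H - z) (H - cnj z)\<close> is this operator.\<close>

lemma resolvent_setI:
  assumes d: "d > 0" "\<And>v. d * (norm v)\<^sup>2 \<le> (norm (Hop \<gamma> \<mu> K v - Re z *\<^sub>R v))\<^sup>2 + (Im z)\<^sup>2 * (norm v)\<^sup>2"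
  shows "z \<in> resolvent_set torus2_measure L2a (H_op \<gamma> \<mu> K)"
  unfolding resolvent_set_def mem_Collect_eq
proof
  interpret T: bounded_linear "Hop \<gamma> \<mu> K" by (rule bounded_linear_Hop)
  define T where "T = Hop \<gamma> \<mu> K"
  show "\<forall>g\<in>L2a. \<exists>f\<in>L2a. AE x in torus2_measure. H_op \<gamma> \<mu> K f x - z * f x = g x"
  proof
    fix g assume g: "g \<in> L2a"
    have "\<exists>h. T (T h - Re z *\<^sub>R h) - Re z *\<^sub>R (T h - Re z *\<^sub>R h) + (Im z)\<^sup>2 *\<^sub>R h = v" for v
      unfolding T_def using symmetric_bounded_below_surj[OF bounded_linear_Hop Hop_sym d] by blast
    then obtain h1 h2 where h1: "T (T h1 - Re z *\<^sub>R h1) - Re z *\<^sub>R (T h1 - Re z *\<^sub>R h1) + (Im z)\<^sup>2 *\<^sub>R h1 = hre g"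
      and h2: "T (T h2 - Re z *\<^sub>R h2) - Re z *\<^sub>R (T h2 - Re z *\<^sub>R h2) + (Im z)\<^sup>2 *\<^sub>R h2 = him g" by metis
    define f1 where "f1 = (T h1 - Re z *\<^sub>R h1) - Im z *\<^sub>R h2"
    define f2 where "f2 = (T h2 - Re z *\<^sub>R h2) + Im z *\<^sub>R h1"
    define f where "f = (\<lambda>x. Complex (rep_hilb f1 x) (rep_hilb f2 x))"
    have f: "f \<in> L2a" "hre f = f1" "him f = f2" by (simp_all add: f_def L2a_of_hilb)
    have "T f1 - Re z *\<^sub>R f1 + Im z *\<^sub>R f2 = hre g"
      unfolding h1[symmetric] f1_def f2_def T_def
      by (simp add: T.diff T.add T.scaleR algebra_simps power2_eq_square)
    moreover have "T f2 - Re z *\<^sub>R f2 - Im z *\<^sub>R f1 = him g"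
      unfolding h2[symmetric] f1_def f2_def T_def
      by (simp add: T.diff T.add T.scaleR algebra_simps power2_eq_square)
    ultimately have "AE x in torus2_measure. H_op \<gamma> \<mu> K f x - z * f x = g x"
      using AE_eq_iff_hilb[OF H_minus_z(1)[OF f(1)] g] by (simp add: H_minus_z[OF f(1)] f T_def)
    then show "\<exists>f\<in>L2a. AE x in torus2_measure. H_op \<gamma> \<mu> K f x - z * f x = g x" using f by blast
  qed
  show "\<exists>C. \<forall>f\<in>L2a. l2_norm torus2_measure f \<le> C * l2_norm torus2_measure (\<lambda>x. H_op \<gamma> \<mu> K f x - z * f x)"
  proof (intro exI[of _ "1 / sqrt d"] ballI)
    fix f assume f: "f \<in> L2a"
    define v where "v = hre f"
    define w where "w = him f"
    define A where "A u = T u - Re z *\<^sub>R u" for u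
    have sym: "A v \<bullet> w = A w \<bullet> v"
    proof -
      have "A v \<bullet> w = v \<bullet> A w" by (simp add: A_def T_def inner_diff_left inner_diff_right Hop_sym)
      then show ?thesis by (simp add: inner_commute)
    qed
    have "(norm (A v + Im z *\<^sub>R w))\<^sup>2 + (norm (A w - Im z *\<^sub>R v))\<^sup>2
      = (norm (A v))\<^sup>2 + (norm (A w))\<^sup>2 + (Im z)\<^sup>2 * (norm v)\<^sup>2 + (Im z)\<^sup>2 * (norm w)\<^sup>2
        + 2 * Im z * (A v \<bullet> w - A w \<bullet> v)"
      unfolding power2_norm_eq_inner inner_add_left inner_add_right inner_diff_left inner_diff_right
      by (simp add: inner_commute[of w "A v"] inner_commute[of v "A w"] power2_eq_square algebra_simps)
    then have "(norm (A v + Im z *\<^sub>R w))\<^sup>2 + (norm (A w - Im z *\<^sub>R v))\<^sup>2 \<ge> d * ((norm v)\<^sup>2 + (norm w)\<^sup>2)"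
      using d(2)[of v] d(2)[of w] sym by (simp add: A_def T_def distrib_left)
    then have "d * ((norm v)\<^sup>2 + (norm w)\<^sup>2) \<le> (norm (A v + Im z *\<^sub>R w))\<^sup>2 + (norm (A w - Im z *\<^sub>R v))\<^sup>2" .
    then have "sqrt (d * ((norm v)\<^sup>2 + (norm w)\<^sup>2)) \<le> sqrt ((norm (A v + Im z *\<^sub>R w))\<^sup>2 + (norm (A w - Im z *\<^sub>R v))\<^sup>2)"
      by (rule real_sqrt_le_mono)
    then have "sqrt d * l2_norm torus2_measure f \<le> l2_norm torus2_measure (\<lambda>x. H_op \<gamma> \<mu> K f x - z * f x)"
      by (simp add: l2_norm_hilb f H_minus_z[OF f] A_def T_def v_def w_def real_sqrt_mult)
    then show "l2_norm torus2_measure f \<le> 1 / sqrt d * l2_norm torus2_measure (\<lambda>x. H_op \<gamma> \<mu> K f x - z * f x)"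
      using d(1) by (simp add: field_simps)
  qed
qed

lemma eigenspace_iff:
  "f \<in> eigenspace torus2_measure L2a (H_op \<gamma> \<mu> K) (complex_of_real a)
    \<longleftrightarrow> f \<in> L2a \<and> Hop \<gamma> \<mu> K (hre f) = a *\<^sub>R hre f \<and> Hop \<gamma> \<mu> K (him f) = a *\<^sub>R him f"
proof (cases "f \<in> L2a")
  case True
  have "(AE x in torus2_measure. H_op \<gamma> \<mu> K f x = complex_of_real a * f x)
    \<longleftrightarrow> Hop \<gamma> \<mu> K (hre f) = a *\<^sub>R hre f \<and> Hop \<gamma> \<mu> K (him f) = a *\<^sub>R him f"
    using AE_eq_iff_hilb[OF H_op_L2a(1)[OF True] L2a_cmult(1)[OF True, of "complex_of_real a"]]
    by (simp add: H_op_L2a[OF True] L2a_cmult[OF True])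
  then show ?thesis using True by (simp add: eigenspace_def)
qed (simp add: eigenspace_def)

lemma eigenvalue_of_eigenvector:
  assumes e: "Hop \<gamma> \<mu> K e = a *\<^sub>R e" "e \<noteq> 0"
  shows "is_eigenvalue torus2_measure L2a (H_op \<gamma> \<mu> K) (complex_of_real a)"
    "complex_of_real a \<in> spectrum_of torus2_measure L2a (H_op \<gamma> \<mu> K)"
proof -
  define f where "f = (\<lambda>x. Complex (rep_hilb e x) (rep_hilb 0 x))"
  have f: "f \<in> L2a" "hre f = e" "him f = 0" by (simp_all add: f_def L2a_of_hilb)
  have T0: "Hop \<gamma> \<mu> K 0 = 0" using bounded_linear_Hop by (rule linear_simps(3))
  have fe: "f \<in> eigenspace torus2_measure L2a (H_op \<gamma> \<mu> K) (complex_of_real a)"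
    by (simp add: eigenspace_iff f e T0)
  moreover have "\<not> (AE x in torus2_measure. f x = 0)"
    using AE_eq_iff_hilb[OF f(1) L2a_zero(1)] f e by (simp add: L2a_zero)
  ultimately show "is_eigenvalue torus2_measure L2a (H_op \<gamma> \<mu> K) (complex_of_real a)"
    by (auto simp: is_eigenvalue_def)
  have "l2_norm torus2_measure f > 0" using e by (simp add: l2_norm_hilb f)
  moreover have "l2_norm torus2_measure (\<lambda>x. H_op \<gamma> \<mu> K f x - complex_of_real a * f x) = 0"
    by (simp add: l2_norm_hilb[OF H_minus_z(1)[OF f(1)]] H_minus_z[OF f(1)] f e T0)
  ultimately show "complex_of_real a \<in> spectrum_of torus2_measure L2a (H_op \<gamma> \<mu> K)"
    using f(1) unfolding spectrum_of_def resolvent_set_def by force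
qed

text \<open>Real vectors enter as functions with imaginary part zero, so a complex relation splits
  into one real relation for the real parts of the coefficients and one for the imaginary
  parts.\<close>

lemma lin_indep_of_orthonormal:
  assumes on: "\<forall>i<k. \<forall>j<k. e i \<bullet> e j = (if i = j then 1 else 0)"
    and h: "inj_on h {..<n}" "\<And>i. i < n \<Longrightarrow> h i < (k::nat)"
  shows "lin_indep_AE torus2_measure n (\<lambda>i x. Complex (rep_hilb (e (h i)) x) (rep_hilb 0 x))"
  unfolding lin_indep_AE_def
proof (intro allI impI)
  fix c :: "nat \<Rightarrow> complex" and j
  define f where "f i = (\<lambda>x. Complex (rep_hilb (e (h i)) x) (rep_hilb 0 x))" for i
  have f: "f i \<in> L2a" "hre (f i) = e (h i)" "him (f i) = 0" for i by (simp_all add: f_def L2a_of_hilb)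
  assume "AE x in torus2_measure. (\<Sum>i<n. c i * Complex (rep_hilb (e (h i)) x) (rep_hilb 0 x)) = 0" and j: "j < n"
  then have z: "AE x in torus2_measure. (\<Sum>i<n. c i * f i x) = 0" by (simp add: f_def)
  note s = L2a_sum[OF finite_lessThan, of n "\<lambda>i x. c i * f i x"]
  have "hre (\<lambda>x. \<Sum>i<n. c i * f i x) = 0 \<and> him (\<lambda>x. \<Sum>i<n. c i * f i x) = 0"
    using z AE_eq_iff_hilb[of "\<lambda>x. \<Sum>i<n. c i * f i x" "\<lambda>_. 0"] s f L2a_zero by (simp add: L2a_cmult)
  then have "(\<Sum>i<n. Re (c i) *\<^sub>R e (h i)) = 0" "(\<Sum>i<n. Im (c i) *\<^sub>R e (h i)) = 0"
    using s f by (simp_all add: L2a_cmult)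
  moreover have "e (h j) \<bullet> (\<Sum>i<n. b i *\<^sub>R e (h i)) = b j" for b
    by (rule inner_sum_orthonormal[where k = n and e = "\<lambda>i. e (h i)"]) (use on h j in \<open>auto simp: inj_on_eq_iff\<close>)
  ultimately have "Re (c j) = 0" "Im (c j) = 0" by (metis inner_zero_right)+
  then show "c j = 0" by (simp add: complex_eq_iff)
qed

lemma multiplicity_ge:
  assumes on: "\<forall>i<k. \<forall>j<k. e i \<bullet> e j = (if i = j then 1 else 0)"
    and ev: "\<forall>i<k. Hop \<gamma> \<mu> K (e i) = l i *\<^sub>R e i"
  shows "enat (card {i\<in>{..<k::nat}. l i = a}) \<le> multiplicity_of torus2_measure L2a (H_op \<gamma> \<mu> K) (complex_of_real a)"
proof -
  define J where "J = {i\<in>{..<k}. l i = a}"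
  have "finite J" by (simp add: J_def)
  then obtain h where h: "bij_betw h {..<card J} J" using ex_bij_betw_nat_finite[of J] by (auto simp: atLeast0LessThan)
  have T0: "Hop \<gamma> \<mu> K 0 = 0" using bounded_linear_Hop by (rule linear_simps(3))
  have hJ: "h i \<in> J" if "i < card J" for i using h that by (auto simp: bij_betw_def)
  have "lin_indep_AE torus2_measure (card J) (\<lambda>i x. Complex (rep_hilb (e (h i)) x) (rep_hilb 0 x))"
    by (rule lin_indep_of_orthonormal[OF on]) (use h hJ in \<open>auto simp: bij_betw_def J_def\<close>)
  moreover have "\<forall>i<card J. (\<lambda>x. Complex (rep_hilb (e (h i)) x) (rep_hilb 0 x)) \<in> eigenspace torus2_measure L2a (H_op \<gamma> \<mu> K) (complex_of_real a)"
    using hJ ev by (auto simp: eigenspace_iff L2a_of_hilb T0 J_def)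
  ultimately show ?thesis unfolding multiplicity_of_def J_def[symmetric]
    by (intro Sup_upper) auto
qed

text \<open>With more than \<open>k\<close> independent eigenfunctions, \<open>k\<close> complex
  equations leave a nontrivial combination whose real and imaginary parts are both orthogonal to all
  \<open>e j\<close>. Both parts are eigenvectors below \<open>m\<close> in the region where the
  form is at least \<open>m\<close>, hence zero.\<close>

lemma multiplicity_le:
  assumes orth: "\<forall>x. (\<forall>i<k. e i \<bullet> x = 0) \<longrightarrow> m * (norm x)\<^sup>2 \<le> x \<bullet> Hop \<gamma> \<mu> K x"
    and a: "a < m"
  shows "multiplicity_of torus2_measure L2a (H_op \<gamma> \<mu> K) (complex_of_real a) \<le> enat k"
  unfolding multiplicity_of_def
proof (rule Sup_least)
  interpret T: bounded_linear "Hop \<gamma> \<mu> K" by (rule bounded_linear_Hop)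
  fix y assume "y \<in> {enat n |n. \<exists>f. (\<forall>i<n. f i \<in> eigenspace torus2_measure L2a (H_op \<gamma> \<mu> K) (complex_of_real a)) \<and> lin_indep_AE torus2_measure n f}"
  then obtain n f where y: "y = enat n" and f: "\<And>i. i < n \<Longrightarrow> f i \<in> eigenspace torus2_measure L2a (H_op \<gamma> \<mu> K) (complex_of_real a)"
    and ind: "lin_indep_AE torus2_measure n f" by blast
  have "n \<le> k"
  proof (rule ccontr)
    assume "\<not> n \<le> k"
    then have "card {..<k} < card {..<n}" by simp
    from underdetermined_system[OF finite_lessThan finite_lessThan this, of "\<lambda>j i. Complex (e j \<bullet> hre (f i)) (e j \<bullet> him (f i))"]
    obtain c where c: "\<exists>i<n. c i \<noteq> 0" and z: "\<And>j. j < k \<Longrightarrow> (\<Sum>i<n. c i * Complex (e j \<bullet> hre (f i)) (e j \<bullet> him (f i))) = 0"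
      by auto
    have fi: "f i \<in> L2a" "Hop \<gamma> \<mu> K (hre (f i)) = a *\<^sub>R hre (f i)" "Hop \<gamma> \<mu> K (him (f i)) = a *\<^sub>R him (f i)" if "i < n" for i
      using f[OF that] by (auto simp: eigenspace_iff)
    define g where "g = (\<lambda>x. \<Sum>i<n. c i * f i x)"
    have g: "g \<in> L2a" "hre g = (\<Sum>i<n. Re (c i) *\<^sub>R hre (f i) - Im (c i) *\<^sub>R him (f i))"
      "him g = (\<Sum>i<n. Re (c i) *\<^sub>R him (f i) + Im (c i) *\<^sub>R hre (f i))"
      using L2a_sum[OF finite_lessThan, of n "\<lambda>i x. c i * f i x"] fi(1) by (auto simp: g_def L2a_cmult)
    have Tg: "Hop \<gamma> \<mu> K (hre g) = a *\<^sub>R hre g" "Hop \<gamma> \<mu> K (him g) = a *\<^sub>R him g"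
      unfolding g T.sum scaleR_sum_right
      by (intro sum.cong; simp add: T.diff T.add T.scaleR fi algebra_simps)+
    have "e j \<bullet> hre g = 0 \<and> e j \<bullet> him g = 0" if "j < k" for j
    proof -
      have "Re (\<Sum>i<n. c i * Complex (e j \<bullet> hre (f i)) (e j \<bullet> him (f i))) = e j \<bullet> hre g"
        "Im (\<Sum>i<n. c i * Complex (e j \<bullet> hre (f i)) (e j \<bullet> him (f i))) = e j \<bullet> him g"
        by (simp_all add: g inner_sum_right inner_diff_right inner_add_right)
      then show ?thesis using z[OF that] by simp
    qed
    then have "hre g = 0" "him g = 0"
      using eigenvector_in_complement_zero[OF orth Tg(1) a] eigenvector_in_complement_zero[OF orth Tg(2) a]
      by auto
    then have "AE x in torus2_measure. g x = 0"
      using AE_eq_iff_hilb[OF g(1) L2a_zero(1)] by (simp add: L2a_zero)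
    then have "\<forall>i<n. c i = 0" using ind unfolding lin_indep_AE_def g_def by blast
    then show False using c by blast
  qed
  then show "y \<le> enat k" by (simp add: y)
qed

text \<open>Below \<open>m\<close> the spectrum is exactly the finite set of the \<open>l i\<close>,
  all of it discrete, so the essential spectrum starts at \<open>m\<close> or higher. The
  orthonormal eigenvectors then count with multiplicity, and min-max gives at least \<open>n\<close>
  of them.\<close>

theorem number_below_ess_ge:
  fixes L :: "hilb \<Rightarrow> 'b::euclidean_space"
  assumes L: "bounded_linear L"
    and form: "\<And>x. m * (norm x)\<^sup>2 \<le> x \<bullet> Hop \<gamma> \<mu> K x + (norm (L x))\<^sup>2"
    and trial: "\<And>c :: nat \<Rightarrow> real. \<exists>i<n. c i \<noteq> 0 \<Longrightarrow>
      (\<Sum>i<n. c i *\<^sub>R u i) \<bullet> Hop \<gamma> \<mu> K (\<Sum>i<n. c i *\<^sub>R u i) < m * (norm (\<Sum>i<n. c i *\<^sub>R u i))\<^sup>2"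
  shows "enat n \<le> number_below_ess torus2_measure L2a (H_op \<gamma> \<mu> K)"
proof -
  let ?A = "H_op \<gamma> \<mu> K"
  obtain k :: nat and e l where on: "\<forall>i<k. \<forall>j<k. e i \<bullet> e j = (if i = j then 1 else 0)"
    and ev: "\<forall>i<k. Hop \<gamma> \<mu> K (e i) = l i *\<^sub>R e i"
    and lm: "\<forall>i<k. l i < m"
    and orth: "\<forall>x. (\<forall>i<k. e i \<bullet> x = 0) \<longrightarrow> m * (norm x)\<^sup>2 \<le> x \<bullet> Hop \<gamma> \<mu> K x"
    by (rule finite_spectrum_below[OF bounded_linear_Hop Hop_sym L form]) (rule that)
  have nk: "n \<le> k" by (rule eigenvector_count_ge_trial[OF orth trial])
  have ne: "e i \<noteq> 0" if "i < k" for i using on that by fastforce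
  define F where "F = l ` {..<k}"
  have spec: "z \<in> complex_of_real ` F" if z: "z \<in> spectrum_of torus2_measure L2a ?A" and zm: "Re z < m" for z
  proof (rule ccontr)
    assume nz: "z \<notin> complex_of_real ` F"
    have "\<exists>d>0. \<forall>v. d * (norm v)\<^sup>2 \<le> (norm (Hop \<gamma> \<mu> K v - Re z *\<^sub>R v))\<^sup>2 + (Im z)\<^sup>2 * (norm v)\<^sup>2"
    proof (cases "Im z = 0")
      case True
      then have "Re z \<noteq> l i" if "i < k" for i
        using nz that by (auto simp: F_def complex_eq_iff image_iff)
      from bounded_below_off_eigenvalues[OF bounded_linear_Hop Hop_sym on ev orth zm this]
      obtain d where d: "d > 0" "\<And>x. d * norm x \<le> norm (Hop \<gamma> \<mu> K x - Re z *\<^sub>R x)" by blast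
      have "d\<^sup>2 * (norm x)\<^sup>2 \<le> (norm (Hop \<gamma> \<mu> K x - Re z *\<^sub>R x))\<^sup>2" for x
        using power_mono[OF d(2)[of x], of 2] d(1) by (simp add: power_mult_distrib)
      then show ?thesis using True d(1) by (intro exI[of _ "d\<^sup>2"]) simp
    next
      case False
      then show ?thesis by (intro exI[of _ "(Im z)\<^sup>2"]) simp
    qed
    then have "z \<in> resolvent_set torus2_measure L2a ?A" using resolvent_setI by blast
    then show False using z by (simp add: spectrum_of_def)
  qed
  have disc: "complex_of_real a \<in> discrete_spectrum torus2_measure L2a ?A" if a: "a \<in> F" for a
  proof -
    obtain i where i: "i < k" "a = l i" using a by (auto simp: F_def)
    \<comment> \<open>A neighbourhood in which \<open>a\<close> is the only spectral point: the
      half-plane with the other eigenvalues removed.\<close>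
    define U where "U = {z. Re z < m} - (complex_of_real ` F - {complex_of_real a})"
    have "open U" unfolding U_def
      by (intro open_Diff open_halfspace_Re_lt finite_imp_closed) (simp add: F_def)
    moreover have "U \<inter> spectrum_of torus2_measure L2a ?A = {complex_of_real a}"
      using spec lm i eigenvalue_of_eigenvector(2)[OF ev[rule_format, OF i(1)] ne[OF i(1)]]
      by (auto simp: U_def)
    moreover have "multiplicity_of torus2_measure L2a ?A (complex_of_real a) < \<infinity>"
    proof -
      have "multiplicity_of torus2_measure L2a ?A (complex_of_real a) \<le> enat k"
        by (rule multiplicity_le[OF orth]) (use lm i in auto)
      also have "enat k < \<infinity>" by simp
      finally show ?thesis .
    qed
    ultimately show ?thesis
      using eigenvalue_of_eigenvector[OF ev[rule_format, OF i(1)] ne[OF i(1)]] i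
      by (auto simp: discrete_spectrum_def isolated_in_def)
  qed
  have inf: "ereal m \<le> inf_ess_spectrum torus2_measure L2a ?A"
    unfolding inf_ess_spectrum_def
  proof (rule INF_greatest)
    fix z assume "z \<in> essential_spectrum torus2_measure L2a ?A"
    then have "\<not> Re z < m" using spec disc by (auto simp: essential_spectrum_def)
    then show "ereal m \<le> ereal (Re z)" by simp
  qed
  have eig: "is_eigenvalue torus2_measure L2a ?A (complex_of_real a)" "a < m" if "a \<in> F" for a
    using that eigenvalue_of_eigenvector(1)[OF ev[rule_format] ne] lm by (auto simp: F_def)
  have F: "F \<subseteq> eigenvalues_below_ess torus2_measure L2a ?A"
  proof
    fix a assume a: "a \<in> F"
    have "ereal a < ereal m" using eig(2)[OF a] by simp
    then have "ereal a < inf_ess_spectrum torus2_measure L2a ?A" using inf by (rule less_le_trans)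
    then show "a \<in> eigenvalues_below_ess torus2_measure L2a ?A"
      using eig(1)[OF a] by (simp add: eigenvalues_below_ess_def)
  qed
  \<comment> \<open>The \<open>k\<close> eigenvectors are grouped by eigenvalue; each group is
    bounded by the multiplicity.\<close>
  have "k = (\<Sum>i<k. 1)" by simp
  also have "\<dots> = (\<Sum>a\<in>F. \<Sum>i\<in>{i\<in>{..<k}. l i = a}. 1)" unfolding F_def by (rule sum.image_gen) simp
  also have "\<dots> = (\<Sum>a\<in>F. card {i\<in>{..<k}. l i = a})" by simp
  finally have card: "(\<Sum>a\<in>F. card {i\<in>{..<k}. l i = a}) = k" ..
  have "enat n \<le> enat k" using nk by simp
  also have "enat k = of_nat (\<Sum>a\<in>F. card {i\<in>{..<k}. l i = a})"
    by (simp only: card of_nat_eq_enat)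
  also have "\<dots> = (\<Sum>a\<in>F. enat (card {i\<in>{..<k}. l i = a}))"
    unfolding of_nat_sum by (simp only: of_nat_eq_enat)
  also have "\<dots> \<le> (\<Sum>a\<in>F. multiplicity_of torus2_measure L2a ?A (complex_of_real a))"
    by (intro sum_mono multiplicity_ge[OF on ev])
  also have "\<dots> \<le> number_below_ess torus2_measure L2a ?A"
    unfolding number_below_ess_def using F by (intro SUP_upper) (auto simp: F_def)
  finally show ?thesis .
qed

section \<open>Strong coupling: existence of eigenvalues\<close>

lemma Emul_nonneg:
  assumes "0 \<le> \<gamma>"
  shows "0 \<le> x \<bullet> Emul \<gamma> K x"
proof -
  obtain f where f: "asq f" "x = abs_hilb f" by (rule hilb_cases)
  have "0 \<le> (\<integral>x. f x * (E_disp \<gamma> K (fst x) (snd x) * f x) \<partial>torus2_measure)"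
  proof (intro integral_nonneg_AE AE_I2)
    fix x
    have "f x * (E_disp \<gamma> K (fst x) (snd x) * f x) = E_disp \<gamma> K (fst x) (snd x) * (f x)\<^sup>2"
      by (simp add: power2_eq_square)
    then show "0 \<le> f x * (E_disp \<gamma> K (fst x) (snd x) * f x)" using E_disp_bounds(1)[OF assms, of K "fst x" "snd x"]
      by (metis mult_nonneg_nonneg zero_le_power2)
  qed
  then show ?thesis by (simp add: f Emul_abs abs_hilb_inner asq_E_disp)
qed

lemma Emul_inner_anti:
  assumes "sq_int torus_measure \<phi>"
  shows "abs_hilb (anti \<phi>) \<bullet> Emul \<gamma> K (abs_hilb (anti \<phi>))
    = (\<integral>x. E_disp \<gamma> K (fst x) (snd x) * (\<phi> (snd x) - \<phi> (fst x))\<^sup>2 \<partial>torus2_measure)"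
proof -
  have a: "asq (anti \<phi>)" by (rule asq_anti[OF assms])
  have "abs_hilb (anti \<phi>) \<bullet> Emul \<gamma> K (abs_hilb (anti \<phi>))
    = (\<integral>x. anti \<phi> x * (E_disp \<gamma> K (fst x) (snd x) * anti \<phi> x) \<partial>torus2_measure)"
    by (simp add: Emul_abs a abs_hilb_inner asq_E_disp)
  then show ?thesis by (simp add: anti_def power2_eq_square ac_simps)
qed

text \<open>Normalized so that its squared norm is \<open>2 * \<gamma>\<close> times the sum of the
  squared sine coefficients of \<open>\<phi>\<close>, where \<open>Pop x\<close> is represented by
  \<open>anti \<phi>\<close>. This is just what the negative part of \<open>qker\<close> can remove
  from \<open>2 * vol * qform \<gamma> K \<phi>\<close>.\<close>

definition sine_map :: "real \<Rightarrow> real^3 \<Rightarrow> hilb \<Rightarrow> real^3" where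
  "sine_map \<gamma> K x = (\<chi> i. sqrt (\<gamma> / 2) / vol * (abs_hilb (anti (ssh K i)) \<bullet> x))"

lemma bounded_linear_sine_map: "bounded_linear (sine_map \<gamma> K)"
proof -
  have "sine_map \<gamma> K x = (\<Sum>i\<in>UNIV. (sqrt (\<gamma> / 2) / vol * (abs_hilb (anti (ssh K i)) \<bullet> x)) *\<^sub>R axis i 1)" for x
    by (simp add: vec_eq_iff sine_map_def axis_def if_distrib[of "\<lambda>z. _ * z"] cong: if_cong)
  then have eq: "sine_map \<gamma> K = (\<lambda>x. \<Sum>i\<in>UNIV. (sqrt (\<gamma> / 2) / vol * (abs_hilb (anti (ssh K i)) \<bullet> x)) *\<^sub>R axis i 1)" by auto
  show ?thesis unfolding eq
    by (intro bounded_linear_sum bounded_linear_scaleR_const bounded_linear_const_mult bounded_linear_inner_right)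
qed

lemma qform_ge:
  assumes "sq_int torus_measure \<phi>" "0 \<le> \<gamma>"
  shows "qform \<gamma> K \<phi> \<ge> - \<gamma> / vol * (\<Sum>i\<in>UNIV. (\<integral>p. ssh K i p * \<phi> p \<partial>torus_measure)\<^sup>2)"
proof -
  have "qker K \<phi> \<ge> (\<Sum>i\<in>UNIV. - (\<integral>p. ssh K i p * \<phi> p \<partial>torus_measure)\<^sup>2)"
    unfolding qker_eq[OF assms(1)] by (intro sum_mono) auto
  then have "\<gamma> / vol * qker K \<phi> \<ge> \<gamma> / vol * (\<Sum>i\<in>UNIV. - (\<integral>p. ssh K i p * \<phi> p \<partial>torus_measure)\<^sup>2)"
    using assms(2) vol_pos by (intro mult_left_mono) auto
  moreover have "0 \<le> (\<integral>p. eps p * (\<phi> p)\<^sup>2 \<partial>torus_measure)"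
    by (intro integral_nonneg_AE AE_I2) (simp add: eps_nonneg)
  ultimately show ?thesis by (simp add: qform_def sum_negf)
qed

text \<open>On the range of the projection \<open>antisym_form\<close> evaluates the form. The
  \<open>eps\<close> term and the cosine squares are nonnegative, and \<open>sine_map\<close>
  compensates the sine squares.\<close>

lemma Pop_form_ge:
  assumes \<gamma>: "0 \<le> \<gamma>"
  shows "(3 + 3 * \<gamma>) * (norm (Pop x))\<^sup>2 \<le> Pop x \<bullet> Emul \<gamma> K (Pop x) + (norm (sine_map \<gamma> K x))\<^sup>2"
proof -
  obtain f where f: "asq f" "x = abs_hilb f" by (rule hilb_cases)
  define \<phi> where "\<phi> = (\<lambda>p. (1 / vol) * asec f p)"
  have \<phi>: "sq_int torus_measure \<phi>" unfolding \<phi>_def by (intro sq_int_cmult sq_int_asec asqD f)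
  have z: "(\<integral>p. \<phi> p \<partial>torus_measure) = 0" using integral_asec[OF f(1)] by (simp add: \<phi>_def)
  have P: "Pop x = abs_hilb (anti \<phi>)" by (simp add: f Pop_abs pfun_def \<phi>_def)
  have a: "asq (anti \<phi>)" by (rule asq_anti[OF \<phi>])
  have n: "(norm (Pop x))\<^sup>2 = 2 * vol * (\<integral>p. (\<phi> p)\<^sup>2 \<partial>torus_measure)"
    using antisym_norm[OF \<phi> z] by (simp add: P abs_hilb_norm[OF a] anti_def)
  have E: "Pop x \<bullet> Emul \<gamma> K (Pop x) = 2 * vol * ((3 + 3 * \<gamma>) * (\<integral>p. (\<phi> p)\<^sup>2 \<partial>torus_measure) + qform \<gamma> K \<phi>)"
  proof -
    have "Pop x \<bullet> Emul \<gamma> K (Pop x) = (\<integral>x. E_disp \<gamma> K (fst x) (snd x) * (\<phi> (snd x) - \<phi> (fst x))\<^sup>2 \<partial>torus2_measure)"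
      unfolding P by (rule Emul_inner_anti[OF \<phi>])
    then show ?thesis using antisym_form[OF \<phi> z \<gamma>] by simp
  qed
  have s: "(abs_hilb (anti (ssh K i)) \<bullet> x) = 2 * vol * (\<integral>p. ssh K i p * \<phi> p \<partial>torus_measure)" for i
    using vol_pos anti_inner[OF sq_int_csh_ssh(2) f(1), of K i]
    by (simp add: f abs_hilb_inner asq_anti sq_int_csh_ssh \<phi>_def)
  have "(norm (sine_map \<gamma> K x))\<^sup>2 = (\<Sum>i\<in>UNIV. (sqrt (\<gamma> / 2) / vol * (2 * vol * (\<integral>p. ssh K i p * \<phi> p \<partial>torus_measure)))\<^sup>2)"
    unfolding power2_norm_eq_inner by (simp add: inner_vec_def sine_map_def s power2_eq_square)
  also have "\<dots> = 2 * \<gamma> * (\<Sum>i\<in>UNIV. (\<integral>p. ssh K i p * \<phi> p \<partial>torus_measure)\<^sup>2)"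
    using vol_pos \<gamma> by (simp add: power_mult_distrib sum_distrib_left mult.assoc)
  finally have L: "(norm (sine_map \<gamma> K x))\<^sup>2 = 2 * \<gamma> * (\<Sum>i\<in>UNIV. (\<integral>p. ssh K i p * \<phi> p \<partial>torus_measure)\<^sup>2)" .
  define S where "S = (\<Sum>i\<in>UNIV. (\<integral>p. ssh K i p * \<phi> p \<partial>torus_measure)\<^sup>2)"
  define q where "q = qform \<gamma> K \<phi>"
  have "- \<gamma> / vol * S \<le> q" unfolding S_def q_def by (rule qform_ge[OF \<phi> \<gamma>])
  then have "2 * vol * (- \<gamma> / vol * S) \<le> 2 * vol * q" using vol_pos by (intro mult_left_mono) auto
  then have "- 2 * \<gamma> * S \<le> 2 * vol * q" using vol_pos by simp
  moreover have "(3 + 3 * \<gamma>) * (2 * vol * (\<integral>p. (\<phi> p)\<^sup>2 \<partial>torus_measure)) = 2 * vol * ((3 + 3 * \<gamma>) * (\<integral>p. (\<phi> p)\<^sup>2 \<partial>torus_measure))"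
    by simp
  ultimately show ?thesis unfolding n E L S_def[symmetric] q_def[symmetric] distrib_left[of "2 * vol"]
    by linarith
qed

text \<open>Split \<open>x\<close> into \<open>Pop x\<close> and the rest \<open>g\<close>. Young's
  inequality with weight \<open>\<eta>\<close> costs \<open>\<eta>\<close> on \<open>Pop x\<close>
  and \<open>C^2 / \<eta>\<close> on \<open>g\<close>. The latter is harmless because the attraction
  \<open>- \<mu>\<close> acts only on \<open>Pop x\<close>: the lower bound on \<open>\<mu>\<close>
  puts \<open>- C^2 / \<eta>\<close> above the claimed level.\<close>

lemma Hop_form_ge:
  assumes \<gamma>: "0 \<le> \<gamma>" and \<eta>: "0 < \<eta>" and \<mu>: "3 + 3 * \<gamma> + (12 + 6 * \<gamma>)\<^sup>2 / \<eta> \<le> \<mu>"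
  shows "(3 + 3 * \<gamma> - \<eta> - \<mu>) * (norm x)\<^sup>2 \<le> x \<bullet> Hop \<gamma> \<mu> K x + (norm (sine_map \<gamma> K x))\<^sup>2"
proof -
  interpret E: bounded_linear "Emul \<gamma> K" by (rule bounded_linear_Emul)
  define C where "C = 12 + 6 * \<gamma>"
  have C: "C \<ge> 0" using \<gamma> by (simp add: C_def)
  define y where "y = Pop x"
  define g where "g = x - y"
  have x: "x = y + g" by (simp add: g_def)
  have yx: "y \<bullet> x = (norm y)\<^sup>2" using Pop_inner_Pop[of x x] by (simp add: y_def power2_norm_eq_inner)
  then have yg: "y \<bullet> g = 0" by (simp add: g_def inner_diff_right power2_norm_eq_inner)
  have nx: "(norm x)\<^sup>2 = (norm y)\<^sup>2 + (norm g)\<^sup>2"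
    by (simp add: x power2_norm_eq_inner inner_add_left inner_add_right yg inner_commute[of g y])
  have "\<bar>Emul \<gamma> K y \<bullet> g\<bar> \<le> norm (Emul \<gamma> K y) * norm g" by (rule Cauchy_Schwarz_ineq2)
  also have "\<dots> \<le> (C * norm y) * norm g"
    using norm_Emul_le[of \<gamma> K y] \<gamma> by (intro mult_right_mono) (auto simp: C_def)
  finally have "2 * \<bar>Emul \<gamma> K y \<bullet> g\<bar> \<le> 2 * C * norm y * norm g" by simp
  also have "\<dots> \<le> \<eta> * (norm y)\<^sup>2 + C\<^sup>2 / \<eta> * (norm g)\<^sup>2"
  proof -
    have "0 \<le> (\<eta> * norm y - C * norm g)\<^sup>2 / \<eta>" using \<eta> by simp
    also have "\<dots> = \<eta> * (norm y)\<^sup>2 + C\<^sup>2 / \<eta> * (norm g)\<^sup>2 - 2 * C * norm y * norm g"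
      using \<eta> by (simp add: power2_diff power_mult_distrib field_simps power2_eq_square)
    finally show ?thesis by simp
  qed
  finally have cross: "2 * (Emul \<gamma> K y \<bullet> g) \<ge> - \<eta> * (norm y)\<^sup>2 - C\<^sup>2 / \<eta> * (norm g)\<^sup>2" by simp
  have "x \<bullet> Emul \<gamma> K x = y \<bullet> Emul \<gamma> K y + 2 * (Emul \<gamma> K y \<bullet> g) + g \<bullet> Emul \<gamma> K g"
    by (simp add: x E.add inner_add_left inner_add_right Emul_sym inner_commute[of g "Emul \<gamma> K y"])
  moreover have "x \<bullet> Hop \<gamma> \<mu> K x = x \<bullet> Emul \<gamma> K x - \<mu> * (norm y)\<^sup>2"
    using yx by (simp add: Hop_def inner_diff_right y_def inner_commute)
  moreover have "(3 + 3 * \<gamma>) * (norm y)\<^sup>2 \<le> y \<bullet> Emul \<gamma> K y + (norm (sine_map \<gamma> K x))\<^sup>2"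
    unfolding y_def by (rule Pop_form_ge[OF \<gamma>])
  ultimately have 1: "x \<bullet> Hop \<gamma> \<mu> K x + (norm (sine_map \<gamma> K x))\<^sup>2
    \<ge> (3 + 3 * \<gamma> - \<eta> - \<mu>) * (norm y)\<^sup>2 - C\<^sup>2 / \<eta> * (norm g)\<^sup>2"
    using cross Emul_nonneg[OF \<gamma>, of g K] by (simp add: algebra_simps)
  have "- (C\<^sup>2 / \<eta>) \<ge> 3 + 3 * \<gamma> - \<eta> - \<mu>" using \<mu> \<eta> by (simp add: C_def)
  then have "- (C\<^sup>2 / \<eta>) * (norm g)\<^sup>2 \<ge> (3 + 3 * \<gamma> - \<eta> - \<mu>) * (norm g)\<^sup>2" by (rule mult_right_mono) simp
  with 1 show ?thesis by (simp add: nx distrib_left)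
qed

lemma number_below_ess_ge_trial:
  fixes \<phi> :: "nat \<Rightarrow> real^3 \<Rightarrow> real"
  assumes \<gamma>: "0 \<le> \<gamma>" and \<delta>: "0 < \<delta>"
    and \<phi>: "\<And>i. i < n \<Longrightarrow> sq_int torus_measure (\<phi> i)" "\<And>i. i < n \<Longrightarrow> (\<integral>p. \<phi> i p \<partial>torus_measure) = 0"
    and trial: "\<And>c :: nat \<Rightarrow> real. \<exists>i<n. c i \<noteq> 0 \<Longrightarrow> 0 < (\<integral>p. (\<Sum>i<n. c i * \<phi> i p)\<^sup>2 \<partial>torus_measure) \<and>
      qform \<gamma> K (\<lambda>p. \<Sum>i<n. c i * \<phi> i p) \<le> - \<delta> * (\<integral>p. (\<Sum>i<n. c i * \<phi> i p)\<^sup>2 \<partial>torus_measure)"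
  shows "\<exists>\<mu>0>0. \<forall>\<mu>>\<mu>0. enat n \<le> number_below_ess torus2_measure L2a (H_op \<gamma> \<mu> K)"
proof (intro exI[of _ "3 + 3 * \<gamma> + (12 + 6 * \<gamma>)\<^sup>2 / (\<delta> / 2)"] conjI allI impI)
  show "0 < 3 + 3 * \<gamma> + (12 + 6 * \<gamma>)\<^sup>2 / (\<delta> / 2)"
    using \<gamma> \<delta> by (intro add_pos_nonneg) auto
  fix \<mu> assume \<mu>: "3 + 3 * \<gamma> + (12 + 6 * \<gamma>)\<^sup>2 / (\<delta> / 2) < \<mu>"
  \<comment> \<open>The trial functions lie in the range of \<open>Pop\<close> and have energy at
    most \<open>3 + 3\<gamma> - \<delta> - \<mu>\<close>. Cutting in the middle of the gap
    \<open>\<delta>\<close> leaves \<open>\<eta> = \<delta> / 2\<close> for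
    \<open>Hop_form_ge\<close>.\<close>
  define m where "m = 3 + 3 * \<gamma> - \<delta> / 2 - \<mu>"
  have form: "m * (norm x)\<^sup>2 \<le> x \<bullet> Hop \<gamma> \<mu> K x + (norm (sine_map \<gamma> K x))\<^sup>2" for x
    unfolding m_def using \<mu> \<delta> by (intro Hop_form_ge[OF \<gamma>]) auto
  show "enat n \<le> number_below_ess torus2_measure L2a (H_op \<gamma> \<mu> K)"
  proof (rule number_below_ess_ge[OF bounded_linear_sine_map form, of n "\<lambda>i. abs_hilb (anti (\<phi> i))"])
    fix c :: "nat \<Rightarrow> real" assume c: "\<exists>i<n. c i \<noteq> 0"
    define \<psi> where "\<psi> p = (\<Sum>i<n. c i * \<phi> i p)" for p
    have \<psi>: "sq_int torus_measure \<psi>" unfolding \<psi>_def[abs_def] by (intro sq_int_sum sq_int_cmult \<phi>) auto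
    have z: "(\<integral>p. \<psi> p \<partial>torus_measure) = 0"
      unfolding \<psi>_def using \<phi> torus.sq_int_integrable by (subst Bochner_Integration.integral_sum) auto
    have a: "asq (anti \<psi>)" by (rule asq_anti[OF \<psi>])
    have u: "(\<Sum>i<n. c i *\<^sub>R abs_hilb (anti (\<phi> i))) = abs_hilb (anti \<psi>)"
    proof -
      have "(\<Sum>i<n. c i *\<^sub>R abs_hilb (anti (\<phi> i))) = abs_hilb (\<lambda>x. \<Sum>i<n. c i * anti (\<phi> i) x)"
        using abs_hilb_sum[of "{..<n}" "\<lambda>i. anti (\<phi> i)" c] asq_anti \<phi>(1) by auto
      also have "(\<lambda>x. \<Sum>i<n. c i * anti (\<phi> i) x) = anti \<psi>"
        by (simp add: anti_def \<psi>_def fun_eq_iff right_diff_distrib sum_subtractf)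
      finally show ?thesis .
    qed
    have P: "Pop (abs_hilb (anti \<psi>)) = abs_hilb (anti \<psi>)"
      using vol_pos by (simp add: Pop_abs[OF a] pfun_def asec_anti[OF \<psi> z])
    define N where "N = (\<integral>p. (\<psi> p)\<^sup>2 \<partial>torus_measure)"
    have N: "N > 0" and q: "qform \<gamma> K \<psi> \<le> - \<delta> * N"
      using trial[OF c] by (simp_all add: N_def \<psi>_def[abs_def])
    have n: "(norm (abs_hilb (anti \<psi>)))\<^sup>2 = 2 * vol * N"
      using antisym_norm[OF \<psi> z] by (simp add: abs_hilb_norm[OF a] anti_def N_def)
    have "abs_hilb (anti \<psi>) \<bullet> Hop \<gamma> \<mu> K (abs_hilb (anti \<psi>))
      = abs_hilb (anti \<psi>) \<bullet> Emul \<gamma> K (abs_hilb (anti \<psi>)) - \<mu> * (2 * vol * N)"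
      by (simp add: Hop_def P inner_diff_right n[symmetric] power2_norm_eq_inner)
    also have "abs_hilb (anti \<psi>) \<bullet> Emul \<gamma> K (abs_hilb (anti \<psi>))
      = (\<integral>x. E_disp \<gamma> K (fst x) (snd x) * (\<psi> (snd x) - \<psi> (fst x))\<^sup>2 \<partial>torus2_measure)"
      by (rule Emul_inner_anti[OF \<psi>])
    also have "\<dots> = 2 * vol * ((3 + 3 * \<gamma>) * N + qform \<gamma> K \<psi>)"
      using antisym_form[OF \<psi> z \<gamma>] by (simp add: N_def)
    also have "2 * vol * ((3 + 3 * \<gamma>) * N + qform \<gamma> K \<psi>) - \<mu> * (2 * vol * N)
      \<le> 2 * vol * ((3 + 3 * \<gamma>) * N - \<delta> * N) - \<mu> * (2 * vol * N)"
      using q vol_pos by (intro diff_right_mono mult_left_mono) auto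
    also have "\<dots> < m * (2 * vol * N)"
      using vol_pos N \<delta> by (simp add: m_def algebra_simps)
    finally show "(\<Sum>i<n. c i *\<^sub>R abs_hilb (anti (\<phi> i))) \<bullet> Hop \<gamma> \<mu> K (\<Sum>i<n. c i *\<^sub>R abs_hilb (anti (\<phi> i)))
      < m * (norm (\<Sum>i<n. c i *\<^sub>R abs_hilb (anti (\<phi> i))))\<^sup>2"
      by (simp add: u n)
  qed
qed

lemma integral_eps_sq_le:
  assumes "sq_int torus_measure \<phi>"
  shows "integrable torus_measure (\<lambda>p. eps p * (\<phi> p)\<^sup>2)"
    "(\<integral>p. eps p * (\<phi> p)\<^sup>2 \<partial>torus_measure) \<le> 6 * (\<integral>p. (\<phi> p)\<^sup>2 \<partial>torus_measure)"
proof -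
  have i: "integrable torus_measure (\<lambda>p. 6 * (\<phi> p)\<^sup>2)" using assms by (simp add: sq_int_def)
  have le: "eps p * (\<phi> p)\<^sup>2 \<le> 6 * (\<phi> p)\<^sup>2" for p using eps_le_6[of p] by (intro mult_right_mono) auto
  show 1: "integrable torus_measure (\<lambda>p. eps p * (\<phi> p)\<^sup>2)"
    by (rule Bochner_Integration.integrable_bound[OF i])
      (use sq_intD(1)[OF assms] eps_nonneg le in \<open>auto intro!: AE_I2\<close>)
  have "(\<integral>p. eps p * (\<phi> p)\<^sup>2 \<partial>torus_measure) \<le> (\<integral>p. 6 * (\<phi> p)\<^sup>2 \<partial>torus_measure)"
    by (rule integral_mono[OF 1 i le])
  then show "(\<integral>p. eps p * (\<phi> p)\<^sup>2 \<partial>torus_measure) \<le> 6 * (\<integral>p. (\<phi> p)\<^sup>2 \<partial>torus_measure)" by simp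
qed

text \<open>The sines are orthogonal to each other and to all cosines, so on their span
  \<open>qker\<close> is purely negative, at most \<open>- vol / 2\<close> times the squared norm.
  With \<open>eps \<le> 6\<close> the form changes sign no later than at
  \<open>\<gamma> = 12\<close>, whatever \<open>K\<close> is.\<close>

lemma sine_trial:
  fixes h :: "nat \<Rightarrow> 3" and c :: "nat \<Rightarrow> real" and K :: "real^3"
  assumes h: "inj_on h {..<n}" and \<gamma>: "0 \<le> \<gamma>"
  defines "\<psi> \<equiv> \<lambda>p. \<Sum>i<n. c i * ssh K (h i) p"
  shows "(\<integral>p. (\<psi> p)\<^sup>2 \<partial>torus_measure) = vol / 2 * (\<Sum>i<n. (c i)\<^sup>2)"
    "qform \<gamma> K \<psi> \<le> (6 - \<gamma> / 2) * (\<integral>p. (\<psi> p)\<^sup>2 \<partial>torus_measure)"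
proof -
  have \<psi>: "sq_int torus_measure \<psi>" unfolding \<psi>_def by (intro sq_int_sum sq_int_cmult sq_int_csh_ssh) auto
  have int: "(\<integral>p. f p * \<psi> p \<partial>torus_measure) = (\<Sum>i<n. c i * (\<integral>p. f p * ssh K (h i) p \<partial>torus_measure))"
    if "sq_int torus_measure f" for f
  proof -
    have "f p * \<psi> p = (\<Sum>i<n. c i * (f p * ssh K (h i) p))" for p
      by (simp add: \<psi>_def sum_distrib_left mult.left_commute)
    then show ?thesis
      using sq_int_mult_integrable[OF that sq_int_csh_ssh(2)] by simp
  qed
  have s: "(\<integral>p. ssh K (h j) p * \<psi> p \<partial>torus_measure) = vol / 2 * c j" if "j < n" for j
  proof -
    have "(\<integral>p. ssh K (h j) p * \<psi> p \<partial>torus_measure) = (\<Sum>i<n. if i = j then c i * (vol / 2) else 0)"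
      unfolding int[OF sq_int_csh_ssh(2)] integral_ssh_ssh
      using h that by (intro sum.cong) (auto simp: inj_on_eq_iff)
    then show ?thesis using that by simp
  qed
  have "(\<integral>p. (\<psi> p)\<^sup>2 \<partial>torus_measure) = (\<Sum>i<n. c i * (\<integral>p. \<psi> p * ssh K (h i) p \<partial>torus_measure))"
    using int[OF \<psi>] by (simp add: power2_eq_square)
  also have "\<dots> = (\<Sum>i<n. c i * (vol / 2 * c i))"
    using s by (intro sum.cong) (auto simp: mult.commute)
  finally show n: "(\<integral>p. (\<psi> p)\<^sup>2 \<partial>torus_measure) = vol / 2 * (\<Sum>i<n. (c i)\<^sup>2)"
    by (simp add: sum_distrib_left power2_eq_square ac_simps)
  have "(\<Sum>i\<in>UNIV. (\<integral>p. ssh K i p * \<psi> p \<partial>torus_measure)\<^sup>2) \<ge> (\<Sum>i\<in>h ` {..<n}. (\<integral>p. ssh K i p * \<psi> p \<partial>torus_measure)\<^sup>2)"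
    by (intro sum_mono2) auto
  also have "(\<Sum>i\<in>h ` {..<n}. (\<integral>p. ssh K i p * \<psi> p \<partial>torus_measure)\<^sup>2) = (\<Sum>i<n. (vol / 2 * c i)\<^sup>2)"
    by (subst sum.reindex[OF h]) (simp add: s)
  also have "\<dots> = vol / 2 * (\<integral>p. (\<psi> p)\<^sup>2 \<partial>torus_measure)"
    unfolding n by (simp add: power_mult_distrib sum_distrib_left power2_eq_square ac_simps)
  finally have "qker K \<psi> \<le> - (vol / 2 * (\<integral>p. (\<psi> p)\<^sup>2 \<partial>torus_measure))"
    unfolding qker_eq[OF \<psi>] int[OF sq_int_csh_ssh(1)] integral_csh_ssh by (simp add: sum_negf)
  then have "\<gamma> / vol * qker K \<psi> \<le> \<gamma> / vol * (- (vol / 2 * (\<integral>p. (\<psi> p)\<^sup>2 \<partial>torus_measure)))"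
    using \<gamma> vol_pos by (intro mult_left_mono) auto
  then show "qform \<gamma> K \<psi> \<le> (6 - \<gamma> / 2) * (\<integral>p. (\<psi> p)\<^sup>2 \<partial>torus_measure)"
    using integral_eps_sq_le(2)[OF \<psi>] vol_pos by (simp add: qform_def algebra_simps)
qed

lemma number_below_ess_ge_3:
  assumes \<gamma>: "12 < \<gamma>"
  shows "\<exists>\<mu>0>0. \<forall>\<mu>>\<mu>0. 3 \<le> number_below_ess torus2_measure L2a (H_op \<gamma> \<mu> K)"
proof -
  have "\<exists>h. bij_betw h {0..<card (UNIV :: 3 set)} (UNIV :: 3 set)" by (rule ex_bij_betw_nat_finite) simp
  then obtain h :: "nat \<Rightarrow> 3" where h: "inj_on h {..<3}" by (auto simp: bij_betw_def atLeast0LessThan)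
  have "\<exists>\<mu>0>0. \<forall>\<mu>>\<mu>0. enat 3 \<le> number_below_ess torus2_measure L2a (H_op \<gamma> \<mu> K)"
  proof (rule number_below_ess_ge_trial[where \<phi> = "\<lambda>i. ssh K (h i)" and \<delta> = "\<gamma> / 2 - 6"])
    fix c :: "nat \<Rightarrow> real" assume c: "\<exists>i<3. c i \<noteq> 0"
    then obtain i where "i < 3" "c i \<noteq> 0" by blast
    then have "0 < (\<Sum>i<3. (c i)\<^sup>2)" by (intro sum_pos2[of _ i]) auto
    note s = sine_trial[OF h, where \<gamma> = \<gamma> and K = K and c = c]
    have "0 < (\<integral>p. (\<Sum>i<3. c i * ssh K (h i) p)\<^sup>2 \<partial>torus_measure)"
      unfolding s(1)[OF less_imp_le[OF order.strict_trans[OF _ \<gamma>]], OF zero_less_numeral]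
      using \<open>0 < (\<Sum>i<3. (c i)\<^sup>2)\<close> vol_pos by simp
    then show "0 < (\<integral>p. (\<Sum>i<3. c i * ssh K (h i) p)\<^sup>2 \<partial>torus_measure) \<and>
      qform \<gamma> K (\<lambda>p. \<Sum>i<3. c i * ssh K (h i) p) \<le> - (\<gamma> / 2 - 6) * (\<integral>p. (\<Sum>i<3. c i * ssh K (h i) p)\<^sup>2 \<partial>torus_measure)"
      using s(2) \<gamma> by simp
  qed (use \<gamma> in \<open>auto simp: sq_int_csh_ssh integral_ssh\<close>)
  then show ?thesis by (simp add: numeral_eq_enat)
qed

section \<open>The critical mass ratio\<close>

definition subcritical :: "real^3 \<Rightarrow> real set" where
  "subcritical K = {\<gamma>. 0 \<le> \<gamma> \<and> (\<forall>\<phi>. sq_int torus_measure \<phi> \<and> (\<integral>p. \<phi> p \<partial>torus_measure) = 0 \<longrightarrow> 0 \<le> qform \<gamma> K \<phi>)}"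

lemma subcritical_le_12:
  assumes "\<gamma> \<in> subcritical K"
  shows "\<gamma> \<le> 12"
proof -
  have \<gamma>: "0 \<le> \<gamma>" using assms by (simp add: subcritical_def)
  have h: "inj_on (\<lambda>_. 1 :: 3) {..<Suc 0}" by (auto simp: inj_on_def)
  have "0 \<le> qform \<gamma> K (\<lambda>p. ssh K 1 p)"
    using assms sq_int_csh_ssh(2) integral_ssh by (auto simp: subcritical_def)
  also have "\<dots> \<le> (6 - \<gamma> / 2) * (\<integral>p. (ssh K 1 p)\<^sup>2 \<partial>torus_measure)"
    using sine_trial(2)[OF h \<gamma>, where K = K and c = "\<lambda>_. 1"] by simp
  also have "(\<integral>p. (ssh K 1 p)\<^sup>2 \<partial>torus_measure) = vol / 2"
    using sine_trial(1)[OF h \<gamma>, where K = K and c = "\<lambda>_. 1"] by simp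
  finally show ?thesis using vol_pos by (simp add: zero_le_mult_iff)
qed

lemma bdd_above_subcritical: "bdd_above (subcritical K)"
  using subcritical_le_12 by (intro bdd_aboveI)

lemma qform_scale: "qform \<gamma> K (\<lambda>p. c * \<phi> p) = c\<^sup>2 * qform \<gamma> K \<phi>"
proof -
  have "qker K (\<lambda>p. c * \<phi> p) = (\<integral>x. c\<^sup>2 * (kker K (fst x) (snd x) * (\<phi> (fst x) * \<phi> (snd x))) \<partial>torus2_measure)"
    unfolding qker_def by (intro Bochner_Integration.integral_cong) (auto simp: power2_eq_square)
  then have "qker K (\<lambda>p. c * \<phi> p) = c\<^sup>2 * qker K \<phi>" by (simp add: qker_def)
  moreover have "(\<integral>p. eps p * (c * \<phi> p)\<^sup>2 \<partial>torus_measure) = c\<^sup>2 * (\<integral>p. eps p * (\<phi> p)\<^sup>2 \<partial>torus_measure)"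
  proof -
    have "eps p * (c * \<phi> p)\<^sup>2 = c\<^sup>2 * (eps p * (\<phi> p)\<^sup>2)" for p by (simp add: power_mult_distrib)
    then show ?thesis by (simp only: integral_mult_right_zero)
  qed
  ultimately show ?thesis by (simp add: qform_def distrib_left mult.left_commute)
qed

lemma qform_AE_zero:
  assumes \<phi>: "sq_int torus_measure \<phi>" and z: "AE p in torus_measure. \<phi> p = 0"
  shows "qform \<gamma> K \<phi> = 0"
proof -
  have "(\<integral>p. f p * \<phi> p \<partial>torus_measure) = 0" for f
    by (rule integral_eq_zero_AE) (use z in eventually_elim, simp)
  then have "qker K \<phi> = 0" by (simp add: qker_eq[OF \<phi>])
  moreover have "(\<integral>p. eps p * (\<phi> p)\<^sup>2 \<partial>torus_measure) = 0"
    by (rule integral_eq_zero_AE) (use z in eventually_elim, simp)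
  ultimately show ?thesis by (simp add: qform_def)
qed

lemma eigenvalue_if_supercritical:
  assumes \<gamma>: "0 \<le> \<gamma>" "\<gamma> \<notin> subcritical K"
  shows "\<exists>\<mu>0>0. \<forall>\<mu>>\<mu>0. eigenvalues_below_ess torus2_measure L2a (H_op \<gamma> \<mu> K) \<noteq> {}"
proof -
  obtain \<phi> where \<phi>: "sq_int torus_measure \<phi>" "(\<integral>p. \<phi> p \<partial>torus_measure) = 0" and q: "qform \<gamma> K \<phi> < 0"
    using \<gamma> by (auto simp: subcritical_def not_le)
  define N where "N = (\<integral>p. (\<phi> p)\<^sup>2 \<partial>torus_measure)"
  have "N \<noteq> 0"
  proof
    assume "N = 0"
    then have "AE p in torus_measure. \<phi> p = 0"
      using integral_nonneg_eq_0_iff_AE[of torus_measure "\<lambda>p. (\<phi> p)\<^sup>2"] \<phi> by (simp add: N_def sq_int_def)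
    then show False using q qform_AE_zero[OF \<phi>(1), of \<gamma> K] by simp
  qed
  then have N: "N > 0" by (simp add: N_def order.strict_iff_order)
  have "\<exists>\<mu>0>0. \<forall>\<mu>>\<mu>0. enat 1 \<le> number_below_ess torus2_measure L2a (H_op \<gamma> \<mu> K)"
  \<comment> \<open>\<open>\<delta>\<close> is the negative of a Rayleigh quotient, hence the same
    for every multiple of \<open>\<phi>\<close>.\<close>
  proof (rule number_below_ess_ge_trial[where \<phi> = "\<lambda>_. \<phi>" and \<delta> = "- qform \<gamma> K \<phi> / N"])
    fix c :: "nat \<Rightarrow> real" assume "\<exists>i<1. c i \<noteq> 0"
    then show "0 < (\<integral>p. (\<Sum>i<1. c i * \<phi> p)\<^sup>2 \<partial>torus_measure) \<and>
      qform \<gamma> K (\<lambda>p. \<Sum>i<1. c i * \<phi> p) \<le> - (- qform \<gamma> K \<phi> / N) * (\<integral>p. (\<Sum>i<1. c i * \<phi> p)\<^sup>2 \<partial>torus_measure)"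
      using N by (simp add: power_mult_distrib qform_scale N_def[symmetric])
  qed (use \<gamma> \<phi> q N in \<open>auto simp: divide_neg_pos\<close>)
  then obtain \<mu>0 where m: "\<mu>0 > 0" "\<And>\<mu>. \<mu> > \<mu>0 \<Longrightarrow> enat 1 \<le> number_below_ess torus2_measure L2a (H_op \<gamma> \<mu> K)"
    by blast
  have "eigenvalues_below_ess torus2_measure L2a (H_op \<gamma> \<mu> K) \<noteq> {}" if "\<mu> > \<mu>0" for \<mu>
  proof
    assume e: "eigenvalues_below_ess torus2_measure L2a (H_op \<gamma> \<mu> K) = {}"
    have "{F. finite F \<and> F \<subseteq> ({} :: real set)} = {{}}" by auto
    then have "number_below_ess torus2_measure L2a (H_op \<gamma> \<mu> K) = 0" by (simp add: number_below_ess_def e)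
    then show False using m(2)[OF that] by (simp add: zero_enat_def)
  qed
  then show ?thesis using m(1) by blast
qed

section \<open>The two-particle branch of the essential spectrum\<close>

text \<open>The open cube of full measure in the torus. It is convex, so the intermediate value
  theorem can be applied along segments, and open, so that small cubes around its points stay in the
  torus.\<close>

definition obox :: "(real^3) set" where "obox = {p. \<forall>i. \<bar>p $ i\<bar> < pi}"

lemma obox_subset_torus: "obox \<subseteq> torus"
  by (auto simp: obox_def torus_def abs_less_iff less_imp_le minus_less_iff)

lemma convex_obox: "convex obox"
proof -
  have eq: "obox = (\<Inter>i\<in>UNIV. {p. \<bar>p $ i\<bar> < pi})" by (auto simp: obox_def)
  have "convex {p :: real^3. \<bar>p $ i\<bar> < pi}" for i
  proof -
    have "{p :: real^3. \<bar>p $ i\<bar> < pi} = (\<lambda>p. p $ i) -` {-pi<..<pi}" by auto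
    then show ?thesis by (simp add: convex_linear_vimage bounded_linear_vec_nth bounded_linear.linear)
  qed
  then show ?thesis unfolding eq by (intro convex_INT) auto
qed

definition Jint :: "real \<Rightarrow> real^3 \<Rightarrow> real \<Rightarrow> real^3 \<Rightarrow> real" where
  "Jint \<gamma> K z q = (\<integral>p. 1 / (E_disp \<gamma> K p q - z) \<partial>torus_measure)"

text \<open>The Fredholm determinant of the two-particle operator at fixed momentum \<open>q\<close>
  of the third particle: multiplication by \<open>E_disp \<gamma> K p q\<close> minus
  \<open>\<mu> / vol\<close> times integration over \<open>p\<close>. A zero at \<open>z\<close> is
  an eigenvalue of that operator below its continuum.\<close>

definition Lam :: "real \<Rightarrow> real \<Rightarrow> real^3 \<Rightarrow> real \<Rightarrow> real^3 \<Rightarrow> real" where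
  "Lam \<gamma> \<mu> K z q = 1 - \<mu> / vol * Jint \<gamma> K z q"

lemma E_minus_pos: "0 \<le> \<gamma> \<Longrightarrow> z < 0 \<Longrightarrow> 0 < E_disp \<gamma> K p q - z"
  using E_disp_bounds(1)[of \<gamma> K p q] by simp

lemma inverse_E_bounds:
  assumes "0 \<le> \<gamma>" "z < 0"
  shows "1 / (12 + 6 * \<gamma> - z) \<le> 1 / (E_disp \<gamma> K p q - z)" "1 / (E_disp \<gamma> K p q - z) \<le> 1 / (- z)"
    "0 < 1 / (E_disp \<gamma> K p q - z)"
proof -
  have E: "0 \<le> E_disp \<gamma> K p q" "E_disp \<gamma> K p q \<le> 12 + 6 * \<gamma>"
    using E_disp_bounds[OF assms(1)] by auto
  show "1 / (12 + 6 * \<gamma> - z) \<le> 1 / (E_disp \<gamma> K p q - z)" using E assms(2) by (intro frac_le) auto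
  show "1 / (E_disp \<gamma> K p q - z) \<le> 1 / (- z)" using E assms(2) by (intro frac_le) auto
  show "0 < 1 / (E_disp \<gamma> K p q - z)" using E assms(2) by simp
qed

lemma inverse_E_integrable:
  assumes "0 \<le> \<gamma>" "z < 0"
  shows "integrable torus_measure (\<lambda>p. 1 / (E_disp \<gamma> K p q - z))"
proof (rule torus.integrable_const_bound[where B = "1 / (- z)"])
  show "AE p in torus_measure. norm (1 / (E_disp \<gamma> K p q - z)) \<le> 1 / - z"
  proof (rule AE_I2)
    fix p show "norm (1 / (E_disp \<gamma> K p q - z)) \<le> 1 / - z"
      using inverse_E_bounds(2,3)[OF assms, of K p q] unfolding real_norm_def by linarith
  qed
qed measurable

lemma Jint_bounds:
  assumes "0 \<le> \<gamma>" "z < 0"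
  shows "vol / (12 + 6 * \<gamma> - z) \<le> Jint \<gamma> K z q" "Jint \<gamma> K z q \<le> vol / (- z)"
proof -
  have "(\<integral>p. 1 / (12 + 6 * \<gamma> - z) \<partial>torus_measure) \<le> Jint \<gamma> K z q"
    unfolding Jint_def using inverse_E_bounds(1)[OF assms] inverse_E_integrable[OF assms]
    by (intro integral_mono) auto
  then show "vol / (12 + 6 * \<gamma> - z) \<le> Jint \<gamma> K z q" by (simp add: measure_torus)
  have "Jint \<gamma> K z q \<le> (\<integral>p. 1 / (- z) \<partial>torus_measure)"
    unfolding Jint_def using inverse_E_bounds(2)[OF assms] inverse_E_integrable[OF assms]
    by (intro integral_mono) auto
  then show "Jint \<gamma> K z q \<le> vol / (- z)" by (simp add: measure_torus)
qed

lemma Lam_bounds: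
  assumes "0 \<le> \<gamma>" "z < 0" "0 < \<mu>"
  shows "1 - \<mu> / (- z) \<le> Lam \<gamma> \<mu> K z q" "Lam \<gamma> \<mu> K z q \<le> 1 - \<mu> / (12 + 6 * \<gamma> - z)"
proof -
  have "\<mu> / vol * Jint \<gamma> K z q \<le> \<mu> / vol * (vol / (- z))"
    using Jint_bounds(2)[OF assms(1,2)] assms vol_pos by (intro mult_left_mono) auto
  then show "1 - \<mu> / (- z) \<le> Lam \<gamma> \<mu> K z q" using vol_pos by (simp add: Lam_def)
  have "\<mu> / vol * (vol / (12 + 6 * \<gamma> - z)) \<le> \<mu> / vol * Jint \<gamma> K z q"
    using Jint_bounds(1)[OF assms(1,2)] assms vol_pos by (intro mult_left_mono) auto
  then show "Lam \<gamma> \<mu> K z q \<le> 1 - \<mu> / (12 + 6 * \<gamma> - z)" using vol_pos by (simp add: Lam_def)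
qed

lemma E_disp_tendsto:
  assumes "qs \<longlonglongrightarrow> q"
  shows "(\<lambda>n. E_disp \<gamma> K p (qs n)) \<longlonglongrightarrow> E_disp \<gamma> K p q"
proof -
  have "continuous_on UNIV (\<lambda>q. E_disp \<gamma> K p q)" unfolding E_disp_def by (intro continuous_intros)
  then show ?thesis using continuous_on_tendsto_compose[of UNIV _ qs q] assms by auto
qed

lemma Jint_tendsto:
  assumes \<gamma>: "0 \<le> \<gamma>" and qs: "qs \<longlonglongrightarrow> q" and zs: "zs \<longlonglongrightarrow> z" "\<And>n. zs n \<le> b" and b: "b < 0"
  shows "(\<lambda>n. Jint \<gamma> K (zs n) (qs n)) \<longlonglongrightarrow> Jint \<gamma> K z q"
  unfolding Jint_def
proof (rule integral_dominated_convergence[where w = "\<lambda>_. 1 / (- b)"])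
  have z: "z \<le> b" using LIMSEQ_le_const2[OF zs(1)] zs(2) by blast
  show "AE p in torus_measure. (\<lambda>n. 1 / (E_disp \<gamma> K p (qs n) - zs n)) \<longlonglongrightarrow> 1 / (E_disp \<gamma> K p q - z)"
  proof (rule AE_I2)
    fix p show "(\<lambda>n. 1 / (E_disp \<gamma> K p (qs n) - zs n)) \<longlonglongrightarrow> 1 / (E_disp \<gamma> K p q - z)"
      using E_minus_pos[OF \<gamma>, of z K p q] z b by (intro tendsto_intros E_disp_tendsto qs zs) auto
  qed
  show "AE p in torus_measure. norm (1 / (E_disp \<gamma> K p (qs n) - zs n)) \<le> 1 / - b" for n
  proof (rule AE_I2)
    fix p
    have "zs n < 0" using zs(2)[of n] b by simp
    then have "1 / (E_disp \<gamma> K p (qs n) - zs n) \<le> 1 / (- zs n)" "0 < 1 / (E_disp \<gamma> K p (qs n) - zs n)"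
      using inverse_E_bounds[OF \<gamma>] by auto
    moreover have "1 / (- zs n) \<le> 1 / (- b)" using zs(2)[of n] b by (intro divide_left_mono mult_pos_pos) auto
    ultimately show "norm (1 / (E_disp \<gamma> K p (qs n) - zs n)) \<le> 1 / - b" unfolding real_norm_def by linarith
  qed
  show "integrable torus_measure (\<lambda>_. 1 / - b)" by simp
qed measurable

lemma continuous_on_Lam:
  assumes "0 \<le> \<gamma>" "z < 0"
  shows "continuous_on A (\<lambda>q. Lam \<gamma> \<mu> K z q)"
proof -
  have "continuous_on A (\<lambda>q. Jint \<gamma> K z q)"
    unfolding continuous_on_sequentially o_def
    using Jint_tendsto[OF assms(1) _ tendsto_const _ assms(2)] by blast
  then show ?thesis unfolding Lam_def by (intro continuous_intros)
qed

lemma continuous_on_Lam_energy: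
  assumes "0 \<le> \<gamma>" "b < 0"
  shows "continuous_on {..b} (\<lambda>z. Lam \<gamma> \<mu> K z q)"
proof -
  have "continuous_on {..b} (\<lambda>z. Jint \<gamma> K z q)"
    unfolding continuous_on_sequentially o_def
    using Jint_tendsto[OF assms(1) tendsto_const _ _ assms(2)] by auto
  then show ?thesis unfolding Lam_def by (intro continuous_intros)
qed

text \<open>The difference of the two integrands is at least a positive constant \<open>k\<close>,
  so strictness survives integration.\<close>

lemma Lam_strict_antimono:
  assumes \<gamma>: "0 \<le> \<gamma>" and z: "z1 < z2" "z2 < 0" and \<mu>: "0 < \<mu>"
  shows "Lam \<gamma> \<mu> K z2 q < Lam \<gamma> \<mu> K z1 q"
proof -
  define k where "k = (z2 - z1) / ((12 + 6 * \<gamma> - z1) * (12 + 6 * \<gamma> - z2))"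
  have k: "k > 0" using z \<gamma> by (simp add: k_def)
  have "1 / (E_disp \<gamma> K p q - z1) + k \<le> 1 / (E_disp \<gamma> K p q - z2)" for p
  proof -
    define E where "E = E_disp \<gamma> K p q"
    have E: "0 \<le> E" "E \<le> 12 + 6 * \<gamma>" using E_disp_bounds[OF \<gamma>] by (auto simp: E_def)
    have "k \<le> (z2 - z1) / ((E - z1) * (E - z2))"
      unfolding k_def using E z by (intro divide_left_mono mult_mono mult_pos_pos) auto
    also have "\<dots> = 1 / (E - z2) - 1 / (E - z1)" using E z by (simp add: field_simps)
    finally show ?thesis by (simp add: E_def)
  qed
  then have "(\<integral>p. 1 / (E_disp \<gamma> K p q - z1) + k \<partial>torus_measure) \<le> Jint \<gamma> K z2 q"
    unfolding Jint_def using z inverse_E_integrable[OF \<gamma>] by (intro integral_mono) auto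
  then have "Jint \<gamma> K z1 q + vol * k \<le> Jint \<gamma> K z2 q"
    using inverse_E_integrable[OF \<gamma>, of z1] z by (simp add: Jint_def measure_torus)
  then have "Jint \<gamma> K z1 q < Jint \<gamma> K z2 q" using k vol_pos by (smt (verit) mult_pos_pos)
  then show ?thesis using \<mu> vol_pos by (simp add: Lam_def divide_strict_right_mono)
qed

definition cube :: "real^3 \<Rightarrow> real \<Rightarrow> (real^3) set" where
  "cube c r = {p. \<forall>i. \<bar>p $ i - c $ i\<bar> < r}"

lemma cube_measurable [measurable]: "cube c r \<in> sets borel"
  unfolding cube_def by measurable

lemma measure_cube:
  assumes "0 < r" "cube c r \<subseteq> torus"
  shows "cube c r \<in> sets torus_measure" "measure torus_measure (cube c r) = (2 * r) ^ 3"
proof -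
  show s: "cube c r \<in> sets torus_measure"
    using assms by (auto simp: torus_measure_def sets_restrict_space)
  have "emeasure torus_measure (cube c r) = emeasure lborel (cube c r)"
    unfolding torus_measure_def using assms by (subst emeasure_restrict_space) auto
  also have "\<dots> = (\<integral>\<^sup>+p. indicator (cube c r) p \<partial>lborel)" by simp
  also have "\<dots> = (\<integral>\<^sup>+p. (\<Prod>i\<in>UNIV. indicator {c $ i - r<..<c $ i + r} ((p::real^3) $ i)) \<partial>lborel)"
    by (intro nn_integral_cong) (auto simp: cube_def indicator_def abs_less_iff algebra_simps)
  also have "\<dots> = (\<Prod>i\<in>(UNIV::3 set). ennreal (2 * r))"
    using assms by (subst nn_integral_lborel_prod_cart) auto
  also have "\<dots> = ennreal ((2 * r) ^ 3)" using assms by (simp add: ennreal_power)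
  finally show "measure torus_measure (cube c r) = (2 * r) ^ 3" using assms by (simp add: measure_def)
qed

text \<open>Weyl sequences: for a small cube with indicator function \<open>ch\<close> around a zero of \<open>Lam\<close> take the
  antisymmetrization of \<open>ch q / (E p q - z)\<close>.\<close>

lemma zero_of_Lam_in_spectrum:
  assumes \<gamma>: "0 \<le> \<gamma>" and \<mu>: "0 < \<mu>" and z: "z < 0" and q0: "q0 \<in> obox" and zero: "Lam \<gamma> \<mu> K z q0 = 0"
  shows "complex_of_real z \<in> spectrum_of torus2_measure L2a (H_op \<gamma> \<mu> K)"
proof (rule ccontr)
  assume "\<not> ?thesis"
  then obtain C where C: "\<And>f. f \<in> L2a \<Longrightarrow> l2_norm torus2_measure f \<le> C * l2_norm torus2_measure (\<lambda>x. H_op \<gamma> \<mu> K f x - complex_of_real z * f x)"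
    by (auto simp: spectrum_of_def resolvent_set_def)
  have Cv: "norm v \<le> C * norm (Hop \<gamma> \<mu> K v - z *\<^sub>R v)" for v
  proof -
    define f where "f = (\<lambda>x. Complex (rep_hilb v x) (rep_hilb 0 x))"
    have f: "f \<in> L2a" "hre f = v" "him f = 0" by (simp_all add: f_def L2a_of_hilb)
    have T0: "Hop \<gamma> \<mu> K 0 = 0" using bounded_linear_Hop by (rule linear_simps(3))
    show ?thesis using C[OF f(1)]
      by (simp add: l2_norm_hilb[OF f(1)] l2_norm_hilb[OF H_minus_z(1)[OF f(1)]] H_minus_z[OF f(1)] f T0)
  qed
  \<comment> \<open>For a cube of volume \<open>v\<close> the estimates below give
    \<open>k * v \<le> D * (\<epsilon>\<^sup>2 + M * v) * v\<close>. The constants make both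
    \<open>D * \<epsilon>\<^sup>2\<close> and \<open>D * M * v\<close> at most \<open>k / 4\<close>,
    a contradiction.\<close>
  define D where "D = 8 * C\<^sup>2 * vol + 1"
  have D: "D > 0" using vol_pos by (simp add: D_def add_nonneg_pos)
  define k where "k = vol / (12 + 6 * \<gamma> - z)\<^sup>2"
  have k: "k > 0" using vol_pos \<gamma> z by (simp add: k_def)
  define \<epsilon> where "\<epsilon> = sqrt (k / (4 * D))"
  have \<epsilon>: "\<epsilon> > 0" "D * \<epsilon>\<^sup>2 = k / 4" using k D by (auto simp: \<epsilon>_def)
  define M where "M = \<mu>\<^sup>2 / vol / z\<^sup>2"
  have M: "M > 0" using \<mu> vol_pos z by (simp add: M_def)
  have "isCont (\<lambda>q. Lam \<gamma> \<mu> K z q) q0"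
    using continuous_on_Lam[OF \<gamma> z, of UNIV \<mu> K] by (simp add: continuous_on_eq_continuous_at)
  then obtain s where s: "s > 0" "\<And>q. dist q q0 < s \<Longrightarrow> \<bar>Lam \<gamma> \<mu> K z q\<bar> < \<epsilon>"
    unfolding continuous_at_eps_delta using \<epsilon>(1) zero by (force simp: dist_real_def)
  define r0 where "r0 = Min (range (\<lambda>i. pi - \<bar>q0 $ i\<bar>))"
  have r0: "r0 > 0" "\<And>i. r0 \<le> pi - \<bar>q0 $ i\<bar>" using q0 by (auto simp: r0_def obox_def)
  \<comment> \<open>\<open>s / 3\<close> keeps the cube in the continuity ball, by summing three
    coordinates; \<open>r0\<close> keeps it in the torus; \<open>1 / 2\<close> yields
    \<open>v \<le> 1\<close> and \<open>v \<le> 8 * r\<close>; the last entry makes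
    \<open>D * M * v\<close> small.\<close>
  define r where "r = min (min (s / 3) r0) (min (1 / 2) (k / (32 * D * M)))"
  have r: "r > 0" "r \<le> s / 3" "r \<le> r0" "r \<le> 1 / 2" "r \<le> k / (32 * D * M)"
    using s r0 k D M by (auto simp: r_def)
  have sub: "cube q0 r \<subseteq> torus"
  proof
    fix p assume p: "p \<in> cube q0 r"
    have "\<bar>p $ i\<bar> < pi" for i
    proof -
      have "\<bar>p $ i - q0 $ i\<bar> < r" using p by (simp add: cube_def)
      then show ?thesis using r(3) r0(2)[of i] by linarith
    qed
    then show "p \<in> torus" using obox_subset_torus by (auto simp: obox_def)
  qed
  define ch where "ch = (\<lambda>p. indicator (cube q0 r) p :: real)"
  define v where "v = (2 * r) ^ 3"
  have chm [measurable]: "ch \<in> borel_measurable torus_measure"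
    unfolding ch_def using measure_cube(1)[OF r(1) sub] by (simp add: borel_measurable_indicator)
  have ch: "sq_int torus_measure ch" by (rule torus.sq_int_bounded[where C = 1]) (auto simp: ch_def indicator_def)
  have chi: "integrable torus_measure ch" "(\<integral>p. ch p \<partial>torus_measure) = v"
    using torus.sq_int_integrable[OF ch] measure_cube[OF r(1) sub] sub
    by (auto simp: ch_def v_def Int_absorb1 Int_absorb2)
  have v: "v > 0" "v \<le> 1" "v \<le> 8 * r"
  proof -
    show "v > 0" using r by (simp add: v_def)
    show "v \<le> 1" unfolding v_def using r by (intro power_le_one) auto
    have "r ^ 3 \<le> r ^ 1" using r by (intro power_decreasing) auto
    then show "v \<le> 8 * r" by (simp add: v_def power_mult_distrib)
  qed
  define \<psi> where "\<psi> x = 1 / (E_disp \<gamma> K (fst x) (snd x) - z)" for x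
  have \<psi>m [measurable]: "\<psi> \<in> borel_measurable torus2_measure" unfolding \<psi>_def[abs_def] by measurable
  have \<psi>b: "1 / (12 + 6 * \<gamma> - z) \<le> \<psi> x" "\<psi> x \<le> 1 / (- z)" "0 < \<psi> x" for x
    using inverse_E_bounds[OF \<gamma> z] by (auto simp: \<psi>_def)
  define u where "u x = \<psi> x * anti ch x" for x
  have ach: "asq (anti ch)" by (rule asq_anti[OF ch])
  have u: "asq u"
    unfolding asq_def
  proof
    show "sq_int torus2_measure u" unfolding u_def[abs_def]
      by (rule sq_int_mult_bounded[OF asqD(1)[OF ach] \<psi>m, of "1 / (- z)"]) (use \<psi>b in \<open>auto intro!: AE_I2 simp: abs_of_pos\<close>)
    show "AE x in torus2_measure. u x = - u (prod.swap x)"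
      by (rule AE_I2) (simp add: u_def \<psi>_def anti_def E_disp_commute[of \<gamma> K "snd _" "fst _"] diff_divide_distrib)
  qed
  define g where "g q = ch q - \<mu> * ((1 / vol) * asec u q)" for q
  have gi: "sq_int torus_measure g"
    unfolding g_def[abs_def] by (intro sq_int_diff sq_int_cmult ch sq_int_asec asqD u)
  have Hg: "Hop \<gamma> \<mu> K (abs_hilb u) - z *\<^sub>R abs_hilb u = abs_hilb (anti g)"
  proof -
    have "Hop \<gamma> \<mu> K (abs_hilb u) - z *\<^sub>R abs_hilb u
      = abs_hilb (\<lambda>x. hfun \<gamma> \<mu> K u x - z * u x)"
      using hfun_hilb[OF u, of \<gamma> \<mu> K] u by (simp add: abs_hilb_scaleR abs_hilb_minus asq_cmult)
    also have "(\<lambda>x. hfun \<gamma> \<mu> K u x - z * u x) = anti g"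
    proof
      fix x
      have "(E_disp \<gamma> K (fst x) (snd x) - z) * u x = anti ch x"
        using E_minus_pos[OF \<gamma> z, of K "fst x" "snd x"] by (simp add: u_def \<psi>_def)
      then show "hfun \<gamma> \<mu> K u x - z * u x = anti g x"
        by (simp add: hfun_def pfun_def anti_def g_def algebra_simps)
    qed
    finally show ?thesis .
  qed
  \<comment> \<open>On the cube \<open>Lam\<close> is below \<open>\<epsilon>\<close>. The other
    term is of order \<open>v\<close> uniformly in \<open>q\<close>, so it contributes order
    \<open>v^2\<close> to the squared norm, whereas that of \<open>u\<close> is of order
    \<open>v\<close>.\<close>
  have g_eq: "g q = ch q * Lam \<gamma> \<mu> K z q + \<mu> / vol * (\<integral>p. ch p * \<psi> (p, q) \<partial>torus_measure)" for q
  proof -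
    have i1: "integrable torus_measure (\<lambda>p. \<psi> (p, q))"
      using inverse_E_integrable[OF \<gamma> z] by (simp add: \<psi>_def)
    have i2: "integrable torus_measure (\<lambda>p. ch p * \<psi> (p, q))"
      by (rule Bochner_Integration.integrable_bound[OF i1])
        (use borel_measurable_integrable[OF i1] in \<open>auto simp: ch_def indicator_def\<close>)
    have "asec u q = (\<integral>p. ch q * \<psi> (p, q) - ch p * \<psi> (p, q) \<partial>torus_measure)"
      unfolding asec_def by (intro Bochner_Integration.integral_cong) (auto simp: u_def anti_def algebra_simps)
    also have "\<dots> = ch q * Jint \<gamma> K z q - (\<integral>p. ch p * \<psi> (p, q) \<partial>torus_measure)"
    proof -
      have J: "Jint \<gamma> K z q = (\<integral>p. \<psi> (p, q) \<partial>torus_measure)" by (simp add: Jint_def \<psi>_def)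
      show ?thesis unfolding J using i1 i2 by simp
    qed
    finally have a: "asec u q = ch q * Jint \<gamma> K z q - (\<integral>p. ch p * \<psi> (p, q) \<partial>torus_measure)" .
    show ?thesis unfolding g_def a Lam_def by (simp add: algebra_simps diff_divide_distrib)
  qed
  have T: "\<bar>\<integral>p. ch p * \<psi> (p, q) \<partial>torus_measure\<bar> \<le> v / (- z)" for q
  proof -
    have "\<bar>\<integral>p. ch p * \<psi> (p, q) \<partial>torus_measure\<bar> \<le> (\<integral>p. ch p * (1 / (- z)) \<partial>torus_measure)"
    proof (rule integral_abs_bound_integral)
      show "integrable torus_measure (\<lambda>p. ch p * \<psi> (p, q))"
        using inverse_E_integrable[OF \<gamma> z, of K q]
        by (rule Bochner_Integration.integrable_bound)
          (use borel_measurable_integrable[OF inverse_E_integrable[OF \<gamma> z, of K q]] in \<open>auto simp: ch_def indicator_def \<psi>_def\<close>)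
      show "integrable torus_measure (\<lambda>p. ch p * (1 / - z))" using chi by (intro integrable_mult_left)
      fix p
      have "\<bar>\<psi> (p, q)\<bar> \<le> 1 / (- z)" using \<psi>b[of "(p, q)"] by simp
      moreover have "0 \<le> ch p" by (simp add: ch_def)
      ultimately have "\<bar>ch p\<bar> * \<bar>\<psi> (p, q)\<bar> \<le> ch p * (1 / - z)"
        by (intro mult_mono) auto
      then show "\<bar>ch p * \<psi> (p, q)\<bar> \<le> ch p * (1 / - z)" by (simp only: abs_mult)
    qed
    then show ?thesis using chi by (simp add: )
  qed
  have g2: "(g q)\<^sup>2 \<le> 2 * \<epsilon>\<^sup>2 * ch q + 2 * (\<mu> / vol * (v / (- z)))\<^sup>2" for q
  proof -
    have sq: "(a + b)\<^sup>2 \<le> 2 * a\<^sup>2 + 2 * b\<^sup>2" for a b :: real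
      using zero_le_power2[of "a - b"] by (simp add: power2_sum power2_diff)
    have "(ch q * Lam \<gamma> \<mu> K z q)\<^sup>2 \<le> \<epsilon>\<^sup>2 * ch q"
    proof (cases "q \<in> cube q0 r")
      case True
      have "norm (q - q0) \<le> (\<Sum>i\<in>UNIV. \<bar>(q - q0) $ i\<bar>)" by (rule norm_le_l1_cart)
      also have "\<dots> < (\<Sum>i\<in>(UNIV::3 set). r)" using True by (intro sum_strict_mono) (auto simp: cube_def)
      finally have "dist q q0 < s" using r(2) by (simp add: dist_norm)
      then have "\<bar>Lam \<gamma> \<mu> K z q\<bar> \<le> \<epsilon>" using s(2) less_imp_le by blast
      then have "(Lam \<gamma> \<mu> K z q)\<^sup>2 \<le> \<epsilon>\<^sup>2" by (metis abs_ge_zero power2_abs power_mono)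
      then show ?thesis using True by (simp add: ch_def)
    qed (simp add: ch_def)
    moreover have "(\<mu> / vol * (\<integral>p. ch p * \<psi> (p, q) \<partial>torus_measure))\<^sup>2 \<le> (\<mu> / vol * (v / (- z)))\<^sup>2"
    proof (rule power2_le_iff_abs_le[THEN iffD2])
      show "0 \<le> \<mu> / vol * (v / - z)" using \<mu> vol_pos v z by (intro mult_nonneg_nonneg divide_nonneg_nonneg) auto
      show "\<bar>\<mu> / vol * (\<integral>p. ch p * \<psi> (p, q) \<partial>torus_measure)\<bar> \<le> \<mu> / vol * (v / - z)"
      proof -
        have m: "0 \<le> \<mu> / vol" using \<mu> vol_pos by simp
        show ?thesis using mult_left_mono[OF T[of q] m] by (simp only: abs_mult abs_of_nonneg[OF m])
      qed
    qed
    ultimately show ?thesis unfolding g_eq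
      using sq[of "ch q * Lam \<gamma> \<mu> K z q" "\<mu> / vol * (\<integral>p. ch p * \<psi> (p, q) \<partial>torus_measure)"] by linarith
  qed
  have "(\<integral>q. (g q)\<^sup>2 \<partial>torus_measure) \<le> (\<integral>q. 2 * \<epsilon>\<^sup>2 * ch q + 2 * (\<mu> / vol * (v / (- z)))\<^sup>2 \<partial>torus_measure)"
    using gi g2 chi by (intro integral_mono) (auto simp: sq_int_def)
  also have "\<dots> = 2 * \<epsilon>\<^sup>2 * v + vol * (2 * (\<mu> / vol * (v / (- z)))\<^sup>2)"
    using chi by (simp add: measure_torus)
  also have "\<dots> = 2 * v * (\<epsilon>\<^sup>2 + M * v)"
    using vol_pos z by (simp add: M_def power_mult_distrib power_divide field_simps power2_eq_square)
  finally have gle: "(\<integral>q. (g q)\<^sup>2 \<partial>torus_measure) \<le> 2 * v * (\<epsilon>\<^sup>2 + M * v)" .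
  have up: "(norm (abs_hilb (anti g)))\<^sup>2 \<le> 4 * vol * (\<integral>q. (g q)\<^sup>2 \<partial>torus_measure)"
  proof -
    have i: "integrable torus_measure (\<lambda>q. (g q)\<^sup>2)" using gi by (simp add: sq_int_def)
    have "(norm (abs_hilb (anti g)))\<^sup>2 = (\<integral>x. (anti g x)\<^sup>2 \<partial>torus2_measure)"
      by (rule abs_hilb_norm[OF asq_anti[OF gi]])
    also have "\<dots> \<le> (\<integral>x. 2 * (g (snd x))\<^sup>2 + 2 * (g (fst x))\<^sup>2 \<partial>torus2_measure)"
    proof (rule integral_mono)
      show "integrable torus2_measure (\<lambda>x. (anti g x)\<^sup>2)" using asqD(1)[OF asq_anti[OF gi]] by (simp add: sq_int_def)
      show "integrable torus2_measure (\<lambda>x. 2 * (g (snd x))\<^sup>2 + 2 * (g (fst x))\<^sup>2)"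
        using torus2_integrable_fst[OF i] torus2_integrable_snd[OF i] by simp
      fix x show "(anti g x)\<^sup>2 \<le> 2 * (g (snd x))\<^sup>2 + 2 * (g (fst x))\<^sup>2"
        using zero_le_power2[of "g (snd x) + g (fst x)"] by (simp add: anti_def power2_sum power2_diff)
    qed
    also have "\<dots> = 4 * vol * (\<integral>q. (g q)\<^sup>2 \<partial>torus_measure)"
      using torus2_integrable_fst[OF i] torus2_integrable_snd[OF i] torus2_integral_fst[OF i] torus2_integral_snd[OF i] by simp
    finally show ?thesis .
  qed
  have low: "k * v \<le> (norm (abs_hilb u))\<^sup>2"
  proof -
    have "(\<integral>x. (anti ch x)\<^sup>2 \<partial>torus2_measure) = 2 * vol * v - 2 * v\<^sup>2"
    proof -
      have "(ch p)\<^sup>2 = ch p" for p by (simp add: ch_def indicator_def)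
      then have "(anti ch x)\<^sup>2 = ch (snd x) + ch (fst x) - 2 * (ch (fst x) * ch (snd x))" for x
        by (simp add: anti_def power2_diff)
      then show ?thesis
        using torus2_integrable_fst[OF chi(1)] torus2_integrable_snd[OF chi(1)] torus2_integrable_prod[OF ch ch]
          torus2_integral_fst[OF chi(1)] torus2_integral_snd[OF chi(1)] torus2_integral_prod[OF ch ch] chi(2)
        by (simp add: power2_eq_square)
    qed
    moreover have "2 * v\<^sup>2 \<le> vol * v"
    proof -
      have "vol \<ge> 6 ^ 3" unfolding vol_def using pi_ge_two pi_gt3 by (intro power_mono) auto
      then have "2 * v \<le> vol" using v by simp
      then show ?thesis using v by (simp add: power2_eq_square)
    qed
    ultimately have "vol * v \<le> (\<integral>x. (anti ch x)\<^sup>2 \<partial>torus2_measure)" by simp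
    then have "(1 / (12 + 6 * \<gamma> - z))\<^sup>2 * (vol * v) \<le> (1 / (12 + 6 * \<gamma> - z))\<^sup>2 * (\<integral>x. (anti ch x)\<^sup>2 \<partial>torus2_measure)"
      by (rule mult_left_mono) simp
    also have "\<dots> = (\<integral>x. (1 / (12 + 6 * \<gamma> - z))\<^sup>2 * (anti ch x)\<^sup>2 \<partial>torus2_measure)" by simp
    also have "\<dots> \<le> (\<integral>x. (u x)\<^sup>2 \<partial>torus2_measure)"
    proof (rule integral_mono)
      show "integrable torus2_measure (\<lambda>x. (1 / (12 + 6 * \<gamma> - z))\<^sup>2 * (anti ch x)\<^sup>2)"
        using asqD(1)[OF ach] by (simp add: sq_int_def)
      show "integrable torus2_measure (\<lambda>x. (u x)\<^sup>2)" using asqD(1)[OF u] by (simp add: sq_int_def)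
      fix x
      have "(1 / (12 + 6 * \<gamma> - z))\<^sup>2 \<le> (\<psi> x)\<^sup>2" using \<psi>b(1)[of x] \<gamma> z by (intro power_mono) auto
      then show "(1 / (12 + 6 * \<gamma> - z))\<^sup>2 * (anti ch x)\<^sup>2 \<le> (u x)\<^sup>2"
        by (simp add: u_def power_mult_distrib mult_right_mono)
    qed
    finally show ?thesis by (simp add: k_def abs_hilb_norm[OF u] power_divide)
  qed
  have "k * v \<le> (C * norm (abs_hilb (anti g)))\<^sup>2"
    using low power_mono[OF Cv[of "abs_hilb u"], of 2] by (simp add: Hg)
  also have "\<dots> \<le> C\<^sup>2 * (4 * vol * (2 * v * (\<epsilon>\<^sup>2 + M * v)))"
    unfolding power_mult_distrib using up gle vol_pos
    by (intro mult_left_mono order_trans[OF up] mult_left_mono) auto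
  also have "\<dots> = 8 * C\<^sup>2 * vol * (\<epsilon>\<^sup>2 + M * v) * v" by (simp add: algebra_simps)
  also have "\<dots> \<le> D * (\<epsilon>\<^sup>2 + M * v) * v"
    using M v by (intro mult_right_mono) (auto simp: D_def)
  finally have "k \<le> D * \<epsilon>\<^sup>2 + D * M * v" using v by (simp add: distrib_left)
  moreover have "D * M * v \<le> k / 4"
  proof -
    have "D * M * v \<le> D * M * (8 * (k / (32 * D * M)))"
      using v(3) r(5) D M by (intro mult_left_mono) auto
    then show ?thesis using D M by simp
  qed
  ultimately show False using \<epsilon>(2) k by simp
qed

text \<open>Intermediate value theorem along the segment from \<open>q1\<close> to
  \<open>q2\<close>, which stays in the convex set \<open>obox\<close>.\<close>

lemma Lam_zero_exists:
  assumes \<gamma>: "0 \<le> \<gamma>" and z: "z < 0" and q: "q1 \<in> obox" "q2 \<in> obox"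
    and le: "Lam \<gamma> \<mu> K z q1 \<le> 0" "0 \<le> Lam \<gamma> \<mu> K z q2"
  shows "\<exists>q\<in>obox. Lam \<gamma> \<mu> K z q = 0"
proof -
  have "continuous_on {0..1} (\<lambda>t. Lam \<gamma> \<mu> K z ((1 - t) *\<^sub>R q1 + t *\<^sub>R q2))"
    by (rule continuous_on_compose2[OF continuous_on_Lam[OF \<gamma> z, of UNIV]]) (auto intro!: continuous_intros)
  then obtain t where t: "0 \<le> t" "t \<le> 1" "Lam \<gamma> \<mu> K z ((1 - t) *\<^sub>R q1 + t *\<^sub>R q2) = 0"
    using IVT'[of "\<lambda>t. Lam \<gamma> \<mu> K z ((1 - t) *\<^sub>R q1 + t *\<^sub>R q2)" 0 0 1] le by auto
  moreover have "(1 - t) *\<^sub>R q1 + t *\<^sub>R q2 \<in> obox" using convex_obox q t by (simp add: convex_alt)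
  ultimately show ?thesis by blast
qed

text \<open>If the branch point \<open>z\<close> were isolated, then \<open>Lam\<close> at energies slightly below and above \<open>z\<close> would have no
  zeros, hence constant signs, which forces \<open>Lam\<close> to vanish identically at \<open>z\<close>.\<close>

lemma zero_of_Lam_in_essential_spectrum:
  assumes \<gamma>: "0 \<le> \<gamma>" and \<mu>: "0 < \<mu>" and z: "z < 0" and q0: "q0 \<in> obox" and zero: "Lam \<gamma> \<mu> K z q0 = 0"
    and nonconst: "q1 \<in> obox" "Lam \<gamma> \<mu> K z q1 \<noteq> 0"
  shows "complex_of_real z \<in> essential_spectrum torus2_measure L2a (H_op \<gamma> \<mu> K)"
proof (rule ccontr)
  let ?S = "spectrum_of torus2_measure L2a (H_op \<gamma> \<mu> K)"
  note spec = zero_of_Lam_in_spectrum[OF \<gamma> \<mu>]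
  assume "\<not> ?thesis"
  then have "complex_of_real z isolated_in ?S"
    using spec[OF z q0 zero] by (auto simp: essential_spectrum_def discrete_spectrum_def)
  then obtain e where e: "e > 0" "\<And>y. y \<in> ?S \<Longrightarrow> dist (complex_of_real z) y < e \<Longrightarrow> y = complex_of_real z"
    unfolding isolated_in_dist_Ex_iff by blast
  have no_zero: "Lam \<gamma> \<mu> K (z + s) q \<noteq> 0" if "s \<noteq> 0" "\<bar>s\<bar> < e" "z + s < 0" "q \<in> obox" for s q
  proof
    assume "Lam \<gamma> \<mu> K (z + s) q = 0"
    from spec[OF that(3,4) this] have "complex_of_real (z + s) = complex_of_real z"
    proof (rule e(2))
      have "dist (complex_of_real z) (complex_of_real (z + s)) = dist z (z + s)" by (rule dist_of_real)
      then show "dist (complex_of_real z) (complex_of_real (z + s)) < e" using that(2) by (simp add: dist_real_def)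
    qed
    then have "z + s = z" by (simp only: of_real_eq_iff)
    then show False using that(1) by simp
  qed
  \<comment> \<open>A null sequence of energy shifts inside the isolation radius \<open>e\<close>;
    the bound \<open>- z / 2\<close> keeps \<open>z + s n\<close> negative and away from
    zero.\<close>
  define s where "s n = min e (- z) / (2 + real n)" for n :: nat
  have s: "0 < s n" "s n < e" "s n \<le> - z / 2" for n
  proof -
    show "0 < s n" using e z by (simp add: s_def)
    have "s n \<le> min e (- z) / 2" unfolding s_def using e z by (intro divide_left_mono) auto
    then show "s n < e" "s n \<le> - z / 2" using e z by auto
  qed
  have s0: "s \<longlonglongrightarrow> 0" unfolding s_def
    by (intro tendsto_divide_0[OF tendsto_const] filterlim_at_top_imp_at_infinity
        filterlim_tendsto_add_at_top[OF tendsto_const] filterlim_real_sequentially)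
  have cont: "(\<lambda>n. Lam \<gamma> \<mu> K (z + t n) q1) \<longlonglongrightarrow> Lam \<gamma> \<mu> K z q1"
    if "t \<longlonglongrightarrow> 0" "\<And>n. t n \<le> - z / 2" for t
  proof -
    have "(\<lambda>n. z + t n) \<longlonglongrightarrow> z + 0" by (intro tendsto_intros that)
    moreover have "z + t n \<in> {..z / 2}" for n using that(2)[of n] by simp
    ultimately show ?thesis
      using continuous_on_tendsto_compose[OF continuous_on_Lam_energy[OF \<gamma>, of "z/2" \<mu> K q1], of "\<lambda>n. z + t n" z sequentially] z
      by auto
  qed
  have "0 \<le> Lam \<gamma> \<mu> K z q1"
  proof (rule LIMSEQ_le_const[OF cont[of "\<lambda>n. - s n"]])
    show "(\<lambda>n. - s n) \<longlonglongrightarrow> 0" using tendsto_minus[OF s0] by simp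
    show "- s n \<le> - z / 2" for n using s(1)[of n] z by simp
    have "0 \<le> Lam \<gamma> \<mu> K (z + - s n) q1" for n
    proof (rule ccontr)
      assume "\<not> ?thesis"
      moreover have "0 < Lam \<gamma> \<mu> K (z + - s n) q0"
        using Lam_strict_antimono[OF \<gamma> _ z \<mu>, of "z + - s n" K q0] s(1)[of n] zero by simp
      moreover have "z + - s n < 0" using s(1)[of n] z by simp
      ultimately obtain q where "q \<in> obox" "Lam \<gamma> \<mu> K (z + - s n) q = 0"
        using Lam_zero_exists[OF \<gamma> _ nonconst(1) q0, of "z + - s n" \<mu> K] by force
      then show False using no_zero[of "- s n" q] s[of n] z by simp
    qed
    then show "\<exists>N. \<forall>n\<ge>N. 0 \<le> Lam \<gamma> \<mu> K (z + - s n) q1" by blast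
  qed
  moreover have "Lam \<gamma> \<mu> K z q1 \<le> 0"
  proof (rule LIMSEQ_le_const2[OF cont[OF s0 s(3)]])
    have "Lam \<gamma> \<mu> K (z + s n) q1 \<le> 0" for n
    proof (rule ccontr)
      assume "\<not> ?thesis"
      moreover have neg: "z + s n < 0" using s(3)[of n] z by simp
      moreover have "Lam \<gamma> \<mu> K (z + s n) q0 < 0"
        using Lam_strict_antimono[OF \<gamma> _ neg \<mu>, of z K q0] s(1)[of n] zero by simp
      ultimately obtain q where "q \<in> obox" "Lam \<gamma> \<mu> K (z + s n) q = 0"
        using Lam_zero_exists[OF \<gamma> neg q0 nonconst(1), of \<mu> K] by force
      then show False using no_zero[of "s n" q] s[of n] neg by simp
    qed
    then show "\<exists>N. \<forall>n\<ge>N. Lam \<gamma> \<mu> K (z + s n) q1 \<le> 0" by blast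
  qed
  ultimately show False using nonconst(2) by simp
qed

text \<open>At very low energy \<open>Lam\<close> is positive, at \<open>e\<close> it is not, so it
  vanishes at some energy \<open>z \<le> e\<close> for the same momentum. By
  \<open>Lam_bounds\<close> such a zero lies in the energy window of
  \<open>nonconst\<close>.\<close>

lemma inf_ess_spectrum_le:
  assumes \<gamma>: "0 \<le> \<gamma>" and \<mu>: "0 < \<mu>" and e: "e < 0" and q0: "q0 \<in> obox" and le: "Lam \<gamma> \<mu> K e q0 \<le> 0"
    and nonconst: "\<And>z. z < 0 \<Longrightarrow> - \<mu> \<le> z \<Longrightarrow> z \<le> - \<mu> + (12 + 6 * \<gamma>) \<Longrightarrow> \<exists>q\<in>obox. Lam \<gamma> \<mu> K z q \<noteq> 0"
  shows "inf_ess_spectrum torus2_measure L2a (H_op \<gamma> \<mu> K) \<le> ereal e"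
proof -
  \<comment> \<open>Low enough that \<open>\<mu> / (- b) < 1\<close>, which makes \<open>Lam\<close>
    positive.\<close>
  define b where "b = e - \<mu> - 1"
  have b: "b < e" "b < 0" using \<mu> e by (auto simp: b_def)
  have "\<mu> / (- b) < 1" using b \<mu> e by (simp add: b_def)
  then have "0 < Lam \<gamma> \<mu> K b q0" using Lam_bounds(1)[OF \<gamma> b(2) \<mu>, of K q0] by simp
  moreover have "continuous_on {b..e} (\<lambda>z. Lam \<gamma> \<mu> K z q0)"
    using continuous_on_Lam_energy[OF \<gamma> e] by (rule continuous_on_subset) auto
  ultimately obtain z where z: "b \<le> z" "z \<le> e" "Lam \<gamma> \<mu> K z q0 = 0"
    using IVT2'[of "\<lambda>z. Lam \<gamma> \<mu> K z q0" e 0 b] le b by auto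
  have zn: "z < 0" using z e by simp
  have "- \<mu> \<le> z" using Lam_bounds(1)[OF \<gamma> zn \<mu>, of K q0] z(3) zn by (simp add: field_simps)
  moreover have "z \<le> - \<mu> + (12 + 6 * \<gamma>)"
    using Lam_bounds(2)[OF \<gamma> zn \<mu>, of K q0] z(3) zn \<gamma> by (simp add: field_simps)
  ultimately obtain q1 where "q1 \<in> obox" "Lam \<gamma> \<mu> K z q1 \<noteq> 0" using nonconst zn by blast
  from zero_of_Lam_in_essential_spectrum[OF \<gamma> \<mu> zn q0 z(3) this]
  have "inf_ess_spectrum torus2_measure L2a (H_op \<gamma> \<mu> K) \<le> ereal (Re (complex_of_real z))"
    unfolding inf_ess_spectrum_def by (rule INF_lower)
  then show ?thesis using z(2) by (simp add: order_trans)
qed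

section \<open>Strong coupling asymptotics of the branch function\<close>

lemma Jordan_sine_inequality:
  assumes "0 \<le> x" "x \<le> pi / 2"
  shows "2 / pi * x \<le> sin x"
proof -
  have c: "convex_on {0..pi/2} (\<lambda>x. - sin x)"
  proof (rule f''_ge0_imp_convex)
    fix x assume "x \<in> {0..pi/2}"
    then show "0 \<le> sin x" by (intro sin_ge_zero) auto
    show "((\<lambda>x. - sin x) has_real_derivative - cos x) (at x)" by (auto intro!: derivative_eq_intros)
    show "((\<lambda>x. - cos x) has_real_derivative sin x) (at x)" by (auto intro!: derivative_eq_intros)
  qed simp
  define t where "t = 2 / pi * x"
  have t: "0 \<le> t" "t \<le> 1" "t * (pi / 2) = x" using assms by (auto simp: t_def field_simps)
  have "- sin ((1 - t) *\<^sub>R 0 + t *\<^sub>R (pi / 2)) \<le> (1 - t) * (- sin 0) + t * (- sin (pi / 2))"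
    by (rule convex_onD[OF c]) (use t in auto)
  then show ?thesis using t by (simp add: t_def)
qed

lemma one_minus_cos_ge:
  assumes "\<bar>t\<bar> \<le> pi"
  shows "2 / pi\<^sup>2 * t\<^sup>2 \<le> 1 - cos t"
proof -
  have "2 / pi * (\<bar>t\<bar> / 2) \<le> sin (\<bar>t\<bar> / 2)" using assms by (intro Jordan_sine_inequality) auto
  then have "(\<bar>t\<bar> / pi)\<^sup>2 \<le> (sin (\<bar>t\<bar> / 2))\<^sup>2" by (intro power_mono) auto
  moreover have "cos t = 1 - 2 * (sin (\<bar>t\<bar> / 2))\<^sup>2"
    using cos_double_sin[of "\<bar>t\<bar> / 2"] by simp
  ultimately show ?thesis by (simp add: power_divide)
qed

lemma norm_cart_power2: "(norm (p :: real^'n))\<^sup>2 = (\<Sum>i\<in>UNIV. (p $ i)\<^sup>2)"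
  unfolding power2_norm_eq_inner inner_vec_def by (simp add: power2_eq_square)

lemma eps_ge_norm:
  assumes "\<And>i. \<bar>t $ i\<bar> \<le> pi"
  shows "2 / pi\<^sup>2 * (norm t)\<^sup>2 \<le> eps t"
  unfolding norm_cart_power2 eps_def sum_distrib_left
  using one_minus_cos_ge[OF assms] by (intro sum_mono) auto

text \<open>Symmetric second differences take the place of the Hessian: they commute with the
  integral over \<open>p\<close> and call for no differentiation under it.\<close>

lemma eps_second_difference:
  "eps (k + t) + eps (k - t) - 2 * eps k = 2 * (\<Sum>i\<in>UNIV. cos (k $ i) * (1 - cos (t $ i)))"
  by (simp add: eps_def cos_add cos_diff sum_distrib_left flip: sum.distrib sum_subtractf)
    (simp add: algebra_simps)

lemma eps_second_difference_le: "\<bar>eps (k + t) + eps (k - t) - 2 * eps k\<bar> \<le> 2 * eps t"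
proof -
  have "\<bar>\<Sum>i\<in>UNIV. cos (k $ i) * (1 - cos (t $ i))\<bar> \<le> (\<Sum>i\<in>UNIV. 1 - cos (t $ i))"
  proof (rule order_trans[OF sum_abs], rule sum_mono)
    fix i
    have "\<bar>cos (k $ i)\<bar> * \<bar>1 - cos (t $ i)\<bar> \<le> 1 * \<bar>1 - cos (t $ i)\<bar>" by (intro mult_right_mono) auto
    then show "\<bar>cos (k $ i) * (1 - cos (t $ i))\<bar> \<le> 1 - cos (t $ i)" by (simp add: abs_mult)
  qed
  then show ?thesis unfolding eps_second_difference by (simp add: eps_def)
qed

text \<open>The increment is odd in \<open>t\<close>, so its square is of the same order as
  \<open>eps t\<close>. Cauchy-Schwarz over three coordinates gives a factor 3, and
  \<open>sin^2 \<le> 2 (1 - cos)\<close> turns the coefficient 4 into 8.\<close>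

lemma eps_first_difference_sq: "(eps (k + t) - eps (k - t))\<^sup>2 \<le> 24 * eps t"
proof -
  have "eps (k + t) - eps (k - t) = (\<Sum>i\<in>UNIV. 2 * (sin (k $ i) * sin (t $ i)))"
    by (simp add: eps_def cos_add cos_diff flip: sum_subtractf)
  then have "(eps (k + t) - eps (k - t))\<^sup>2 \<le> (\<Sum>i\<in>UNIV. (2 * (sin (k $ i) * sin (t $ i)))\<^sup>2) * real CARD(3)"
    using sum_squared_le_sum_of_squares[of "\<lambda>i. 2 * (sin (k $ i) * sin (t $ i))" "UNIV :: 3 set"] by simp
  also have "\<dots> \<le> (\<Sum>i\<in>UNIV. 8 * (1 - cos (t $ i))) * real CARD(3)"
  proof (intro mult_right_mono sum_mono)
    fix i
    have "(sin (k $ i))\<^sup>2 * (sin (t $ i))\<^sup>2 \<le> 1 * (sin (t $ i))\<^sup>2"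
      by (intro mult_right_mono) (auto simp: abs_square_le_1)
    moreover have "(sin (t $ i))\<^sup>2 = (1 - cos (t $ i)) * (1 + cos (t $ i))"
      by (simp add: sin_squared_eq power2_eq_square algebra_simps)
    moreover have "(1 - cos (t $ i)) * (1 + cos (t $ i)) \<le> (1 - cos (t $ i)) * 2" by (intro mult_left_mono) auto
    ultimately show "(2 * (sin (k $ i) * sin (t $ i)))\<^sup>2 \<le> 8 * (1 - cos (t $ i))"
      by (simp add: power_mult_distrib)
  qed simp
  also have "\<dots> = 24 * eps t" unfolding eps_def sum_distrib_left[symmetric] by simp
  finally show ?thesis .
qed

text \<open>Both factors are at least \<open>\<mu> / 2\<close>. The 12 arises from dividing
  \<open>3 * C * \<mu>\<close>, a bound for \<open>\<bar>\<mu>\<^sup>2 - a * b\<bar>\<close>, by the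
  lower bound \<open>\<mu>\<^sup>2 / 4\<close> for the product.\<close>

lemma product_near_square:
  fixes a b \<mu> C :: real
  assumes a: "\<bar>a - \<mu>\<bar> \<le> C" and b: "\<bar>b - \<mu>\<bar> \<le> C" and \<mu>: "2 * C \<le> \<mu>" "0 < \<mu>"
  shows "\<mu> / 2 \<le> a" "\<mu>\<^sup>2 / (a * b) \<le> 4" "\<bar>\<mu>\<^sup>2 / (a * b) - 1\<bar> \<le> 12 * C / \<mu>"
proof -
  have C: "0 \<le> C" using a by linarith
  show a2: "\<mu> / 2 \<le> a" using a \<mu> by linarith
  have b2: "\<mu> / 2 \<le> b" using b \<mu> by linarith
  have "(\<mu> / 2) * (\<mu> / 2) \<le> a * b" using a2 b2 \<mu> by (intro mult_mono) auto
  then have ab: "\<mu>\<^sup>2 / 4 \<le> a * b" by (simp add: power2_eq_square)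
  have abp: "0 < a * b" using a2 b2 \<mu> by (intro mult_pos_pos) auto
  show "\<mu>\<^sup>2 / (a * b) \<le> 4" using ab abp by (simp add: pos_divide_le_eq)
  define x where "x = a - \<mu>"
  define y where "y = b - \<mu>"
  have xy: "\<bar>x\<bar> \<le> C" "\<bar>y\<bar> \<le> C" using a b by (auto simp: x_def y_def)
  have "\<mu>\<^sup>2 - a * b = - (\<mu> * (x + y)) - x * y" by (simp add: x_def y_def power2_eq_square algebra_simps)
  also have "\<bar>\<dots>\<bar> \<le> \<mu> * (2 * C) + C * C"
  proof -
    have "\<bar>\<mu> * (x + y)\<bar> \<le> \<mu> * (2 * C)" unfolding abs_mult using xy \<mu> by (intro mult_mono) auto
    moreover have "\<bar>x * y\<bar> \<le> C * C" unfolding abs_mult using xy by (intro mult_mono) auto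
    ultimately show ?thesis by linarith
  qed
  also have "\<dots> \<le> 3 * C * \<mu>"
  proof -
    have "C * C \<le> C * \<mu>" using C \<mu> by (intro mult_left_mono) auto
    then show ?thesis by (simp add: algebra_simps)
  qed
  finally have n: "\<bar>\<mu>\<^sup>2 - a * b\<bar> \<le> 3 * C * \<mu>" .
  have "\<bar>\<mu>\<^sup>2 / (a * b) - 1\<bar> = \<bar>\<mu>\<^sup>2 - a * b\<bar> / (a * b)"
  proof -
    have "\<mu>\<^sup>2 / (a * b) - 1 = (\<mu>\<^sup>2 - a * b) / (a * b)"
      using a2 b2 \<mu> by (simp add: diff_divide_distrib)
    then show ?thesis using abp by (simp only: abs_divide abs_of_pos)
  qed
  also have "\<dots> \<le> (3 * C * \<mu>) / (\<mu>\<^sup>2 / 4)"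
  proof (rule frac_le)
    show "0 \<le> 3 * C * \<mu>" using C \<mu> by simp
    show "0 < \<mu>\<^sup>2 / 4" using \<mu> by simp
  qed (rule n, rule ab)
  also have "\<dots> = 12 * C / \<mu>" using \<mu> by (simp add: field_simps power2_eq_square)
  finally show "\<bar>\<mu>\<^sup>2 / (a * b) - 1\<bar> \<le> 12 * C / \<mu>" .
qed

text \<open>The energy window that contains both the zeros of \<open>Lam\<close> and any eigenvalue
  \<open>e\<close> still to be excluded. Inside it every denominator \<open>D p q\<close> is within
  \<open>C\<close> of \<open>\<mu>\<close>, whence error bounds independent of
  \<open>z\<close>.\<close>

locale strong_coupling =
  fixes \<gamma> \<mu> z :: real and K :: "real^3" and C :: real
  assumes \<gamma>: "0 \<le> \<gamma>" and C_eq: "C = 12 + 6 * \<gamma>" and \<mu>: "2 * C \<le> \<mu>"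
    and z: "- \<mu> \<le> z" "z \<le> - \<mu> + C"
begin

lemma C_pos: "0 < C" and \<mu>_pos: "0 < \<mu>" and z_neg: "z < 0"
  using \<gamma> \<mu> z by (auto simp: C_eq)

text \<open>The factor \<open>\<mu>\<close> brings the variation in \<open>q\<close> to order one:
  differences of \<open>w\<close> are those of \<open>eps\<close> up to
  \<open>O(1/\<mu>)\<close>.\<close>

definition w :: "real^3 \<Rightarrow> real" where "w q = \<mu> * Lam \<gamma> \<mu> K z q"

definition D :: "real^3 \<Rightarrow> real^3 \<Rightarrow> real" where "D p q = E_disp \<gamma> K p q - z"

lemma D_near: "\<bar>D p q - \<mu>\<bar> \<le> C"
  using E_disp_bounds[OF \<gamma>, of K p q] z by (auto simp: D_def C_eq abs_le_iff)

lemma D_pos: "0 < D p q"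
  using E_minus_pos[OF \<gamma> z_neg] by (simp add: D_def)

lemma D_diff_le: "\<bar>D p q - D p q'\<bar> \<le> C"
  using E_disp_bounds[OF \<gamma>, of K p q] E_disp_bounds[OF \<gamma>, of K p q'] by (auto simp: D_def C_eq abs_le_iff)

lemma D_inverse_integrable: "integrable torus_measure (\<lambda>p. 1 / D p q)"
  unfolding D_def by (rule inverse_E_integrable[OF \<gamma> z_neg])

lemma w_eq: "w q = \<mu> - \<mu>\<^sup>2 / vol * (\<integral>p. 1 / D p q \<partial>torus_measure)"
  by (simp add: w_def Lam_def Jint_def D_def power2_eq_square algebra_simps)

lemma E_integrable: "integrable torus_measure (\<lambda>p. E_disp \<gamma> K p q)"
proof (rule torus.integrable_const_bound[where B = C])
  show "AE p in torus_measure. norm (E_disp \<gamma> K p q) \<le> C"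
    using E_disp_bounds[OF \<gamma>, of K _ q] by (intro AE_I2) (auto simp: C_eq)
qed measurable

lemma D_integrable: "integrable torus_measure (\<lambda>p. D p q)"
  unfolding D_def using E_integrable by simp

lemma integral_D: "(\<integral>p. D p q \<partial>torus_measure) = vol * (3 + eps q + 3 * \<gamma> - z)"
  unfolding D_def using E_integrable
  by (simp add: integral_torus_E_disp measure_torus algebra_simps)

text \<open>The difference of two reciprocals is \<open>D p q - D p q'\<close> over a product that
  is nearly \<open>\<mu>\<^sup>2\<close>, and averaging \<open>D p q - D p q'\<close> over
  \<open>p\<close> leaves \<open>eps q - eps q'\<close>. Only differences are comparable, as the
  additive level of \<open>w\<close> depends on \<open>z\<close>.\<close>

lemma w_diff: "eps q - eps q' - 12 * C\<^sup>2 / \<mu> \<le> w q - w q'"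
proof -
  have pt: "D p q - D p q' - 12 * C\<^sup>2 / \<mu> \<le> \<mu>\<^sup>2 * (1 / D p q' - 1 / D p q)" for p
  proof -
    define \<theta> where "\<theta> = \<mu>\<^sup>2 / (D p q' * D p q)"
    have \<theta>: "\<bar>\<theta> - 1\<bar> \<le> 12 * C / \<mu>"
      unfolding \<theta>_def by (rule product_near_square(3)[OF D_near D_near \<mu> \<mu>_pos])
    have "\<bar>(\<theta> - 1) * (D p q - D p q')\<bar> \<le> 12 * C / \<mu> * C"
      unfolding abs_mult using \<theta> D_diff_le C_pos \<mu>_pos by (intro mult_mono) auto
    moreover have "\<mu>\<^sup>2 * (1 / D p q' - 1 / D p q) = \<theta> * (D p q - D p q')"
      using D_pos[of p q] D_pos[of p q'] by (simp add: \<theta>_def field_simps)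
    ultimately show ?thesis by (simp add: algebra_simps power2_eq_square abs_le_iff)
  qed
  have "(\<integral>p. D p q - D p q' - 12 * C\<^sup>2 / \<mu> \<partial>torus_measure) \<le> (\<integral>p. \<mu>\<^sup>2 * (1 / D p q' - 1 / D p q) \<partial>torus_measure)"
    using D_integrable D_inverse_integrable pt by (intro integral_mono) auto
  moreover have "(\<integral>p. D p q - D p q' - 12 * C\<^sup>2 / \<mu> \<partial>torus_measure) = vol * (eps q - eps q' - 12 * C\<^sup>2 / \<mu>)"
    using D_integrable by (simp add: integral_D measure_torus algebra_simps)
  moreover have "(\<integral>p. \<mu>\<^sup>2 * (1 / D p q' - 1 / D p q) \<partial>torus_measure)
    = \<mu>\<^sup>2 * ((\<integral>p. 1 / D p q' \<partial>torus_measure) - (\<integral>p. 1 / D p q \<partial>torus_measure))"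
    unfolding integral_mult_right_zero
    by (simp only: Bochner_Integration.integral_diff[OF D_inverse_integrable D_inverse_integrable])
  ultimately have "vol * (eps q - eps q' - 12 * C\<^sup>2 / \<mu>) \<le> \<mu>\<^sup>2 * ((\<integral>p. 1 / D p q' \<partial>torus_measure) - (\<integral>p. 1 / D p q \<partial>torus_measure))"
    by argo
  also have "\<dots> = vol * (w q - w q')" using vol_pos by (simp add: w_eq field_simps)
  finally show ?thesis using vol_pos by simp
qed

definition C3 :: real where "C3 = 24 * C * (1 + \<gamma>) + 192 * (1 + \<gamma>\<^sup>2)"

text \<open>The point is an error proportional to \<open>eps t\<close>, which still vanishes at
  \<open>t = 0\<close>. The first summand of \<open>C3\<close> comes from replacing
  \<open>\<mu>\<^sup>2\<close> over products of denominators by 1, the second from the squared first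
  difference.\<close>

lemma w_second_difference:
  "2 * (\<Sum>i\<in>UNIV. cos (c $ i) * (1 - cos (t $ i))) - C3 / \<mu> * eps t \<le> w (c + t) + w (c - t) - 2 * w c"
proof -
  have pt: "D p (c + t) + D p (c - t) - 2 * D p c - C3 / \<mu> * eps t
    \<le> \<mu>\<^sup>2 * (2 * (1 / D p c) - 1 / D p (c + t) - 1 / D p (c - t))" for p
  proof -
    define a where "a = D p (c + t)"
    define b where "b = D p (c - t)"
    define d where "d = D p c"
    define k where "k = K - p - c"
    define s where "s = a + b - 2 * d"
    define \<theta> where "\<theta> = (\<mu>\<^sup>2 / (b * d) + \<mu>\<^sup>2 / (a * d)) / 2"
    have pos: "0 < a" "0 < b" "0 < d" using D_pos by (auto simp: a_def b_def d_def)
    have near: "\<bar>a - \<mu>\<bar> \<le> C" "\<bar>b - \<mu>\<bar> \<le> C" "\<bar>d - \<mu>\<bar> \<le> C" using D_near by (auto simp: a_def b_def d_def)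
    have e0: "0 \<le> eps t" by (rule eps_nonneg)
    have k: "K - p - (c + t) = k - t" "K - p - (c - t) = k + t" by (simp_all add: k_def)
    have s: "s = (eps (c + t) + eps (c - t) - 2 * eps c) + \<gamma> * (eps (k + t) + eps (k - t) - 2 * eps k)"
      unfolding s_def a_def b_def d_def D_def E_disp_def k by (simp add: k_def algebra_simps)
    have "\<bar>s\<bar> \<le> 2 * eps t + \<gamma> * (2 * eps t)"
    proof -
      have "\<bar>\<gamma> * (eps (k + t) + eps (k - t) - 2 * eps k)\<bar> \<le> \<gamma> * (2 * eps t)"
        unfolding abs_mult using \<gamma> eps_second_difference_le[of k t] by (simp add: mult_left_mono)
      then show ?thesis unfolding s using eps_second_difference_le[of c t] by linarith
    qed
    then have sb: "\<bar>s\<bar> \<le> 2 * (1 + \<gamma>) * eps t" by (simp add: algebra_simps)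
    have avg: "\<bar>(x + y) / 2 - 1\<bar> \<le> r" if "\<bar>x - 1\<bar> \<le> r" "\<bar>y - 1\<bar> \<le> r" for x y r :: real
      using that by argo
    have \<theta>: "\<bar>\<theta> - 1\<bar> \<le> 12 * C / \<mu>"
      unfolding \<theta>_def using product_near_square(3)[OF near(2,3) \<mu> \<mu>_pos] product_near_square(3)[OF near(1,3) \<mu> \<mu>_pos] by (rule avg)
    have "\<bar>(\<theta> - 1) * s\<bar> \<le> 12 * C / \<mu> * (2 * (1 + \<gamma>) * eps t)"
      unfolding abs_mult using \<theta> sb C_pos \<mu>_pos by (intro mult_mono) auto
    then have 1: "s - 12 * C / \<mu> * (2 * (1 + \<gamma>) * eps t) \<le> \<theta> * s" by (simp add: algebra_simps abs_le_iff)
    have ab: "a - b = (eps (c + t) - eps (c - t)) - \<gamma> * (eps (k + t) - eps (k - t))"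
      unfolding a_def b_def D_def E_disp_def k by (simp add: algebra_simps)
    have sq: "(x - y)\<^sup>2 \<le> 2 * x\<^sup>2 + 2 * y\<^sup>2" for x y :: real
      using zero_le_power2[of "x + y"] by (simp add: power2_sum power2_diff)
    have "(a - b)\<^sup>2 \<le> 2 * (eps (c + t) - eps (c - t))\<^sup>2 + 2 * (\<gamma> * (eps (k + t) - eps (k - t)))\<^sup>2"
      unfolding ab by (rule sq)
    also have "\<dots> \<le> 2 * (24 * eps t) + 2 * (\<gamma>\<^sup>2 * (24 * eps t))"
      unfolding power_mult_distrib using eps_first_difference_sq by (intro add_mono mult_left_mono) auto
    finally have ab2: "(a - b)\<^sup>2 \<le> 48 * (1 + \<gamma>\<^sup>2) * eps t" by (simp add: algebra_simps)
    have "\<mu>\<^sup>2 * (a - b)\<^sup>2 / (2 * a * b * d) = (\<mu>\<^sup>2 / (a * b)) * (1 / (2 * d)) * (a - b)\<^sup>2" by simp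
    also have "\<dots> \<le> 4 * (1 / \<mu>) * (48 * (1 + \<gamma>\<^sup>2) * eps t)"
    proof (intro mult_mono ab2)
      show "\<mu>\<^sup>2 / (a * b) \<le> 4" by (rule product_near_square(2)[OF near(1,2) \<mu> \<mu>_pos])
      show "1 / (2 * d) \<le> 1 / \<mu>"
        using product_near_square(1)[OF near(3,3) \<mu> \<mu>_pos] \<mu>_pos by (intro frac_le) auto
    qed (use pos \<mu>_pos e0 in auto)
    also have "\<dots> = 192 * (1 + \<gamma>\<^sup>2) / \<mu> * eps t" by (simp add: add_divide_distrib algebra_simps)
    finally have 2: "\<mu>\<^sup>2 * (a - b)\<^sup>2 / (2 * a * b * d) \<le> 192 * (1 + \<gamma>\<^sup>2) / \<mu> * eps t" .
    \<comment> \<open>An exact second-order expansion: a main term linear in the second difference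
      \<open>s\<close> of the denominators, minus a term quadratic in their first
      difference.\<close>
    have "\<mu>\<^sup>2 * (2 * (1 / d) - 1 / a - 1 / b) = \<theta> * s - \<mu>\<^sup>2 * (a - b)\<^sup>2 / (2 * a * b * d)"
    proof -
      have "2 * (1 / d) - 1 / a - 1 / b = (1 / (b * d) + 1 / (a * d)) / 2 * s - (a - b)\<^sup>2 / (2 * a * b * d)"
        using pos by (simp add: s_def field_simps power2_eq_square)
      then have "\<mu>\<^sup>2 * (2 * (1 / d) - 1 / a - 1 / b) = \<mu>\<^sup>2 * ((1 / (b * d) + 1 / (a * d)) / 2 * s) - \<mu>\<^sup>2 * ((a - b)\<^sup>2 / (2 * a * b * d))"
        by (simp only: right_diff_distrib)
      moreover have "\<mu>\<^sup>2 * ((1 / (b * d) + 1 / (a * d)) / 2 * s) = \<theta> * s"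
        by (simp add: \<theta>_def algebra_simps)
      ultimately show ?thesis by simp
    qed
    moreover have "C3 / \<mu> * eps t = 12 * C / \<mu> * (2 * (1 + \<gamma>) * eps t) + 192 * (1 + \<gamma>\<^sup>2) / \<mu> * eps t"
      by (simp add: C3_def add_divide_distrib algebra_simps)
    ultimately show ?thesis using 1 2 unfolding s_def a_def b_def d_def by linarith
  qed
  have "(\<integral>p. D p (c + t) + D p (c - t) - 2 * D p c - C3 / \<mu> * eps t \<partial>torus_measure)
    \<le> (\<integral>p. \<mu>\<^sup>2 * (2 * (1 / D p c) - 1 / D p (c + t) - 1 / D p (c - t)) \<partial>torus_measure)"
  proof (rule integral_mono[OF _ _ pt])
    show "integrable torus_measure (\<lambda>p. D p (c + t) + D p (c - t) - 2 * D p c - C3 / \<mu> * eps t)"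
      by (intro Bochner_Integration.integrable_diff Bochner_Integration.integrable_add D_integrable integrable_mult_right) auto
    show "integrable torus_measure (\<lambda>p. \<mu>\<^sup>2 * (2 * (1 / D p c) - 1 / D p (c + t) - 1 / D p (c - t)))"
      by (intro Bochner_Integration.integrable_diff integrable_mult_right D_inverse_integrable)
  qed
  also have "(\<integral>p. D p (c + t) + D p (c - t) - 2 * D p c - C3 / \<mu> * eps t \<partial>torus_measure)
    = vol * ((eps (c + t) + eps (c - t) - 2 * eps c) - C3 / \<mu> * eps t)"
    using D_integrable by (simp add: integral_D measure_torus algebra_simps)
  also have "(\<integral>p. \<mu>\<^sup>2 * (2 * (1 / D p c) - 1 / D p (c + t) - 1 / D p (c - t)) \<partial>torus_measure)
    = \<mu>\<^sup>2 * (2 * (\<integral>p. 1 / D p c \<partial>torus_measure) - (\<integral>p. 1 / D p (c + t) \<partial>torus_measure) - (\<integral>p. 1 / D p (c - t) \<partial>torus_measure))"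
    using D_inverse_integrable by (simp del: times_divide_eq_right)
  also have "\<dots> = vol * (w (c + t) + w (c - t) - 2 * w c)"
    using vol_pos by (simp add: w_eq algebra_simps)
  finally show ?thesis using vol_pos by (simp add: eps_second_difference)
qed

lemma w_continuous: "continuous_on A w"
  unfolding w_def[abs_def] by (intro continuous_intros continuous_on_Lam[OF \<gamma> z_neg])

text \<open>Let \<open>d\<close> minimize \<open>w\<close> on the cube of half-width 1, and let
  \<open>c\<close> be the midpoint of \<open>q\<close> and \<open>d\<close>. On this cube the
  cosines are at least 1/2, as \<open>1 < pi / 3\<close>, so the second difference at
  \<open>c\<close> is at least \<open>eps t / 2\<close> with \<open>t = (q - d) / 2\<close>. Since
  \<open>0 < w d \<le> w c\<close>, this bounds \<open>w q\<close> itself. The constant is the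
  product of 1/2, \<open>2 / pi\<^sup>2\<close> and 1/4.\<close>

lemma w_quadratic_lower_bound:
  assumes \<mu>3: "2 * C3 \<le> \<mu>" and pos: "\<And>q. q \<in> obox \<Longrightarrow> 0 < w q"
  obtains d where "\<And>q. (\<And>i. \<bar>q $ i\<bar> \<le> 1) \<Longrightarrow> 1 / (4 * pi\<^sup>2) * (norm (q - d))\<^sup>2 \<le> w q"
proof -
  define Q where "Q = {p :: real^3. \<forall>i. \<bar>p $ i\<bar> \<le> 1}"
  have Q: "Q = cbox (\<chi> i. - 1) (\<chi> i. 1)" by (auto simp: Q_def mem_box_cart abs_le_iff minus_le_iff)
  have "0 \<in> Q" by (simp add: Q_def)
  then obtain d where d: "d \<in> Q" "\<And>q. q \<in> Q \<Longrightarrow> w d \<le> w q"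
    using continuous_attains_inf[of Q w] w_continuous by (auto simp: Q)
  have "Q \<subseteq> obox" using pi_gt3 by (auto simp: Q_def obox_def intro: le_less_trans)
  then have wd: "0 < w d" using d pos by blast
  have "1 / (4 * pi\<^sup>2) * (norm (q - d))\<^sup>2 \<le> w q" if q: "\<And>i. \<bar>q $ i\<bar> \<le> 1" for q
  proof -
    define c where "c = (1/2) *\<^sub>R (q + d)"
    define t where "t = (1/2) *\<^sub>R (q - d)"
    have ct: "c + t = q" "c - t = d" by (simp_all add: c_def t_def flip: scaleR_add_right scaleR_diff_right)
    have db: "\<bar>d $ i\<bar> \<le> 1" for i using d by (simp add: Q_def)
    have cb: "\<bar>c $ i\<bar> \<le> 1" for i using q[of i] db[of i] by (simp add: c_def)
    have tb: "\<bar>t $ i\<bar> \<le> 1" for i using q[of i] db[of i] by (simp add: t_def)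
    have "c \<in> Q" using cb by (simp add: Q_def)
    then have wc: "w d \<le> w c" by (rule d(2))
    have cos: "1 / 2 \<le> cos (c $ i)" for i
    proof -
      have "cos (pi / 3) \<le> cos \<bar>c $ i\<bar>" using cb[of i] pi_gt3 by (intro cos_monotone_0_pi_le) auto
      then show ?thesis by (simp add: cos_60)
    qed
    have "eps t = 2 * (\<Sum>i\<in>UNIV. (1 / 2) * (1 - cos (t $ i)))" unfolding eps_def sum_distrib_left[symmetric] by simp
    also have "\<dots> \<le> 2 * (\<Sum>i\<in>UNIV. cos (c $ i) * (1 - cos (t $ i)))"
      using cos by (intro mult_left_mono sum_mono mult_right_mono) auto
    finally have 1: "eps t \<le> 2 * (\<Sum>i\<in>UNIV. cos (c $ i) * (1 - cos (t $ i)))" .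
    have "C3 / \<mu> * eps t \<le> 1 / 2 * eps t"
      using \<mu>3 \<mu>_pos eps_nonneg by (intro mult_right_mono) (auto simp: field_simps)
    then have "1 / 2 * eps t \<le> w q + w d - 2 * w c"
      using w_second_difference[of c t] 1 by (simp add: ct)
    then have "1 / 2 * eps t \<le> w q" using wc wd by simp
    moreover have "2 / pi\<^sup>2 * (norm t)\<^sup>2 \<le> eps t"
      using tb pi_gt3 by (intro eps_ge_norm) (meson order_trans less_imp_le order.strict_trans1 one_le_numeral)
    moreover have "(norm t)\<^sup>2 = 1 / 4 * (norm (q - d))\<^sup>2"
      by (simp add: t_def power_divide)
    ultimately show ?thesis by simp
  qed
  then show ?thesis by (rule that)
qed

end

section \<open>Positivity of perturbed forms below the critical mass ratio\<close>

lemma AE_obox: "AE p in torus_measure. p \<in> obox"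
proof -
  have c: "cube 0 pi = obox" by (simp add: cube_def obox_def)
  have s: "obox \<in> sets torus_measure" and m: "measure torus_measure obox = vol"
    using measure_cube[of pi 0] obox_subset_torus by (simp_all add: c vol_def)
  have "measure torus_measure (torus - obox) = 0"
    using torus.finite_measure_Diff[of torus obox] s m obox_subset_torus sets.top[of torus_measure]
    by (simp add: measure_torus)
  then have "torus - obox \<in> null_sets torus_measure"
    using s sets.top[of torus_measure] by (auto simp: null_sets_def torus.emeasure_eq_measure)
  then show ?thesis by (rule AE_I') auto
qed

lemma AE_torus_not_eq: "AE p in torus_measure. p \<noteq> d"
proof -
  have "AE p in lborel. p \<noteq> d" by (rule AE_lborel_singleton)
  then show ?thesis unfolding torus_measure_def by (subst AE_restrict_space_iff) (auto elim: eventually_mono)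
qed

lemma nn_integral_inverse_weight:
  assumes [measurable]: "w \<in> borel_measurable torus_measure" "A \<in> sets torus_measure"
    and a: "0 < a" "\<And>p i. p \<in> A \<Longrightarrow> \<bar>p $ i\<bar> \<le> a" and k: "0 < k"
    and w: "AE p in torus_measure. p \<in> A \<longrightarrow> k * (norm (p - d))\<^sup>2 \<le> w p"
  shows "(\<integral>\<^sup>+p. ennreal (1 / w p) * indicator A p \<partial>torus_measure) \<le> ennreal (512 * a / k)"
proof -
  define g where "g p = ennreal (1 / k) * (ennreal (1 / (norm (p - d))\<^sup>2) * indicator {p. \<forall>i. \<bar>p $ i\<bar> \<le> a} p)" for p
  have m1: "(\<lambda>p. ennreal (1 / (norm (p - d))\<^sup>2) * indicator {p. \<forall>i. \<bar>p $ i\<bar> \<le> a} p) \<in> borel_measurable borel"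
    by measurable
  then have m [measurable]: "g \<in> borel_measurable borel" unfolding g_def[abs_def] by measurable
  have "(\<integral>\<^sup>+p. ennreal (1 / w p) * indicator A p \<partial>torus_measure) \<le> (\<integral>\<^sup>+p. g p \<partial>torus_measure)"
  proof (rule nn_integral_mono_AE)
    show "AE p in torus_measure. ennreal (1 / w p) * indicator A p \<le> g p"
      using w AE_torus_not_eq[of d]
    proof eventually_elim
      case (elim p)
      show ?case
      proof (cases "p \<in> A")
        case True
        have n: "0 < (norm (p - d))\<^sup>2" using elim by simp
        then have "0 < k * (norm (p - d))\<^sup>2" using k by simp
        then have "1 / w p \<le> 1 / (k * (norm (p - d))\<^sup>2)" using elim True by (intro frac_le) auto
        then have "ennreal (1 / w p) \<le> ennreal (1 / k * (1 / (norm (p - d))\<^sup>2))" by (intro ennreal_leI) (simp add: mult.commute)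
          also have "\<dots> = ennreal (1 / k) * ennreal (1 / (norm (p - d))\<^sup>2)" using k by (intro ennreal_mult) auto
          finally show ?thesis using True a(2) by (simp add: g_def)
      qed simp
    qed
  qed
  also have "\<dots> \<le> (\<integral>\<^sup>+p. g p \<partial>lborel)"
    unfolding torus_measure_def by (subst nn_integral_restrict_space) (auto intro!: nn_integral_mono simp: indicator_def)
  also have "\<dots> = ennreal (1 / k) * (\<integral>\<^sup>+p. ennreal (1 / (norm (p - d))\<^sup>2) * indicator {p. \<forall>i. \<bar>p $ i\<bar> \<le> a} p \<partial>lborel)"
    unfolding g_def using m1 by (intro nn_integral_cmult) simp
  also have "\<dots> \<le> ennreal (1 / k) * ennreal (512 * a)"
    by (intro mult_left_mono nn_integral_inverse_square a) simp
  also have "\<dots> = ennreal (512 * a / k)" using a k by (simp flip: ennreal_mult)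
  finally show ?thesis .
qed

text \<open>Split the modulus of \<open>\<phi>\<close> as \<open>sqrt w\<close> times it, times
  \<open>1 / sqrt w\<close>. The weight enters only through the integral of \<open>1 / w\<close>, so
  it may come close to zero as long as that integral stays controlled.\<close>

lemma weighted_Cauchy_Schwarz:
  assumes [measurable]: "\<phi> \<in> borel_measurable M" "w \<in> borel_measurable M" "A \<in> sets M"
    and w: "AE x in M. 0 < w x" and i: "integrable M (\<lambda>x. w x * (\<phi> x)\<^sup>2)" "integrable M \<phi>"
    and r: "(\<integral>\<^sup>+x. ennreal (1 / w x) * indicator A x \<partial>M) \<le> ennreal r" "0 \<le> r"
  shows "(\<integral>x. \<bar>\<phi> x\<bar> * indicator A x \<partial>M)\<^sup>2 \<le> r * (\<integral>x. w x * (\<phi> x)\<^sup>2 \<partial>M)"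
proof -
  have iA: "integrable M (\<lambda>x. \<bar>\<phi> x\<bar> * indicator A x)"
    by (intro integrable_real_mult_indicator integrable_abs i) fact
  have W: "0 \<le> (\<integral>x. w x * (\<phi> x)\<^sup>2 \<partial>M)"
    by (intro integral_nonneg_AE) (use w in eventually_elim, simp)
  define f where "f x = ennreal (sqrt (w x) * \<bar>\<phi> x\<bar>)" for x
  define g where "g x = ennreal (sqrt (1 / w x)) * indicator A x" for x
  have [measurable]: "f \<in> borel_measurable M" "g \<in> borel_measurable M" unfolding f_def[abs_def] g_def[abs_def] by measurable
  have "ennreal ((\<integral>x. \<bar>\<phi> x\<bar> * indicator A x \<partial>M)\<^sup>2) = (\<integral>\<^sup>+x. ennreal (\<bar>\<phi> x\<bar> * indicator A x) \<partial>M)\<^sup>2"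
    by (subst nn_integral_eq_integral[OF iA]) (auto simp: ennreal_power)
  also have "(\<integral>\<^sup>+x. ennreal (\<bar>\<phi> x\<bar> * indicator A x) \<partial>M) = (\<integral>\<^sup>+x. f x * g x \<partial>M)"
  proof (rule nn_integral_cong_AE)
    show "AE x in M. ennreal (\<bar>\<phi> x\<bar> * indicator A x) = f x * g x"
      using w
    proof eventually_elim
      case (elim x)
      have "sqrt (w x) * \<bar>\<phi> x\<bar> * sqrt (1 / w x) = \<bar>\<phi> x\<bar>" using elim by (simp add: real_sqrt_divide)
      then show ?case using elim by (cases "x \<in> A") (auto simp: f_def g_def simp flip: ennreal_mult)
    qed
  qed
  also have "(\<integral>\<^sup>+x. f x * g x \<partial>M)\<^sup>2 \<le> (\<integral>\<^sup>+x. f x ^ 2 \<partial>M) * (\<integral>\<^sup>+x. g x ^ 2 \<partial>M)"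
    by (rule Cauchy_Schwarz_nn_integral) measurable
  also have "(\<integral>\<^sup>+x. f x ^ 2 \<partial>M) = (\<integral>\<^sup>+x. ennreal (w x * (\<phi> x)\<^sup>2) \<partial>M)"
    by (rule nn_integral_cong_AE) (use w in eventually_elim, simp add: f_def ennreal_power power_mult_distrib)
  also have "\<dots> = ennreal (\<integral>x. w x * (\<phi> x)\<^sup>2 \<partial>M)"
    by (rule nn_integral_eq_integral[OF i(1)]) (use w in eventually_elim, simp)
  also have "(\<integral>\<^sup>+x. g x ^ 2 \<partial>M) = (\<integral>\<^sup>+x. ennreal (1 / w x) * indicator A x \<partial>M)"
    by (rule nn_integral_cong_AE)
      (use w in eventually_elim, simp add: g_def ennreal_power power_mult_distrib indicator_def)
  also have "ennreal (\<integral>x. w x * (\<phi> x)\<^sup>2 \<partial>M) * (\<integral>\<^sup>+x. ennreal (1 / w x) * indicator A x \<partial>M)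
    \<le> ennreal (\<integral>x. w x * (\<phi> x)\<^sup>2 \<partial>M) * ennreal r"
    by (intro mult_left_mono r) simp
  also have "\<dots> = ennreal (r * (\<integral>x. w x * (\<phi> x)\<^sup>2 \<partial>M))" using W r by (simp add: mult.commute flip: ennreal_mult)
  finally show ?thesis using W r by (simp add: ennreal_le_iff)
qed

text \<open>A bounded kernel is controlled by \<open>L^1\<close> norms, exactly what
  \<open>weighted_Cauchy_Schwarz\<close> supplies.\<close>

lemma kernel_bound:
  assumes f: "sq_int torus_measure f" and g: "sq_int torus_measure g"
    and b: "b \<in> borel_measurable torus2_measure" "\<And>x. x \<in> torus \<times> torus \<Longrightarrow> \<bar>b x\<bar> \<le> C"
  shows "\<bar>\<integral>x. b x * (f (fst x) * g (snd x)) \<partial>torus2_measure\<bar>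
    \<le> C * ((\<integral>p. \<bar>f p\<bar> \<partial>torus_measure) * (\<integral>p. \<bar>g p\<bar> \<partial>torus_measure))"
proof -
  have af: "sq_int torus_measure (\<lambda>p. \<bar>f p\<bar>)" and ag: "sq_int torus_measure (\<lambda>p. \<bar>g p\<bar>)"
    using f g by (auto simp: sq_int_def)
  have "\<bar>\<integral>x. b x * (f (fst x) * g (snd x)) \<partial>torus2_measure\<bar> \<le> (\<integral>x. \<bar>b x * (f (fst x) * g (snd x))\<bar> \<partial>torus2_measure)"
    by (rule integral_abs_bound)
  also have "\<dots> \<le> (\<integral>x. C * (\<bar>f (fst x)\<bar> * \<bar>g (snd x)\<bar>) \<partial>torus2_measure)"
  proof (rule integral_mono_AE)
    show "integrable torus2_measure (\<lambda>x. \<bar>b x * (f (fst x) * g (snd x))\<bar>)"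
      by (intro integrable_abs torus2_integrable_kernel[OF f g b])
    show "integrable torus2_measure (\<lambda>x. C * (\<bar>f (fst x)\<bar> * \<bar>g (snd x)\<bar>))"
      using torus2_integrable_prod[OF af ag] by simp
    show "AE x in torus2_measure. \<bar>b x * (f (fst x) * g (snd x))\<bar> \<le> C * (\<bar>f (fst x)\<bar> * \<bar>g (snd x)\<bar>)"
      using b(2) by (intro AE_I2) (auto simp: abs_mult intro!: mult_right_mono)
  qed
  also have "\<dots> = C * ((\<integral>p. \<bar>f p\<bar> \<partial>torus_measure) * (\<integral>p. \<bar>g p\<bar> \<partial>torus_measure))"
    using torus2_integral_prod[OF af ag] by simp
  finally show ?thesis .
qed

lemma qker_diff_le:
  assumes f: "sq_int torus_measure f" and g: "sq_int torus_measure g"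
  shows "\<bar>qker K f - qker K g\<bar>
    \<le> 3 * ((\<integral>p. \<bar>f p - g p\<bar> \<partial>torus_measure) * ((\<integral>p. \<bar>f p\<bar> \<partial>torus_measure) + (\<integral>p. \<bar>g p\<bar> \<partial>torus_measure)))"
proof -
  have fg: "sq_int torus_measure (\<lambda>p. f p - g p)" by (intro sq_int_diff f g)
  let ?B = "\<lambda>u v. \<integral>x. kker K (fst x) (snd x) * (u (fst x) * v (snd x)) \<partial>torus2_measure"
  have "qker K f - qker K g = ?B (\<lambda>p. f p - g p) f + ?B g (\<lambda>p. f p - g p)"
  proof -
    have "?B (\<lambda>p. f p - g p) f + ?B g (\<lambda>p. f p - g p)
      = (\<integral>x. kker K (fst x) (snd x) * ((f (fst x) - g (fst x)) * f (snd x)) + kker K (fst x) (snd x) * (g (fst x) * (f (snd x) - g (snd x))) \<partial>torus2_measure)"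
      by (rule Bochner_Integration.integral_add[symmetric]) (rule qker_integrable[OF fg f], rule qker_integrable[OF g fg])
    also have "\<dots> = (\<integral>x. kker K (fst x) (snd x) * (f (fst x) * f (snd x)) - kker K (fst x) (snd x) * (g (fst x) * g (snd x)) \<partial>torus2_measure)"
      by (intro Bochner_Integration.integral_cong) (auto simp: algebra_simps)
    also have "\<dots> = qker K f - qker K g"
      unfolding qker_def by (rule Bochner_Integration.integral_diff) (rule qker_integrable[OF f f], rule qker_integrable[OF g g])
    finally show ?thesis by simp
  qed
  moreover have "\<bar>?B (\<lambda>p. f p - g p) f\<bar> \<le> 3 * ((\<integral>p. \<bar>f p - g p\<bar> \<partial>torus_measure) * (\<integral>p. \<bar>f p\<bar> \<partial>torus_measure))"
    by (rule kernel_bound[OF fg f kker_measurable]) (rule abs_kker_le)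
  moreover have "\<bar>?B g (\<lambda>p. f p - g p)\<bar> \<le> 3 * ((\<integral>p. \<bar>g p\<bar> \<partial>torus_measure) * (\<integral>p. \<bar>f p - g p\<bar> \<partial>torus_measure))"
    by (rule kernel_bound[OF g fg kker_measurable]) (rule abs_kker_le)
  ultimately show ?thesis by (simp add: algebra_simps abs_le_iff)
qed

text \<open>Put \<open>\<tau> = (1 - \<gamma>/\<gamma>')/4\<close>. Where the weight \<open>w\<close> falls short of \<open>(1 - \<tau>) eps\<close> the momentum is small. Cutting \<open>\<phi>\<close> off on this set \<open>A\<close>
  and restoring its mean value costs little, since \<open>1 / w\<close> has little mass on \<open>A\<close>; the subcritical form bound is
  then applied to the modified function.\<close>

lemma perturbed_form_positive:
  fixes K :: "real^3"
  assumes \<gamma>: "0 < \<gamma>" "\<gamma> < \<gamma>'" and sub: "\<gamma>' \<in> subcritical K"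
  obtains \<eta> where "0 < \<eta>"
    "\<And>w d R \<phi>. w \<in> borel_measurable torus_measure \<Longrightarrow> (\<And>p. p \<in> obox \<Longrightarrow> 0 < w p) \<Longrightarrow>
      (\<And>p. p \<in> obox \<Longrightarrow> eps p - \<eta> \<le> w p) \<Longrightarrow>
      (\<And>p. (\<And>i. \<bar>p $ i\<bar> \<le> 1) \<Longrightarrow> 1 / (4 * pi\<^sup>2) * (norm (p - d))\<^sup>2 \<le> w p) \<Longrightarrow>
      (\<And>p. p \<in> obox \<Longrightarrow> \<exists>i. 1 < \<bar>p $ i\<bar> \<Longrightarrow> 1 / pi\<^sup>2 \<le> w p) \<Longrightarrow>
      R \<in> borel_measurable torus2_measure \<Longrightarrow> (\<And>x. x \<in> torus \<times> torus \<Longrightarrow> \<bar>R x\<bar> \<le> \<eta>) \<Longrightarrow>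
      sq_int torus_measure \<phi> \<Longrightarrow> (\<integral>p. \<phi> p \<partial>torus_measure) = 0 \<Longrightarrow>
      integrable torus_measure (\<lambda>p. w p * (\<phi> p)\<^sup>2) \<Longrightarrow>
      (\<integral>p. w p * (\<phi> p)\<^sup>2 \<partial>torus_measure) + \<gamma> / vol * qker K \<phi>
        + (\<integral>x. R x * (\<phi> (fst x) * \<phi> (snd x)) \<partial>torus2_measure) \<le> 0 \<Longrightarrow>
      AE p in torus_measure. \<phi> p = 0"
proof -
  define \<theta> where "\<theta> = \<gamma> / \<gamma>'"
  have \<theta>: "0 < \<theta>" "\<theta> < 1" using \<gamma> by (auto simp: \<theta>_def)
  define \<tau> where "\<tau> = (1 - \<theta>) / 4"
  have \<tau>: "0 < \<tau>" "\<tau> < 1" using \<theta> by (auto simp: \<tau>_def)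
  \<comment> \<open>\<open>\<theta>\<close> equals \<open>1 - 4\<tau>\<close>. The factor
    \<open>(1 + \<tau>) / (1 - \<tau>)\<close> is the price of expanding the square of
    \<open>\<phi> + b\<close> and of replacing \<open>eps\<close> by \<open>w\<close> off
    \<open>A\<close>; a margin \<open>2\<tau>\<close> remains.\<close>
  have gap: "\<theta> * ((1 + \<tau>) / (1 - \<tau>)) \<le> 1 - 2 * \<tau>"
  proof -
    have "\<theta> = 1 - 4 * \<tau>" unfolding \<tau>_def by argo
    moreover have "(1 - 4 * t) * (1 + t) = (1 - 2 * t) * (1 - t) - 6 * (t * t)" for t :: real by (simp add: algebra_simps)
    ultimately have "\<theta> * (1 + \<tau>) = (1 - 2 * \<tau>) * (1 - \<tau>) - 6 * (\<tau> * \<tau>)" by metis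
    then have "\<theta> * (1 + \<tau>) \<le> (1 - 2 * \<tau>) * (1 - \<tau>)" by simp
    then show ?thesis using \<tau> by (simp add: pos_divide_le_eq)
  qed
  \<comment> \<open>Bounds the integral of \<open>1 / w\<close> over the torus: 2048 is 512 times 4
    from the unit cube, and outside it \<open>w\<close> is at least
    \<open>1 / pi\<^sup>2\<close>.\<close>
  define C0 where "C0 = 2048 * pi\<^sup>2 + vol * pi\<^sup>2"
  have C0: "0 < C0" using vol_pos by (simp add: C0_def add_pos_pos)
  define a where "a \<eta> = pi * sqrt (\<eta> / \<tau>)" for \<eta>
  define \<rho> where "\<rho> \<eta> = 2048 * pi\<^sup>2 * a \<eta>" for \<eta>
  \<comment> \<open>The three relative errors: restoring the mean value, changing
    \<open>qker\<close>, and the perturbation \<open>R\<close>. Here \<open>\<rho> \<eta>\<close>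
    bounds the integral of \<open>1 / w\<close> over \<open>A\<close>. As \<open>X\<close> tends to
    0 with \<open>\<eta>\<close>, one \<open>\<eta>\<close> can be chosen before \<open>w\<close>,
    \<open>d\<close>, \<open>R\<close> and \<open>\<phi>\<close> are given.\<close>
  define X where "X \<eta> = \<theta> * (1 + 1 / \<tau>) * 6 / vol * \<rho> \<eta> + 24 * \<gamma> / vol * sqrt (\<rho> \<eta> * C0) + \<eta> * C0" for \<eta>
  have "((\<lambda>\<eta>. X \<eta>) \<longlongrightarrow> X 0) (at_right 0)" unfolding X_def \<rho>_def a_def using \<tau>
    by (intro tendsto_intros) auto
  moreover have "X 0 = 0" by (simp add: X_def \<rho>_def a_def)
  ultimately have "eventually (\<lambda>\<eta>. X \<eta> < \<tau>) (at_right 0)"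
    using order_tendstoD(2)[of X 0 "at_right 0" \<tau>] \<tau> by simp
  moreover have "(a \<longlongrightarrow> a 0) (at_right 0)" unfolding a_def using \<tau> by (intro tendsto_intros) auto
  then have "eventually (\<lambda>\<eta>. a \<eta> < 1) (at_right 0)"
    using order_tendstoD(2)[of a "a 0" "at_right 0" 1] by (simp add: a_def)
  moreover have "eventually (\<lambda>\<eta>. 0 < \<eta>) (at_right (0::real))" by (rule eventually_at_right_less)
  ultimately have "eventually (\<lambda>\<eta>. X \<eta> < \<tau> \<and> a \<eta> < 1 \<and> 0 < \<eta>) (at_right 0)" by eventually_elim simp
  then obtain \<eta> where \<eta>: "X \<eta> < \<tau>" "a \<eta> < 1" "0 < \<eta>"
    using eventually_happens[of _ "at_right (0::real)"] by auto
  have a: "0 < a \<eta>" using \<eta> \<tau> by (simp add: a_def)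
  have \<rho>: "0 < \<rho> \<eta>" using a by (simp add: \<rho>_def)
  show ?thesis
  proof (rule that[OF \<eta>(3)])
    fix w \<phi> :: "real^3 \<Rightarrow> real" and d :: "real^3" and R :: "(real^3) \<times> (real^3) \<Rightarrow> real"
    assume wm [measurable]: "w \<in> borel_measurable torus_measure" and w0: "\<And>p. p \<in> obox \<Longrightarrow> 0 < w p"
      and w1: "\<And>p. p \<in> obox \<Longrightarrow> eps p - \<eta> \<le> w p"
      and w2: "\<And>p. (\<And>i. \<bar>p $ i\<bar> \<le> 1) \<Longrightarrow> 1 / (4 * pi\<^sup>2) * (norm (p - d))\<^sup>2 \<le> w p"
      and w3: "\<And>p. p \<in> obox \<Longrightarrow> \<exists>i. 1 < \<bar>p $ i\<bar> \<Longrightarrow> 1 / pi\<^sup>2 \<le> w p"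
      and R: "R \<in> borel_measurable torus2_measure" "\<And>x. x \<in> torus \<times> torus \<Longrightarrow> \<bar>R x\<bar> \<le> \<eta>"
      and \<phi>: "sq_int torus_measure \<phi>" and z: "(\<integral>p. \<phi> p \<partial>torus_measure) = 0"
      and wi: "integrable torus_measure (\<lambda>p. w p * (\<phi> p)\<^sup>2)"
      and le: "(\<integral>p. w p * (\<phi> p)\<^sup>2 \<partial>torus_measure) + \<gamma> / vol * qker K \<phi>
        + (\<integral>x. R x * (\<phi> (fst x) * \<phi> (snd x)) \<partial>torus2_measure) \<le> 0"
    have \<phi>m [measurable]: "\<phi> \<in> borel_measurable torus_measure" using sq_intD(1)[OF \<phi>] .
    have \<phi>i: "integrable torus_measure \<phi>" by (rule torus.sq_int_integrable[OF \<phi>])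
    have wpos: "AE p in torus_measure. 0 < w p" using AE_obox w0 by (auto elim: eventually_mono)
    have T [measurable]: "torus \<in> sets torus_measure" using sets.top[of torus_measure] by simp
    define W where "W = (\<integral>p. w p * (\<phi> p)\<^sup>2 \<partial>torus_measure)"
    have W: "0 \<le> W" unfolding W_def by (intro integral_nonneg_AE) (use wpos in eventually_elim, simp)
    define A where "A = {p \<in> space torus_measure. p \<in> obox \<and> w p < (1 - \<tau>) * eps p}"
    have obm: "obox \<in> sets torus_measure"
      using measure_cube(1)[of pi 0] obox_subset_torus by (simp add: cube_def obox_def)
    have Am [measurable]: "A \<in> sets torus_measure"
    proof -
      have "A = obox \<inter> {p \<in> space torus_measure. w p < (1 - \<tau>) * eps p}"
        using obox_subset_torus by (auto simp: A_def)
      then show ?thesis using obm by auto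
    qed
    \<comment> \<open>On \<open>A\<close> the assumption \<open>eps p - \<eta> \<le> w p\<close>
      forces \<open>\<tau> * eps p < \<eta>\<close>, and \<open>eps\<close> controls the square of
      each coordinate.\<close>
    have Aa: "\<bar>p $ i\<bar> \<le> a \<eta>" if p: "p \<in> A" for p i
    proof -
      have ob: "p \<in> obox" and lt: "w p < (1 - \<tau>) * eps p" using p by (auto simp: A_def)
      have "\<tau> * eps p < \<eta>" using w1[OF ob] lt by (simp add: algebra_simps)
      then have "eps p < \<eta> / \<tau>" using \<tau> by (simp add: pos_less_divide_eq mult.commute)
      moreover have "2 / pi\<^sup>2 * (p $ i)\<^sup>2 \<le> eps p"
      proof -
        have "2 / pi\<^sup>2 * (p $ i)\<^sup>2 \<le> 1 - cos (p $ i)"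
          using ob by (intro one_minus_cos_ge) (auto simp: obox_def less_imp_le)
        also have "\<dots> \<le> eps p" unfolding eps_def by (rule member_le_sum) auto
        finally show ?thesis .
      qed
      moreover have "0 < \<eta> / \<tau>" using \<eta> \<tau> by simp
      ultimately have "2 / pi\<^sup>2 * (p $ i)\<^sup>2 \<le> 2 * (\<eta> / \<tau>)" by argo
      then have "2 / pi\<^sup>2 * (p $ i)\<^sup>2 * (pi\<^sup>2 / 2) \<le> 2 * (\<eta> / \<tau>) * (pi\<^sup>2 / 2)" by (rule mult_right_mono) simp
      then have "(p $ i)\<^sup>2 \<le> pi\<^sup>2 * (\<eta> / \<tau>)" by (simp add: mult.commute)
      also have "\<dots> = (a \<eta>)\<^sup>2" using \<eta> \<tau> by (simp add: a_def power_mult_distrib)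
      finally show ?thesis using a by (metis abs_le_square_iff abs_of_pos)
    qed
    have A1: "p \<in> A \<Longrightarrow> \<bar>p $ i\<bar> \<le> 1" for p i using Aa[of p i] \<eta>(2) by linarith
    define m where "m = (\<integral>p. \<bar>\<phi> p\<bar> * indicator A p \<partial>torus_measure)"
    define n where "n = (\<integral>p. \<bar>\<phi> p\<bar> \<partial>torus_measure)"
    have m2: "m\<^sup>2 \<le> \<rho> \<eta> * W"
      unfolding m_def W_def
    proof (rule weighted_Cauchy_Schwarz[OF \<phi>m wm Am wpos wi \<phi>i])
      have "(\<integral>\<^sup>+p. ennreal (1 / w p) * indicator A p \<partial>torus_measure) \<le> ennreal (512 * a \<eta> / (1 / (4 * pi\<^sup>2)))"
        by (rule nn_integral_inverse_weight[OF wm Am a, where d = d]) (use Aa A1 w2 in auto)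
      then show "(\<integral>\<^sup>+p. ennreal (1 / w p) * indicator A p \<partial>torus_measure) \<le> ennreal (\<rho> \<eta>)"
        by (simp add: \<rho>_def mult_ac)
    qed (use \<rho> in simp)
    have n2: "n\<^sup>2 \<le> C0 * W"
    proof -
      define Q where "Q = {p \<in> space torus_measure. \<forall>i. \<bar>p $ i\<bar> \<le> 1}"
      have Qm [measurable]: "Q \<in> sets torus_measure" unfolding Q_def by measurable
      have "(\<integral>\<^sup>+p. ennreal (1 / w p) * indicator torus p \<partial>torus_measure)
        \<le> (\<integral>\<^sup>+p. ennreal (1 / w p) * indicator Q p + ennreal (pi\<^sup>2) \<partial>torus_measure)"
      proof (rule nn_integral_mono_AE)
        show "AE p in torus_measure. ennreal (1 / w p) * indicator torus p \<le> ennreal (1 / w p) * indicator Q p + ennreal (pi\<^sup>2)"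
          using AE_obox
        proof eventually_elim
          case (elim p)
          have t: "p \<in> torus" using elim obox_subset_torus by auto
          show ?case
          proof (cases "p \<in> Q")
            case False
            then have "\<exists>i. 1 < \<bar>p $ i\<bar>" using t by (auto simp: Q_def not_le)
            from w3[OF elim this] have "1 / w p \<le> 1 / (1 / pi\<^sup>2)" by (intro frac_le) auto
            then show ?thesis using False t by (simp add: ennreal_leI)
          qed (use t in simp)
        qed
      qed
      also have "\<dots> = (\<integral>\<^sup>+p. ennreal (1 / w p) * indicator Q p \<partial>torus_measure) + ennreal (pi\<^sup>2) * ennreal vol"
        by (subst nn_integral_add) (auto simp: emeasure_torus)
      also have "\<dots> \<le> ennreal (512 * 1 / (1 / (4 * pi\<^sup>2))) + ennreal (pi\<^sup>2) * ennreal vol"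
        by (intro add_mono nn_integral_inverse_weight[OF wm Qm, where d = d] order_refl) (use w2 in \<open>auto simp: Q_def\<close>)
      also have "\<dots> = ennreal C0"
        using vol_pos by (simp add: C0_def mult_ac flip: ennreal_plus ennreal_mult)
      finally have "(\<integral>p. \<bar>\<phi> p\<bar> * indicator torus p \<partial>torus_measure)\<^sup>2 \<le> C0 * (\<integral>p. w p * (\<phi> p)\<^sup>2 \<partial>torus_measure)"
        using C0 by (intro weighted_Cauchy_Schwarz[OF \<phi>m wm T wpos wi \<phi>i]) auto
      moreover have "(\<integral>p. \<bar>\<phi> p\<bar> * indicator torus p \<partial>torus_measure) = n"
        unfolding n_def by (intro Bochner_Integration.integral_cong) auto
      ultimately show ?thesis by (simp add: W_def)
    qed
    have iA: "integrable torus_measure (\<lambda>p. \<phi> p * indicator A p)" "integrable torus_measure (\<lambda>p. \<bar>\<phi> p\<bar> * indicator A p)"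
      using integrable_real_mult_indicator[OF Am \<phi>i] integrable_real_mult_indicator[OF Am integrable_abs[OF \<phi>i]] by auto
    have m0: "0 \<le> m" "0 \<le> n" "m \<le> n"
    proof -
      show "0 \<le> m" "0 \<le> n" unfolding m_def n_def by (auto intro!: integral_nonneg_AE)
      show "m \<le> n" unfolding m_def n_def using iA \<phi>i by (intro integral_mono) (auto simp: indicator_def)
    qed
    \<comment> \<open>This constant restores mean zero after the cutoff, so that the modified
      function is admissible in \<open>subcritical\<close>.\<close>
    define b where "b = (\<integral>p. \<phi> p * indicator A p \<partial>torus_measure) / vol"
    have bm: "\<bar>b\<bar> * vol \<le> m"
    proof -
      have "\<bar>\<integral>p. \<phi> p * indicator A p \<partial>torus_measure\<bar> \<le> (\<integral>p. \<bar>\<phi> p * indicator A p\<bar> \<partial>torus_measure)"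
        by (rule integral_abs_bound)
      then show ?thesis using vol_pos by (simp add: b_def m_def abs_mult)
    qed
    define \<psi> where "\<psi> p = \<phi> p - \<phi> p * indicator A p + b" for p
    have sA: "sq_int torus_measure (\<lambda>p. indicator A p * \<phi> p)"
      by (rule sq_int_mult_bounded[OF \<phi>, where C = 1]) (auto simp: indicator_def)
    have \<psi>: "sq_int torus_measure \<psi>"
    proof -
      have "sq_int torus_measure (\<lambda>_. b)" by (simp add: sq_int_def)
      from sq_int_add[OF sq_int_diff[OF \<phi> sA] this] show ?thesis by (simp add: \<psi>_def[abs_def] mult.commute)
    qed
    have \<psi>z: "(\<integral>p. \<psi> p \<partial>torus_measure) = 0"
      using vol_pos \<phi>i iA z by (simp add: \<psi>_def b_def measure_torus)
    have d1: "(\<integral>p. \<bar>\<psi> p - \<phi> p\<bar> \<partial>torus_measure) \<le> 2 * m"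
    proof -
      have "(\<integral>p. \<bar>\<psi> p - \<phi> p\<bar> \<partial>torus_measure) \<le> (\<integral>p. \<bar>\<phi> p\<bar> * indicator A p + \<bar>b\<bar> \<partial>torus_measure)"
      proof (rule integral_mono)
        show "integrable torus_measure (\<lambda>p. \<bar>\<psi> p - \<phi> p\<bar>)"
          using torus.sq_int_integrable[OF \<psi>] \<phi>i by auto
        show "integrable torus_measure (\<lambda>p. \<bar>\<phi> p\<bar> * indicator A p + \<bar>b\<bar>)" using iA by auto
      qed (auto simp: \<psi>_def indicator_def)
      also have "\<dots> = m + \<bar>b\<bar> * vol" using iA by (simp add: m_def measure_torus)
      finally show ?thesis using bm by simp
    qed
    have d2: "(\<integral>p. \<bar>\<psi> p\<bar> \<partial>torus_measure) \<le> 3 * n"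
    proof -
      have "(\<integral>p. \<bar>\<psi> p\<bar> \<partial>torus_measure) \<le> (\<integral>p. \<bar>\<psi> p - \<phi> p\<bar> + \<bar>\<phi> p\<bar> \<partial>torus_measure)"
        using torus.sq_int_integrable[OF \<psi>] \<phi>i by (intro integral_mono) auto
      also have "\<dots> = (\<integral>p. \<bar>\<psi> p - \<phi> p\<bar> \<partial>torus_measure) + n"
        using torus.sq_int_integrable[OF \<psi>] \<phi>i by (simp add: n_def)
      finally show ?thesis using d1 m0 by simp
    qed
    have mn: "m * n \<le> sqrt (\<rho> \<eta> * C0) * W"
    proof -
      have "(m * n)\<^sup>2 \<le> (\<rho> \<eta> * W) * (C0 * W)" unfolding power_mult_distrib by (intro mult_mono m2 n2) (use \<rho> W in auto)
      also have "\<dots> = (sqrt (\<rho> \<eta> * C0) * W)\<^sup>2" using \<rho> C0 by (simp add: power_mult_distrib power2_eq_square)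
      finally show ?thesis by (rule power2_le_imp_le) (use \<rho> C0 W in auto)
    qed
    have qd: "\<bar>qker K \<psi> - qker K \<phi>\<bar> \<le> 24 * (sqrt (\<rho> \<eta> * C0) * W)"
    proof -
      have "\<bar>qker K \<psi> - qker K \<phi>\<bar> \<le> 3 * ((\<integral>p. \<bar>\<psi> p - \<phi> p\<bar> \<partial>torus_measure) * ((\<integral>p. \<bar>\<psi> p\<bar> \<partial>torus_measure) + n))"
        using qker_diff_le[OF \<psi> \<phi>] by (simp add: n_def)
      also have "\<dots> \<le> 3 * ((2 * m) * (3 * n + n))"
        by (intro mult_left_mono mult_mono d1 add_mono d2) (use m0 in \<open>auto intro!: add_nonneg_nonneg integral_nonneg_AE\<close>)
      finally show ?thesis using mn by simp
    qed
    have Rb: "\<bar>\<integral>x. R x * (\<phi> (fst x) * \<phi> (snd x)) \<partial>torus2_measure\<bar> \<le> \<eta> * C0 * W"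
    proof -
      have "\<bar>\<integral>x. R x * (\<phi> (fst x) * \<phi> (snd x)) \<partial>torus2_measure\<bar> \<le> \<eta> * (n * n)"
        unfolding n_def by (rule kernel_bound[OF \<phi> \<phi> R])
      also have "\<dots> \<le> \<eta> * (C0 * W)" using n2 \<eta> by (intro mult_left_mono) (auto simp: power2_eq_square)
      finally show ?thesis by simp
    qed
    have e\<psi>: "(\<integral>p. eps p * (\<psi> p)\<^sup>2 \<partial>torus_measure) \<le> (1 + \<tau>) / (1 - \<tau>) * W + (1 + 1 / \<tau>) * 6 / vol * (\<rho> \<eta> * W)"
    proof -
      have "(\<integral>p. eps p * (\<psi> p)\<^sup>2 \<partial>torus_measure)
        \<le> (\<integral>p. (1 + \<tau>) / (1 - \<tau>) * (w p * (\<phi> p)\<^sup>2) + (1 + 1 / \<tau>) * 6 * b\<^sup>2 \<partial>torus_measure)"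
      proof (rule integral_mono_AE)
        show "integrable torus_measure (\<lambda>p. eps p * (\<psi> p)\<^sup>2)" by (rule integral_eps_sq_le(1)[OF \<psi>])
        show "integrable torus_measure (\<lambda>p. (1 + \<tau>) / (1 - \<tau>) * (w p * (\<phi> p)\<^sup>2) + (1 + 1 / \<tau>) * 6 * b\<^sup>2)"
          using wi by (intro Bochner_Integration.integrable_add integrable_mult_right) auto
        show "AE p in torus_measure. eps p * (\<psi> p)\<^sup>2 \<le> (1 + \<tau>) / (1 - \<tau>) * (w p * (\<phi> p)\<^sup>2) + (1 + 1 / \<tau>) * 6 * b\<^sup>2"
          using AE_obox
        proof eventually_elim
          case (elim p)
          have t: "p \<in> torus" using elim obox_subset_torus by auto
          have e: "0 \<le> eps p" "eps p \<le> 6" by (rule eps_nonneg, rule eps_le_6)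
          have c: "0 \<le> (1 + \<tau>) / (1 - \<tau>)" using \<tau> by simp
          have eb: "eps p * b\<^sup>2 \<le> 6 * b\<^sup>2" using e by (intro mult_right_mono) auto
          show ?case
          proof (cases "p \<in> A")
            case True
            then have "eps p * (\<psi> p)\<^sup>2 = eps p * b\<^sup>2" by (simp add: \<psi>_def)
            also have "\<dots> \<le> (1 + 1 / \<tau>) * 6 * b\<^sup>2"
            proof -
              have "1 * (6 * b\<^sup>2) \<le> (1 + 1 / \<tau>) * (6 * b\<^sup>2)" using \<tau> by (intro mult_right_mono) auto
              with eb show ?thesis unfolding mult.assoc mult_1 by (rule order_trans)
            qed
            also have "\<dots> \<le> (1 + \<tau>) / (1 - \<tau>) * (w p * (\<phi> p)\<^sup>2) + (1 + 1 / \<tau>) * 6 * b\<^sup>2"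
              using mult_nonneg_nonneg[OF c, of "w p * (\<phi> p)\<^sup>2"] w0[OF elim] by simp
            finally show ?thesis .
          next
            case False
            then have wl: "(1 - \<tau>) * eps p \<le> w p" using elim t by (auto simp: A_def not_less)
            have "(\<phi> p + b)\<^sup>2 \<le> (1 + \<tau>) * (\<phi> p)\<^sup>2 + (1 + 1 / \<tau>) * b\<^sup>2"
            proof -
              have "0 \<le> (\<tau> * \<phi> p - b)\<^sup>2 / \<tau>" using \<tau> by simp
              also have "\<dots> = \<tau> * (\<phi> p)\<^sup>2 + b\<^sup>2 / \<tau> - 2 * \<phi> p * b"
                using \<tau> by (simp add: power2_diff power_mult_distrib field_simps power2_eq_square)
              finally show ?thesis by (simp add: power2_sum algebra_simps)
            qed
            then have "eps p * (\<psi> p)\<^sup>2 \<le> eps p * ((1 + \<tau>) * (\<phi> p)\<^sup>2 + (1 + 1 / \<tau>) * b\<^sup>2)"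
              using False e by (simp add: \<psi>_def mult_left_mono)
            also have "\<dots> = (1 + \<tau>) * (eps p * (\<phi> p)\<^sup>2) + (1 + 1 / \<tau>) * (eps p * b\<^sup>2)" by (simp add: algebra_simps)
            also have "\<dots> \<le> (1 + \<tau>) * (1 / (1 - \<tau>) * (w p * (\<phi> p)\<^sup>2)) + (1 + 1 / \<tau>) * (6 * b\<^sup>2)"
            proof (intro add_mono mult_left_mono eb)
              have "eps p \<le> 1 / (1 - \<tau>) * w p" using wl \<tau> by (simp add: pos_le_divide_eq mult.commute)
              then have "eps p * (\<phi> p)\<^sup>2 \<le> 1 / (1 - \<tau>) * w p * (\<phi> p)\<^sup>2" by (rule mult_right_mono) simp
              then show "eps p * (\<phi> p)\<^sup>2 \<le> 1 / (1 - \<tau>) * (w p * (\<phi> p)\<^sup>2)" by (simp add: mult.assoc)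
            qed (use \<tau> in auto)
            finally show ?thesis by (simp only: mult.assoc times_divide_eq_left times_divide_eq_right mult_1)
          qed
        qed
      qed
      also have "\<dots> = (1 + \<tau>) / (1 - \<tau>) * W + vol * ((1 + 1 / \<tau>) * 6 * b\<^sup>2)"
        using wi unfolding W_def by (subst Bochner_Integration.integral_add) (auto simp: measure_torus)
      also have "vol * ((1 + 1 / \<tau>) * 6 * b\<^sup>2) \<le> (1 + 1 / \<tau>) * 6 / vol * (\<rho> \<eta> * W)"
      proof -
        have "(\<bar>b\<bar> * vol)\<^sup>2 \<le> m\<^sup>2" using bm vol_pos by (intro power_mono) auto
        then have "b\<^sup>2 * vol\<^sup>2 \<le> \<rho> \<eta> * W" using m2 by (simp add: power_mult_distrib)
        then have "(1 + 1 / \<tau>) * 6 / vol * (b\<^sup>2 * vol\<^sup>2) \<le> (1 + 1 / \<tau>) * 6 / vol * (\<rho> \<eta> * W)"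
          using \<tau> vol_pos by (intro mult_left_mono) auto
        moreover have "(1 + 1 / \<tau>) * 6 / vol * (b\<^sup>2 * vol\<^sup>2) = vol * ((1 + 1 / \<tau>) * 6 * b\<^sup>2)"
          using vol_pos by (simp add: power2_eq_square)
        ultimately show ?thesis by simp
      qed
      finally show ?thesis by simp
    qed
    \<comment> \<open>Multiplication by \<open>\<theta> = \<gamma> / \<gamma>'\<close> turns the
      coupling into \<open>\<gamma>\<close> but keeps only the fraction \<open>\<theta>\<close> of
      the \<open>eps\<close> term; this spare fraction absorbs all errors.\<close>
    have "0 \<le> qform \<gamma>' K \<psi>" using sub \<psi> \<psi>z by (auto simp: subcritical_def)
    then have "0 \<le> \<theta> * qform \<gamma>' K \<psi>" using \<theta> by simp
    also have "\<theta> * qform \<gamma>' K \<psi> = \<theta> * (\<integral>p. eps p * (\<psi> p)\<^sup>2 \<partial>torus_measure) + \<gamma> / vol * qker K \<psi>"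
      using \<gamma> by (simp add: qform_def \<theta>_def distrib_left)
    finally have q1: "- (\<theta> * (\<integral>p. eps p * (\<psi> p)\<^sup>2 \<partial>torus_measure)) \<le> \<gamma> / vol * qker K \<psi>" by simp
    have q2: "\<gamma> / vol * qker K \<psi> - \<gamma> / vol * qker K \<phi> \<le> 24 * \<gamma> / vol * sqrt (\<rho> \<eta> * C0) * W"
    proof -
      have "\<gamma> / vol * (qker K \<psi> - qker K \<phi>) \<le> \<gamma> / vol * (24 * (sqrt (\<rho> \<eta> * C0) * W))"
        using qd \<gamma> vol_pos by (intro mult_left_mono) (auto simp: abs_le_iff)
      then show ?thesis by (simp add: right_diff_distrib mult_ac)
    qed
    have q3: "\<theta> * (\<integral>p. eps p * (\<psi> p)\<^sup>2 \<partial>torus_measure) \<le> (1 - 2 * \<tau>) * W + \<theta> * (1 + 1 / \<tau>) * 6 / vol * \<rho> \<eta> * W"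
    proof -
      have "\<theta> * (\<integral>p. eps p * (\<psi> p)\<^sup>2 \<partial>torus_measure) \<le> \<theta> * ((1 + \<tau>) / (1 - \<tau>) * W + (1 + 1 / \<tau>) * 6 / vol * (\<rho> \<eta> * W))"
        using e\<psi> \<theta> by (intro mult_left_mono) auto
      also have "\<dots> = \<theta> * ((1 + \<tau>) / (1 - \<tau>)) * W + \<theta> * (1 + 1 / \<tau>) * 6 / vol * \<rho> \<eta> * W"
        by (subst distrib_left) (simp only: mult.assoc times_divide_eq_right times_divide_eq_left)
      also have "\<dots> \<le> (1 - 2 * \<tau>) * W + \<theta> * (1 + 1 / \<tau>) * 6 / vol * \<rho> \<eta> * W"
        using gap W by (intro add_right_mono mult_right_mono)
      finally show ?thesis .
    qed
    have "X \<eta> * W = \<theta> * (1 + 1 / \<tau>) * 6 / vol * \<rho> \<eta> * W + 24 * \<gamma> / vol * sqrt (\<rho> \<eta> * C0) * W + \<eta> * C0 * W"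
      by (simp add: X_def distrib_right)
    moreover have "X \<eta> * W \<le> \<tau> * W" using \<eta>(1) W by (intro mult_right_mono) auto
    moreover have "W + \<gamma> / vol * qker K \<phi> + (\<integral>x. R x * (\<phi> (fst x) * \<phi> (snd x)) \<partial>torus2_measure) \<le> 0"
      using le by (simp add: W_def)
    moreover have "(1 - 2 * \<tau>) * W = W - 2 * (\<tau> * W)" by (simp add: algebra_simps)
    ultimately have "\<tau> * W \<le> 0" using q1 q2 q3 Rb unfolding abs_le_iff by linarith
    then have "W = 0" using \<tau> W by (simp add: mult_le_0_iff)
    moreover have "AE p in torus_measure. 0 \<le> w p * (\<phi> p)\<^sup>2" by (use wpos in eventually_elim, simp)
    ultimately have "AE p in torus_measure. w p * (\<phi> p)\<^sup>2 = 0"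
      using integral_nonneg_eq_0_iff_AE[OF wi] by (simp add: W_def)
    then show "AE p in torus_measure. \<phi> p = 0" using wpos by eventually_elim auto
  qed
qed

section \<open>Absence of eigenvalues\<close>

text \<open>Integrability of \<open>1 / eps\<close> bounds the squared \<open>L^1\<close> norm by
  \<open>C0\<close> times the \<open>eps\<close> form, and \<open>qker\<close> by three times that
  squared norm. The value \<open>vol / (3 * C0)\<close> balances the two terms of
  \<open>qform\<close> and makes the critical value positive.\<close>

lemma small_mass_ratio_subcritical: "\<exists>\<gamma>>0. \<gamma> \<in> subcritical K"
proof -
  define C0 where "C0 = 512 * pi / (2 / pi\<^sup>2)"
  have C0: "0 < C0" by (simp add: C0_def)
  define \<gamma> where "\<gamma> = vol / (3 * C0)"
  have \<gamma>: "0 < \<gamma>" using C0 vol_pos by (simp add: \<gamma>_def)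
  have e: "2 / pi\<^sup>2 * (norm (p - 0))\<^sup>2 \<le> eps p" if "p \<in> torus" for p
    using that by (simp only: diff_0_right, intro eps_ge_norm) (auto simp: torus_def abs_le_iff less_imp_le minus_le_iff)
  have epos: "AE p in torus_measure. 0 < eps p"
    using AE_torus_not_eq[of 0] AE_space
  proof eventually_elim
    case (elim p)
    then have "0 < 2 / pi\<^sup>2 * (norm (p - 0))\<^sup>2" by simp
    also have "\<dots> \<le> eps p" using elim by (intro e) auto
    finally show ?case .
  qed
  have T: "torus \<in> sets torus_measure" using sets.top[of torus_measure] by simp
  have "0 \<le> qform \<gamma> K \<phi>" if \<phi>: "sq_int torus_measure \<phi>" for \<phi>
  proof -
    define n where "n = (\<integral>p. \<bar>\<phi> p\<bar> \<partial>torus_measure)"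
    define W where "W = (\<integral>p. eps p * (\<phi> p)\<^sup>2 \<partial>torus_measure)"
    have r: "(\<integral>\<^sup>+p. ennreal (1 / eps p) * indicator torus p \<partial>torus_measure) \<le> ennreal C0"
      unfolding C0_def
      by (rule nn_integral_inverse_weight[OF _ T, where d = 0])
        (use e in \<open>auto simp: torus_def abs_le_iff less_imp_le minus_le_iff\<close>)
    have "(\<integral>p. \<bar>\<phi> p\<bar> * indicator torus p \<partial>torus_measure)\<^sup>2 \<le> C0 * W"
      unfolding W_def using C0
      by (intro weighted_Cauchy_Schwarz[OF sq_intD(1)[OF \<phi>] _ T epos integral_eps_sq_le(1)[OF \<phi>] torus.sq_int_integrable[OF \<phi>] r]) auto
    moreover have "(\<integral>p. \<bar>\<phi> p\<bar> * indicator torus p \<partial>torus_measure) = n"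
      unfolding n_def by (intro Bochner_Integration.integral_cong) auto
    ultimately have n: "n * n \<le> C0 * W" by (simp add: power2_eq_square)
    have "\<bar>qker K \<phi>\<bar> \<le> 3 * (n * n)"
      unfolding qker_def n_def by (rule kernel_bound[OF \<phi> \<phi> kker_measurable]) (rule abs_kker_le)
    then have "- (3 * (C0 * W)) \<le> qker K \<phi>" using n by linarith
    then have "\<gamma> / vol * - (3 * (C0 * W)) \<le> \<gamma> / vol * qker K \<phi>" using \<gamma> vol_pos by (intro mult_left_mono) auto
    moreover have "\<gamma> / vol * - (3 * (C0 * W)) = - W" using C0 vol_pos by (simp add: \<gamma>_def)
    ultimately show ?thesis by (simp add: qform_def W_def)
  qed
  then show ?thesis using \<gamma> by (auto simp: subcritical_def intro!: exI[of _ \<gamma>])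
qed

lemma inverse_E_kernel:
  assumes \<gamma>: "0 \<le> \<gamma>" and z: "z < 0"
  shows "(\<lambda>x. 1 / (E_disp \<gamma> K (fst x) (snd x) - z)) \<in> borel_measurable torus2_measure"
    "\<bar>1 / (E_disp \<gamma> K p q - z)\<bar> \<le> 1 / (- z)"
proof -
  have *: "(\<lambda>x. E_disp \<gamma> K (fst x) (snd x)) \<in> borel_measurable torus2_measure" by (rule E_disp_measurable)
  show "(\<lambda>x. 1 / (E_disp \<gamma> K (fst x) (snd x) - z)) \<in> borel_measurable torus2_measure"
    by (intro borel_measurable_divide borel_measurable_diff * borel_measurable_const)
  show "\<bar>1 / (E_disp \<gamma> K p q - z)\<bar> \<le> 1 / (- z)"
    using inverse_E_bounds(2,3)[OF assms, of K p q] by (simp only: abs_of_pos)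
qed

lemma Lam_measurable:
  assumes "0 \<le> \<gamma>" "z < 0"
  shows "(\<lambda>q. Lam \<gamma> \<mu> K z q) \<in> borel_measurable torus_measure"
  by (rule continuous_imp_torus_measurable) (rule continuous_on_Lam[OF assms])

lemma eigenvector_ge:
  assumes \<gamma>: "0 \<le> \<gamma>" and \<mu>: "0 \<le> \<mu>" and v: "Hop \<gamma> \<mu> K v = e *\<^sub>R v" "v \<noteq> 0"
  shows "- \<mu> \<le> e"
proof -
  have "v \<bullet> Pop v = (norm (Pop v))\<^sup>2"
    using Pop_inner_Pop[of v v] by (simp add: power2_norm_eq_inner inner_commute)
  also have "\<dots> \<le> (norm v)\<^sup>2" using norm_Pop_le by (intro power_mono) auto
  finally have "- \<mu> * (norm v)\<^sup>2 \<le> - \<mu> * (v \<bullet> Pop v)" using \<mu> by (simp add: mult_left_mono)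
  also have "\<dots> \<le> v \<bullet> Hop \<gamma> \<mu> K v" using Emul_nonneg[OF \<gamma>, of v K] by (simp add: Hop_def inner_diff_right)
  also have "\<dots> = e * (norm v)\<^sup>2" by (simp add: v power2_norm_eq_inner)
  finally show ?thesis by (rule mult_right_le_imp_le) (use v(2) in simp)
qed

text \<open>A Birman-Schwinger reduction. The eigenvector is \<open>\<mu> * pfun u\<close> divided
  by \<open>E - e\<close>, so it is determined by \<open>a = asec u\<close>. Integrating this over
  the first variable gives an equation for \<open>a\<close> alone, and pairing it with
  \<open>\<mu> * a\<close> gives the quadratic identity.\<close>

lemma eigenvector_section:
  assumes \<gamma>: "0 \<le> \<gamma>" and e: "e < 0" and u: "asq u"
    and v: "Hop \<gamma> \<mu> K (abs_hilb u) = e *\<^sub>R abs_hilb u"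
  defines "a \<equiv> asec u"
  shows "AE p in torus_measure. a p = 0 \<Longrightarrow> abs_hilb u = 0"
    and "(\<integral>q. \<mu> * Lam \<gamma> \<mu> K e q * (a q)\<^sup>2 \<partial>torus_measure)
      + \<mu>\<^sup>2 / vol * (\<integral>x. 1 / (E_disp \<gamma> K (fst x) (snd x) - e) * (a (fst x) * a (snd x)) \<partial>torus2_measure) = 0"
proof -
  have a: "sq_int torus_measure a" unfolding a_def by (rule sq_int_asec[OF asqD(1)[OF u]])
  have ai: "integrable torus_measure a" by (rule torus.sq_int_integrable[OF a])
  define R where "R p q = 1 / (E_disp \<gamma> K p q - e)" for p q
  have Rp: "0 < R p q" "\<bar>R p q\<bar> \<le> 1 / (- e)" for p q
    using inverse_E_bounds(3)[OF \<gamma> e] inverse_E_kernel(2)[OF \<gamma> e] by (simp_all only: R_def)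
  have Rm: "(\<lambda>x. R (fst x) (snd x)) \<in> borel_measurable torus2_measure"
    unfolding R_def by (rule inverse_E_kernel(1)[OF \<gamma> e])
  define g where "g x = R (fst x) (snd x) * (\<mu> * pfun u x)" for x
  have pf: "sq_int torus2_measure (\<lambda>x. \<mu> * pfun u x)" by (intro sq_int_cmult asqD(1) asq_pfun u)
  have g: "sq_int torus2_measure g"
    unfolding g_def[abs_def] by (rule sq_int_mult_bounded[OF pf Rm, where C = "1 / (- e)"]) (use Rp(2) in auto)
  have "AE x in torus2_measure. hfun \<gamma> \<mu> K u x = e * u x"
    using v hfun_hilb[OF u, of \<gamma> \<mu> K] u by (simp add: abs_hilb_scaleR abs_hilb_eq_iff asq_cmult)
  then have ug: "AE x in torus2_measure. u x = g x"
  proof eventually_elim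
    case (elim x)
    have "E_disp \<gamma> K (fst x) (snd x) - e > 0" by (rule E_minus_pos[OF \<gamma> e])
    moreover have "(E_disp \<gamma> K (fst x) (snd x) - e) * u x = \<mu> * pfun u x" using elim by (simp add: hfun_def algebra_simps)
    ultimately show ?case by (simp add: g_def R_def nonzero_eq_divide_eq mult.commute)
  qed
  show "abs_hilb u = 0" if "AE p in torus_measure. a p = 0"
  proof -
    have "AE x in torus2_measure. u x = 0"
      using ug AE_torus2_fst[OF that] AE_torus2_snd[OF that]
      by eventually_elim (simp add: g_def pfun_def anti_def a_def)
    then show ?thesis using u by (simp add: abs_hilb_zero abs_hilb_eq_iff asq_zero)
  qed
  have Ri: "integrable torus_measure (\<lambda>p. R p q)" for q
    unfolding R_def by (rule inverse_E_integrable[OF \<gamma> e])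
  have Ra: "integrable torus_measure (\<lambda>p. R p q * a p)" for q
  proof (rule torus.sq_int_integrable, rule sq_int_mult_bounded[OF a])
    show "(\<lambda>p. R p q) \<in> borel_measurable torus_measure" using Ri by (rule borel_measurable_integrable)
    show "AE p in torus_measure. \<bar>R p q\<bar> \<le> 1 / (- e)" using Rp(2) by simp
  qed
  have "AE q in torus_measure. a q = asec g q"
    unfolding a_def by (rule asec_cong[OF asqD(1)[OF u] g ug])
  then have eq: "AE q in torus_measure. \<mu> * Lam \<gamma> \<mu> K e q * (a q)\<^sup>2 = - (\<mu>\<^sup>2 / vol) * (\<integral>p. R p q * (a p * a q) \<partial>torus_measure)"
  proof eventually_elim
    case (elim q)
    have "asec g q = (\<integral>p. \<mu> / vol * (R p q * a q - R p q * a p) \<partial>torus_measure)"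
      unfolding asec_def g_def pfun_def anti_def a_def by (intro Bochner_Integration.integral_cong) (auto simp: algebra_simps)
    also have "\<dots> = \<mu> / vol * (Jint \<gamma> K e q * a q - (\<integral>p. R p q * a p \<partial>torus_measure))"
      unfolding integral_mult_right_zero Jint_def R_def[symmetric] using Ri Ra by simp
    finally have 1: "a q = \<mu> / vol * (Jint \<gamma> K e q * a q - (\<integral>p. R p q * a p \<partial>torus_measure))" using elim by simp
    define I where "I = (\<integral>p. R p q * a p \<partial>torus_measure)"
    have 2: "Lam \<gamma> \<mu> K e q * a q = - (\<mu> / vol) * I"
      using 1 unfolding I_def[symmetric] by (simp add: Lam_def algebra_simps)
    have 3: "(\<integral>p. R p q * (a p * a q) \<partial>torus_measure) = I * a q"
      by (simp add: I_def flip: mult.assoc)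
    have "\<mu> * Lam \<gamma> \<mu> K e q * (a q)\<^sup>2 = \<mu> * a q * (Lam \<gamma> \<mu> K e q * a q)" by (simp add: power2_eq_square)
    also have "\<dots> = - (\<mu>\<^sup>2 / vol) * (I * a q)" unfolding 2 by (simp add: power2_eq_square)
    finally show ?case by (simp only: 3)
  qed
  have Raa: "integrable torus2_measure (\<lambda>x. R (fst x) (snd x) * (a (fst x) * a (snd x)))"
    by (rule torus2_integrable_kernel[OF a a Rm]) (rule Rp(2))
  have m: "(\<lambda>q. \<mu> * Lam \<gamma> \<mu> K e q * (a q)\<^sup>2) \<in> borel_measurable torus_measure"
    using Lam_measurable[OF \<gamma> e, of \<mu> K] sq_intD(1)[OF a] by measurable
  have "(\<integral>q. \<mu> * Lam \<gamma> \<mu> K e q * (a q)\<^sup>2 \<partial>torus_measure) = (\<integral>q. - (\<mu>\<^sup>2 / vol) * (\<integral>p. R p q * (a p * a q) \<partial>torus_measure) \<partial>torus_measure)"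
    by (rule integral_cong_AE[OF m _ eq])
      (use borel_measurable_integrable[OF torus2_sections(4)[OF Raa]] in simp)
  also have "\<dots> = - (\<mu>\<^sup>2 / vol) * (\<integral>x. R (fst x) (snd x) * (a (fst x) * a (snd x)) \<partial>torus2_measure)"
    unfolding integral_mult_right_zero torus2_Fubini(2)[OF Raa] by simp
  finally show "(\<integral>q. \<mu> * Lam \<gamma> \<mu> K e q * (a q)\<^sup>2 \<partial>torus_measure)
      + \<mu>\<^sup>2 / vol * (\<integral>x. 1 / (E_disp \<gamma> K (fst x) (snd x) - e) * (a (fst x) * a (snd x)) \<partial>torus2_measure) = 0"
    by (simp add: R_def)
qed

context strong_coupling
begin

text \<open>Collects the second-order remainder of \<open>1 / (E - z)\<close> expanded in
  \<open>E\<close>, and the effect of replacing the prefactor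
  \<open>\<mu>\<^sup>2 / z\<^sup>2\<close> of the \<open>kker\<close> term by 1.\<close>

definition Rem :: "(real^3) \<times> (real^3) \<Rightarrow> real" where
  "Rem x = (\<mu>\<^sup>2 * (E_disp \<gamma> K (fst x) (snd x))\<^sup>2 / (z\<^sup>2 * D (fst x) (snd x)) + (\<mu>\<^sup>2 / z\<^sup>2 - 1) * \<gamma> * kker K (fst x) (snd x)) / vol"

definition C4 :: real where "C4 = (8 * C\<^sup>2 + 36 * C * \<gamma>) / vol"

lemma Rem_measurable: "Rem \<in> borel_measurable torus2_measure"
  unfolding Rem_def[abs_def] D_def by measurable

lemma z_near: "\<bar>- z - \<mu>\<bar> \<le> C"
  using z C_pos by (simp add: abs_le_iff)

lemma Rem_le: "\<bar>Rem x\<bar> \<le> C4 / \<mu>"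
proof -
  define E where "E = E_disp \<gamma> K (fst x) (snd x)"
  define D1 where "D1 = D (fst x) (snd x)"
  have E: "0 \<le> E" "E \<le> C" using E_disp_bounds[OF \<gamma>] by (simp_all add: E_def C_eq)
  have D1: "0 < D1" "\<bar>D1 - \<mu>\<bar> \<le> C" using D_pos D_near by (simp_all add: D1_def)
  have "\<mu>\<^sup>2 * E\<^sup>2 / (z\<^sup>2 * D1) = \<mu>\<^sup>2 / (- z * D1) * (1 / (- z)) * E\<^sup>2" by (simp add: power2_eq_square)
  also have "\<dots> \<le> 4 * (2 / \<mu>) * C\<^sup>2"
  proof (intro mult_mono)
    show "\<mu>\<^sup>2 / (- z * D1) \<le> 4" by (rule product_near_square(2)[OF z_near D1(2) \<mu> \<mu>_pos])
    have "1 / (- z) \<le> 1 / (\<mu> / 2)"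
      using product_near_square(1)[OF z_near z_near \<mu> \<mu>_pos] \<mu>_pos by (intro frac_le) auto
    then show "1 / (- z) \<le> 2 / \<mu>" by simp
    show "E\<^sup>2 \<le> C\<^sup>2" using E by (intro power_mono)
  qed (use z_neg D1 \<mu>_pos in \<open>auto simp: divide_nonneg_neg mult_nonpos_nonneg divide_nonpos_neg\<close>)
  finally have 1: "\<mu>\<^sup>2 * E\<^sup>2 / (z\<^sup>2 * D1) \<le> 8 * C\<^sup>2 / \<mu>" by simp
  have 0: "0 \<le> \<mu>\<^sup>2 * E\<^sup>2 / (z\<^sup>2 * D1)" using D1 by simp
  have "\<bar>\<mu>\<^sup>2 / z\<^sup>2 - 1\<bar> \<le> 12 * C / \<mu>"
    using product_near_square(3)[OF z_near z_near \<mu> \<mu>_pos] by (simp add: power2_eq_square)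
  then have "\<bar>(\<mu>\<^sup>2 / z\<^sup>2 - 1) * \<gamma> * kker K (fst x) (snd x)\<bar> \<le> 12 * C / \<mu> * \<gamma> * 3"
    unfolding abs_mult using \<gamma> abs_kker_le C_pos \<mu>_pos by (intro mult_mono) auto
  then have "\<bar>\<mu>\<^sup>2 * E\<^sup>2 / (z\<^sup>2 * D1) + (\<mu>\<^sup>2 / z\<^sup>2 - 1) * \<gamma> * kker K (fst x) (snd x)\<bar> \<le> 8 * C\<^sup>2 / \<mu> + 12 * C / \<mu> * \<gamma> * 3"
    using 0 1 by linarith
  also have "\<dots> = (8 * C\<^sup>2 + 36 * C * \<gamma>) / \<mu>" by (simp add: add_divide_distrib)
  finally have "\<bar>\<mu>\<^sup>2 * E\<^sup>2 / (z\<^sup>2 * D1) + (\<mu>\<^sup>2 / z\<^sup>2 - 1) * \<gamma> * kker K (fst x) (snd x)\<bar> / vol \<le> (8 * C\<^sup>2 + 36 * C * \<gamma>) / \<mu> / vol"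
    using vol_pos by (intro divide_right_mono) auto
  then show ?thesis using vol_pos by (simp add: Rem_def C4_def E_def D1_def abs_divide mult.commute)
qed

lemma kernel_expansion:
  "\<mu>\<^sup>2 / vol * (1 / D p q) = (\<mu>\<^sup>2 / vol / (- z)) - (\<mu>\<^sup>2 / vol / z\<^sup>2) * E_disp \<gamma> K p q
    + Rem (p, q) - (\<mu>\<^sup>2 / z\<^sup>2 - 1) * \<gamma> / vol * kker K p q"
proof -
  define E where "E = E_disp \<gamma> K p q"
  have D: "D p q = E - z" "0 < D p q" using D_pos by (auto simp: D_def E_def)
  have "1 / (E - z) = 1 / (- z) - E / z\<^sup>2 + E\<^sup>2 / (z\<^sup>2 * (E - z))"
    using D z_neg by (simp add: field_simps power2_eq_square)
  then have "\<mu>\<^sup>2 / vol * (1 / (E - z)) = \<mu>\<^sup>2 / vol * (1 / (- z) - E / z\<^sup>2 + E\<^sup>2 / (z\<^sup>2 * (E - z)))" by (simp only:)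
  also have "\<dots> = (\<mu>\<^sup>2 / vol / (- z)) - (\<mu>\<^sup>2 / vol / z\<^sup>2) * E + \<mu>\<^sup>2 * E\<^sup>2 / (z\<^sup>2 * (E - z)) / vol"
  proof -
    have "m / vol * (1 / (- z) - E / z\<^sup>2 + F) = m / vol / (- z) - m / vol / z\<^sup>2 * E + m * F / vol" for m F
      by (simp add: algebra_simps)
    then show ?thesis by (simp only: times_divide_eq_right)
  qed
  finally have 1: "\<mu>\<^sup>2 / vol * (1 / (E - z)) = (\<mu>\<^sup>2 / vol / (- z)) - (\<mu>\<^sup>2 / vol / z\<^sup>2) * E + \<mu>\<^sup>2 * E\<^sup>2 / (z\<^sup>2 * (E - z)) / vol" .
  have 2: "Rem (p, q) = \<mu>\<^sup>2 * E\<^sup>2 / (z\<^sup>2 * (E - z)) / vol + (\<mu>\<^sup>2 / z\<^sup>2 - 1) * \<gamma> / vol * kker K p q"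
    unfolding Rem_def D E_def[symmetric] fst_conv snd_conv add_divide_distrib times_divide_eq_left ..
  show ?thesis unfolding D E_def[symmetric] 1 2 by argo
qed

text \<open>Against functions of mean zero the constant term of \<open>kernel_expansion\<close>
  vanishes, and of the term linear in \<open>E\<close> only the \<open>kker\<close> part survives.
  This is where \<open>qker\<close> emerges with coefficient \<open>\<gamma> / vol\<close>.\<close>

lemma inverse_D_form:
  assumes \<phi>: "sq_int torus_measure \<phi>" and m: "(\<integral>p. \<phi> p \<partial>torus_measure) = 0"
  shows "\<mu>\<^sup>2 / vol * (\<integral>x. 1 / D (fst x) (snd x) * (\<phi> (fst x) * \<phi> (snd x)) \<partial>torus2_measure)
    = \<gamma> / vol * qker K \<phi> + (\<integral>x. Rem x * (\<phi> (fst x) * \<phi> (snd x)) \<partial>torus2_measure)"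
proof -
  let ?f = "\<lambda>x :: (real^3) \<times> (real^3). \<phi> (fst x) * \<phi> (snd x)"
  define c1 where "c1 = \<mu>\<^sup>2 / vol / (- z)"
  define c2 where "c2 = \<mu>\<^sup>2 / vol / z\<^sup>2"
  define c3 where "c3 = (\<mu>\<^sup>2 / z\<^sup>2 - 1) * \<gamma> / vol"
  have i1: "integrable torus2_measure (\<lambda>x. c1 * ?f x)" using torus2_integrable_prod[OF \<phi> \<phi>] by simp
  have i2: "integrable torus2_measure (\<lambda>x. c2 * (E_disp \<gamma> K (fst x) (snd x) * ?f x))"
    by (intro integrable_mult_right torus2_integrable_kernel[OF \<phi> \<phi> E_disp_measurable, where C = C])
      (use E_disp_bounds[OF \<gamma>] in \<open>auto simp: C_eq\<close>)
  have i3: "integrable torus2_measure (\<lambda>x. Rem x * ?f x)"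
    by (rule torus2_integrable_kernel[OF \<phi> \<phi> Rem_measurable Rem_le])
  have i4: "integrable torus2_measure (\<lambda>x. c3 * (kker K (fst x) (snd x) * ?f x))"
    by (intro integrable_mult_right qker_integrable \<phi>)
  have "\<mu>\<^sup>2 / vol * (\<integral>x. 1 / D (fst x) (snd x) * ?f x \<partial>torus2_measure)
    = (\<integral>x. \<mu>\<^sup>2 / vol * (1 / D (fst x) (snd x)) * ?f x \<partial>torus2_measure)"
    unfolding mult.assoc[of "\<mu>\<^sup>2 / vol"] integral_mult_right_zero ..
  also have "\<dots> = (\<integral>x. c1 * ?f x - c2 * (E_disp \<gamma> K (fst x) (snd x) * ?f x) + Rem x * ?f x
      - c3 * (kker K (fst x) (snd x) * ?f x) \<partial>torus2_measure)"
    unfolding kernel_expansion c1_def[symmetric] c2_def[symmetric] c3_def[symmetric]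
    by (intro Bochner_Integration.integral_cong) (auto simp: algebra_simps)
  also have "\<dots> = (\<integral>x. c1 * ?f x \<partial>torus2_measure) - (\<integral>x. c2 * (E_disp \<gamma> K (fst x) (snd x) * ?f x) \<partial>torus2_measure)
    + (\<integral>x. Rem x * ?f x \<partial>torus2_measure) - (\<integral>x. c3 * (kker K (fst x) (snd x) * ?f x) \<partial>torus2_measure)"
    by (simp only: Bochner_Integration.integral_diff Bochner_Integration.integral_add
        Bochner_Integration.integrable_diff Bochner_Integration.integrable_add i1 i2 i3 i4)
  also have "(\<integral>x. c1 * ?f x \<partial>torus2_measure) = 0" using torus2_integral_prod[OF \<phi> \<phi>] m by simp
  also have "(\<integral>x. c2 * (E_disp \<gamma> K (fst x) (snd x) * ?f x) \<partial>torus2_measure) = c2 * (- \<gamma> * qker K \<phi>)"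
    unfolding integral_mult_right_zero E_disp_product_form[OF \<phi> m] ..
  also have "(\<integral>x. c3 * (kker K (fst x) (snd x) * ?f x) \<partial>torus2_measure) = c3 * qker K \<phi>"
    unfolding integral_mult_right_zero qker_def ..
  also have "0 - c2 * (- \<gamma> * qker K \<phi>) + (\<integral>x. Rem x * ?f x \<partial>torus2_measure) - c3 * qker K \<phi>
    = (c2 * \<gamma> - c3) * qker K \<phi> + (\<integral>x. Rem x * ?f x \<partial>torus2_measure)"
    by (simp add: algebra_simps)
  also have "c2 * \<gamma> - c3 = \<gamma> / vol"
    by (simp add: c2_def c3_def left_diff_distrib diff_divide_distrib)
  finally show ?thesis .
qed

end


lemma no_eigenvalue_if_subcritical:
  assumes \<gamma>: "0 < \<gamma>" "\<gamma> < \<gamma>'" and sub: "\<gamma>' \<in> subcritical K"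
  shows "\<exists>\<mu>0>0. \<forall>\<mu>>\<mu>0. eigenvalues_below_ess torus2_measure L2a (H_op \<gamma> \<mu> K) = {}"
proof -
  obtain \<eta> where \<eta>: "0 < \<eta>" and pos:
    "\<And>w d R \<phi>. w \<in> borel_measurable torus_measure \<Longrightarrow> (\<And>p. p \<in> obox \<Longrightarrow> 0 < w p) \<Longrightarrow>
      (\<And>p. p \<in> obox \<Longrightarrow> eps p - \<eta> \<le> w p) \<Longrightarrow>
      (\<And>p. (\<And>i. \<bar>p $ i\<bar> \<le> 1) \<Longrightarrow> 1 / (4 * pi\<^sup>2) * (norm (p - d))\<^sup>2 \<le> w p) \<Longrightarrow>
      (\<And>p. p \<in> obox \<Longrightarrow> \<exists>i. 1 < \<bar>p $ i\<bar> \<Longrightarrow> 1 / pi\<^sup>2 \<le> w p) \<Longrightarrow>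
      R \<in> borel_measurable torus2_measure \<Longrightarrow> (\<And>x. x \<in> torus \<times> torus \<Longrightarrow> \<bar>R x\<bar> \<le> \<eta>) \<Longrightarrow>
      sq_int torus_measure \<phi> \<Longrightarrow> (\<integral>p. \<phi> p \<partial>torus_measure) = 0 \<Longrightarrow>
      integrable torus_measure (\<lambda>p. w p * (\<phi> p)\<^sup>2) \<Longrightarrow>
      (\<integral>p. w p * (\<phi> p)\<^sup>2 \<partial>torus_measure) + \<gamma> / vol * qker K \<phi>
        + (\<integral>x. R x * (\<phi> (fst x) * \<phi> (snd x)) \<partial>torus2_measure) \<le> 0 \<Longrightarrow>
      AE p in torus_measure. \<phi> p = 0"
    by (rule perturbed_form_positive[OF \<gamma> sub]) blast
  define C where "C = 12 + 6 * \<gamma>"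
  have C: "12 < C" using \<gamma> by (simp add: C_def)
  define k3 where "k3 = 2 * (24 * C * (1 + \<gamma>) + 192 * (1 + \<gamma>\<^sup>2))"
  define k4 where "k4 = (8 * C\<^sup>2 + 36 * C * \<gamma>) / vol / \<eta>"
  have k: "0 \<le> k3" "0 \<le> k4" using C \<gamma> \<eta> vol_pos by (simp_all add: k3_def k4_def)
  \<comment> \<open>One summand per requirement: the window of \<open>strong_coupling\<close>, an
    error of \<open>w\<close> below \<open>\<eta>\<close>, the same error below
    \<open>1 / pi\<^sup>2\<close>, the quadratic lower bound, and \<open>Rem\<close> below
    \<open>\<eta>\<close>.\<close>
  define \<mu>0 where "\<mu>0 = 2 * C + 12 * C\<^sup>2 / \<eta> + 12 * C\<^sup>2 * pi\<^sup>2 + k3 + k4"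
  have nn: "0 \<le> 12 * C\<^sup>2 / \<eta>" "0 \<le> 12 * C\<^sup>2 * pi\<^sup>2" using \<eta> by simp_all
  have "eigenvalues_below_ess torus2_measure L2a (H_op \<gamma> \<mu> K) = {}" if \<mu>: "\<mu>0 < \<mu>" for \<mu>
  proof (rule ccontr)
    have \<gamma>0: "0 \<le> \<gamma>" using \<gamma> by simp
    have m: "2 * C \<le> \<mu>" "12 * C\<^sup>2 / \<eta> \<le> \<mu>" "12 * C\<^sup>2 * pi\<^sup>2 \<le> \<mu>" "k3 \<le> \<mu>" "k4 \<le> \<mu>"
      using \<mu> nn k C unfolding \<mu>0_def by linarith+
    have \<mu>p: "0 < \<mu>" using m(1) C by simp
    have err\<eta>: "12 * C\<^sup>2 / \<mu> \<le> \<eta>" using m(2) \<mu>p \<eta> by (simp add: pos_divide_le_eq mult.commute)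
    have errpi: "12 * C\<^sup>2 / \<mu> \<le> 1 / pi\<^sup>2" using m(3) \<mu>p by (simp add: pos_divide_le_eq pos_le_divide_eq)
    have eps0: "eps 0 = 0" by (simp add: eps_def)
    have out: "2 / pi\<^sup>2 \<le> eps p" if p: "p \<in> obox" "1 \<le> \<bar>p $ i\<bar>" for p i
    proof -
      have "2 / pi\<^sup>2 * 1 \<le> 2 / pi\<^sup>2 * (p $ i)\<^sup>2"
        using power_mono[OF p(2), of 2] by (intro mult_left_mono) auto
      also have "\<dots> \<le> 1 - cos (p $ i)" using p(1) by (intro one_minus_cos_ge) (auto simp: obox_def less_imp_le)
      also have "\<dots> \<le> eps p" unfolding eps_def by (rule member_le_sum) auto
      finally show ?thesis by simp
    qed
    have loc: "strong_coupling \<gamma> \<mu> z C" if "- \<mu> \<le> z" "z \<le> - \<mu> + C" for z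
      using \<gamma>0 m(1) that by unfold_locales (auto simp: C_def)
    have ob0: "0 \<in> obox" and ob1: "(\<chi> i. 1) \<in> obox" using pi_gt3 by (auto simp: obox_def)
    \<comment> \<open>Between the origin and \<open>(1, 1, 1)\<close> the function
      \<open>eps\<close> rises by at least \<open>2 / pi\<^sup>2\<close>, more than the error
      allowed in \<open>w_diff\<close>, so \<open>w\<close> cannot vanish at both points.\<close>
    have nonconst: "\<exists>q\<in>obox. Lam \<gamma> \<mu> K z q \<noteq> 0" if "- \<mu> \<le> z" "z \<le> - \<mu> + (12 + 6 * \<gamma>)" for z
    proof (rule ccontr)
      assume n: "\<not> ?thesis"
      interpret strong_coupling \<gamma> \<mu> z K C by (rule loc) (use that in \<open>auto simp: C_def\<close>)
      have "w (\<chi> i. 1) = 0" "w 0 = 0" using n ob0 ob1 by (auto simp: w_def)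
      then have "eps (\<chi> i. 1) \<le> 1 / pi\<^sup>2" using w_diff[of "\<chi> i. 1" 0] errpi eps0 by simp
      moreover have "2 / pi\<^sup>2 \<le> eps (\<chi> i. 1)" by (rule out[OF ob1]) simp
      moreover have "1 / pi\<^sup>2 < 2 / pi\<^sup>2" by (intro divide_strict_right_mono) auto
      ultimately show False by simp
    qed
    assume "eigenvalues_below_ess torus2_measure L2a (H_op \<gamma> \<mu> K) \<noteq> {}"
    then obtain e where ev: "is_eigenvalue torus2_measure L2a (H_op \<gamma> \<mu> K) (complex_of_real e)"
      and below: "ereal e < inf_ess_spectrum torus2_measure L2a (H_op \<gamma> \<mu> K)"
      by (auto simp: eigenvalues_below_ess_def)
    \<comment> \<open>The minimum with -1 supplies a negative energy before \<open>e\<close> is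
      known to be negative.\<close>
    have Lpos: "0 < Lam \<gamma> \<mu> K (min e (-1)) q" if q: "q \<in> obox" for q
    proof (rule ccontr)
      assume "\<not> ?thesis"
      then have "Lam \<gamma> \<mu> K (min e (-1)) q \<le> 0" by simp
      then have "inf_ess_spectrum torus2_measure L2a (H_op \<gamma> \<mu> K) \<le> ereal (min e (-1))"
        by (intro inf_ess_spectrum_le[OF \<gamma>0 \<mu>p _ q]) (use nonconst in auto)
      also have "\<dots> \<le> ereal e" by simp
      finally show False using below by simp
    qed
    \<comment> \<open>At energy -1 the upper bound for \<open>Lam\<close> is already negative for
      large \<open>\<mu>\<close>, against the positivity just shown.\<close>
    have e1: "e < - 1"
    proof (rule ccontr)
      assume "\<not> ?thesis"
      then have "0 < Lam \<gamma> \<mu> K (-1) 0" using Lpos[OF ob0] by (simp add: min_def split: if_splits)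
      also have "\<dots> \<le> 1 - \<mu> / (12 + 6 * \<gamma> - (-1))" by (rule Lam_bounds(2)[OF \<gamma>0 _ \<mu>p]) simp
      finally have "\<mu> < C + 1" using C by (simp add: C_def field_simps)
      then show False using m(1) C by simp
    qed
    then have e0: "e < 0" by simp
    have Lpos: "0 < Lam \<gamma> \<mu> K e q" if q: "q \<in> obox" for q
      using Lpos[OF q] e1 by (simp add: min_absorb1)
    have "0 < 1 - \<mu> / (12 + 6 * \<gamma> - e)" using Lpos[OF ob0] Lam_bounds(2)[OF \<gamma>0 e0 \<mu>p, of K 0] by simp
    then have e2: "e \<le> - \<mu> + C" using e0 \<gamma> by (simp add: C_def field_simps)
    obtain v where v: "Hop \<gamma> \<mu> K v = e *\<^sub>R v" "v \<noteq> 0"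
    proof -
      obtain f where f: "f \<in> eigenspace torus2_measure L2a (H_op \<gamma> \<mu> K) (complex_of_real e)"
        "\<not> (AE x in torus2_measure. f x = 0)" using ev by (auto simp: is_eigenvalue_def)
      then have "f \<in> L2a" "hre f \<noteq> 0 \<or> him f \<noteq> 0"
        using AE_eq_iff_hilb[of f "\<lambda>_. 0"] by (auto simp: eigenspace_iff L2a_zero)
      then show ?thesis using f(1) that by (auto simp: eigenspace_iff)
    qed
    obtain u where u: "asq u" "v = abs_hilb u" by (rule hilb_cases)
    interpret strong_coupling \<gamma> \<mu> e K C
      by (rule loc) (use eigenvector_ge[OF \<gamma>0 _ v] \<mu>p e2 in auto)
    have a: "sq_int torus_measure (asec u)" by (rule sq_int_asec[OF asqD(1)[OF u(1)]])
    have wm: "w \<in> borel_measurable torus_measure" by (rule continuous_imp_torus_measurable) (rule w_continuous)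
    have wpos: "0 < w q" if "q \<in> obox" for q using Lpos[OF that] \<mu>p by (simp add: w_def)
    have wge: "eps p - 12 * C\<^sup>2 / \<mu> \<le> w p" for p using w_diff[of p 0] wpos[OF ob0] eps0 by simp
    have "2 * C3 \<le> \<mu>" using m(4) by (simp add: k3_def C3_def)
    from w_quadratic_lower_bound[OF this wpos] obtain d
      where d: "\<And>q. (\<And>i. \<bar>q $ i\<bar> \<le> 1) \<Longrightarrow> 1 / (4 * pi\<^sup>2) * (norm (q - d))\<^sup>2 \<le> w q" by blast
    have "AE p in torus_measure. asec u p = 0"
    proof (rule pos[OF wm wpos _ d _ Rem_measurable _ a integral_asec[OF u(1)]])
      show "eps p - \<eta> \<le> w p" for p using wge[of p] err\<eta> by simp
      show "1 / pi\<^sup>2 \<le> w p" if p: "p \<in> obox" "\<exists>i. 1 < \<bar>p $ i\<bar>" for p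
      proof -
        have "2 / pi\<^sup>2 \<le> eps p" using p out less_imp_le by blast
        moreover have "2 / pi\<^sup>2 = 1 / pi\<^sup>2 + 1 / pi\<^sup>2" by simp
        ultimately show ?thesis using wge[of p] errpi by linarith
      qed
      show "\<bar>Rem x\<bar> \<le> \<eta>" for x
      proof -
        have "C4 / \<eta> \<le> \<mu>" using m(5) by (simp only: C4_def k4_def)
        then have "C4 / \<mu> \<le> \<eta>" using \<mu>p \<eta> by (simp add: pos_divide_le_eq mult.commute)
        then show ?thesis using Rem_le[of x] by linarith
      qed
      have "sq_int torus_measure (\<lambda>p. w p * asec u p)"
      proof (rule sq_int_mult_bounded[OF a wm])
        show "AE p in torus_measure. \<bar>w p\<bar> \<le> \<mu>"
          using AE_obox
        proof eventually_elim
          case (elim p)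
          have "0 \<le> \<mu> / (12 + 6 * \<gamma> - e)" using \<mu>p \<gamma>0 e0 by simp
          then have "Lam \<gamma> \<mu> K e p \<le> 1" using Lam_bounds(2)[OF \<gamma>0 e0 \<mu>p, of K p] by linarith
          then have "w p \<le> \<mu>" using \<mu>p by (simp add: w_def)
          then show ?case using wpos[OF elim] by simp
        qed
      qed
      from sq_int_mult_integrable[OF this a]
      show "integrable torus_measure (\<lambda>p. w p * (asec u p)\<^sup>2)" by (simp add: power2_eq_square mult.assoc)
      show "(\<integral>p. w p * (asec u p)\<^sup>2 \<partial>torus_measure) + \<gamma> / vol * qker K (asec u)
        + (\<integral>x. Rem x * (asec u (fst x) * asec u (snd x)) \<partial>torus2_measure) \<le> 0"
        using eigenvector_section(2)[OF \<gamma>0 e0 u(1) v(1)[unfolded u(2)]] inverse_D_form[OF a integral_asec[OF u(1)]]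
        unfolding w_def D_def by linarith
    qed
    then have "abs_hilb u = 0" by (rule eigenvector_section(1)[OF \<gamma>0 e0 u(1) v(1)[unfolded u(2)]])
    then show False using v(2) u(2) by simp
  qed
  moreover have "0 < \<mu>0" using C nn k unfolding \<mu>0_def by linarith
  ultimately show ?thesis by blast
qed

theorem theorem1p2:
  fixes K :: "real^3"
  assumes "K \<in> torus"
  shows "\<exists>\<gamma>\<^sub>1 > 0. \<exists>\<gamma>\<^sub>1' > 0.
    (\<forall>\<gamma>::real. 0 < \<gamma> \<and> \<gamma> < \<gamma>\<^sub>1 \<longrightarrow>
       (\<exists>\<mu>\<^sub>1 > 0. \<forall>\<mu> > \<mu>\<^sub>1. eigenvalues_below_ess torus2_measure L2a (H_op \<gamma> \<mu> K) = {})) \<and>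
    (\<forall>\<gamma> > \<gamma>\<^sub>1.
       (\<exists>\<mu>\<^sub>2 > 0. \<forall>\<mu> > \<mu>\<^sub>2. eigenvalues_below_ess torus2_measure L2a (H_op \<gamma> \<mu> K) \<noteq> {})) \<and>
    (\<forall>\<gamma> > \<gamma>\<^sub>1'.
       (\<exists>\<mu>\<^sub>3 > 0. \<forall>\<mu> > \<mu>\<^sub>3. number_below_ess torus2_measure L2a (H_op \<gamma> \<mu> K) \<ge> 3))"
proof -
  obtain \<gamma>s where s: "0 < \<gamma>s" "\<gamma>s \<in> subcritical K" using small_mass_ratio_subcritical by blast
  then have pos: "0 < Sup (subcritical K)" using cSup_upper[OF s(2) bdd_above_subcritical] by simp
  have "\<exists>\<mu>\<^sub>1>0. \<forall>\<mu>>\<mu>\<^sub>1. eigenvalues_below_ess torus2_measure L2a (H_op \<gamma> \<mu> K) = {}"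
    if \<gamma>: "0 < \<gamma> \<and> \<gamma> < Sup (subcritical K)" for \<gamma>
  proof -
    \<comment> \<open>Strictness below the supremum provides the spare coupling
      \<open>\<gamma>'\<close> on which the perturbation argument lives.\<close>
    obtain \<gamma>' where "\<gamma>' \<in> subcritical K" "\<gamma> < \<gamma>'"
      using \<gamma> s(2) less_cSup_iff[OF _ bdd_above_subcritical, of K \<gamma>] by auto
    then show ?thesis using no_eigenvalue_if_subcritical \<gamma> by blast
  qed
  moreover have "\<exists>\<mu>\<^sub>2>0. \<forall>\<mu>>\<mu>\<^sub>2. eigenvalues_below_ess torus2_measure L2a (H_op \<gamma> \<mu> K) \<noteq> {}"
    if \<gamma>: "Sup (subcritical K) < \<gamma>" for \<gamma>
  proof (rule eigenvalue_if_supercritical)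
    show "0 \<le> \<gamma>" using \<gamma> pos by simp
    show "\<gamma> \<notin> subcritical K" using \<gamma> cSup_upper[OF _ bdd_above_subcritical, of \<gamma> K] by auto
  qed
  ultimately have *: "(\<forall>\<gamma>. 0 < \<gamma> \<and> \<gamma> < Sup (subcritical K) \<longrightarrow>
       (\<exists>\<mu>\<^sub>1 > 0. \<forall>\<mu> > \<mu>\<^sub>1. eigenvalues_below_ess torus2_measure L2a (H_op \<gamma> \<mu> K) = {})) \<and>
    (\<forall>\<gamma> > Sup (subcritical K).
       (\<exists>\<mu>\<^sub>2 > 0. \<forall>\<mu> > \<mu>\<^sub>2. eigenvalues_below_ess torus2_measure L2a (H_op \<gamma> \<mu> K) \<noteq> {})) \<and>
    (\<forall>\<gamma> > 12.
       (\<exists>\<mu>\<^sub>3 > 0. \<forall>\<mu> > \<mu>\<^sub>3. number_below_ess torus2_measure L2a (H_op \<gamma> \<mu> K) \<ge> 3))"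
    using number_below_ess_ge_3 by blast
  show ?thesis
    by (rule exI[of _ "Sup (subcritical K)"], rule conjI, rule pos, rule exI[of _ 12], rule conjI) (simp, rule *)
qed

end
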